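(* Let $(E,\rho)$ be a Polish space, let $(P_t)_{t\ge 0}$ be the semigroup of a continuous Markov process on $E$, and let $T>0$. For $x\in E$ and $\mu\in\mathscr P(E)$ let $P^x$ and $P^\mu$ be the laws on $E_T=C([0,T];E)$ of the Markov process up to time $T$ started at $x$, respectively with initial distribution $\mu$. Assume that for some constants $c_1,c_2\in(0,\infty)$ one has $$\mathbb W_{2,T}(Q,P^x)^2\le c_1\,H(Q|P^x)\qquad\text{for all } x\in E,\ Q\in\mathscr P(E_T),$$ $$\mathbb W_{2,T}(P^x,P^y)^2\le c_2\,\rho(x,y)^2\qquad\text{for all } x,y\in E.$$ Let $\mu\in\mathscr P(E)$. (1) If there is a constant $c_0\in(0,\infty)$ such that $$\mathbb W_2(\nu,\mu)^2\le c_0\,H(\nu|\mu)\qquad\text{for all }\nu\in\mathscr P(E),$$ then $$\mathbb W_{2,T}(Q,P^\mu)^2\le C\,H(Q|P^\mu)\qquad\text{for all }Q\in\mathscr P(E_T)$$ holds with $C=\big(\sqrt{c_1}+\sqrt{c_0c_2}\big)^2$. (2) On the other hand, if for some constant $C\in(0,\infty)$ one has $\mathbb W_{2,T}(Q,P^\mu)^2\le C\,H(Q|P^\mu)$ for all $Q\in\mathscr P(E_T)$, then $\mathbb W_2(\nu,\mu)^2\le C\,H(\nu|\mu)$ for all $\nu\in\mathscr P(E)$.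
   Context: For a metric space $S$, $\mathscr P(S)$ denotes the set of all (Borel) probability measures on $S$. Free path space: $E_T:=C([0,T];E)$ is the set of continuous maps $[0,T]\to E$, equipped with the metric $\rho_T(\xi,\eta):=\sup_{t\in[0,T]}\rho(\xi_t,\eta_t)$. Path measures: let $P_t(x,\cdot)$ be the Markov transition kernel associated with $(P_t)_{t\ge0}$. For $\mu\in\mathscr P(E)$, $P^\mu$ is the unique probability measure on $E_T$ such that for all $0=t_0<t_1<\cdots<t_n=T$ and Borel sets $A_0,\dots,A_n\subset E$, $$P^\mu(X_{t_i}\in A_i,\ 0\le i\le n)=\int_{A_0}\mu(\mathrm dx_0)\int_{A_1}P_{t_1-t_0}(x_0,\mathrm dx_1)\cdots\int_{A_n}P_{t_n-t_{n-1}}(x_{n-1},\mathrm dx_n),$$ where $X_t(\xi)=\xi_t$ is the canonical coordinate process on $E_T$. That the Markov process is continuous means that such a measure on $E_T$ exists for every $\mu$. One writes $P^x:=P^{\delta_x}$, where $\delta_x$ is the Dirac measure at $x$; thus $P^\mu=\int_E P^x\,\mu(\mathrm dx)$. Wasserstein distance: for a metric space $(S,d)$ and $\mu_1,\mu_2\in\mathscr P(S)$, the quadratic Wasserstein distance induced by $d$ is $$\inf_{\pi}\Big\{\int_{S\times S}d(x,y)^2\,\pi(\mathrm dx,\mathrm dy)\Big\}^{1/2}\in[0,\infty],$$ the infimum being over all couplings $\pi$ of $\mu_1$ and $\mu_2$. $\mathbb W_2$ denotes this distance on $\mathscr P(E)$ induced by $\rho$, and $\mathbb W_{2,T}$ denotes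 this distance on $\mathscr P(E_T)$ induced by $\rho_T$. Relative entropy: $H(\mu_1|\mu_2):=\int\log\frac{\mathrm d\mu_1}{\mathrm d\mu_2}\,\mathrm d\mu_1$ if $\mu_1$ is absolutely continuous with respect to $\mu_2$, and $H(\mu_1|\mu_2):=\infty$ otherwise. *)

theory Defs
  imports "HOL-Probability.Probability"
begin

subsection \<open>Wasserstein distance and relative entropy\<close>

text \<open>Throughout, the Borel probability measures on a space with Borel \<open>\<sigma>\<close>-algebra \<open>M\<close> are
  the elements of \<open>space (prob_algebra M)\<close>.\<close>

definition couplings :: "'b measure \<Rightarrow> 'b measure \<Rightarrow> ('b \<times> 'b) measure set" where
  "couplings \<mu> \<nu> =
    {\<pi> \<in> space (prob_algebra (\<mu> \<Otimes>\<^sub>M \<nu>)). distr \<pi> \<mu> fst = \<mu> \<and> distr \<pi> \<nu> snd = \<nu>}"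

definition ennreal_sqrt :: "ennreal \<Rightarrow> ennreal" where
  "ennreal_sqrt x = (if x = \<top> then \<top> else ennreal (sqrt (enn2real x)))"

lemma ennreal_sqrt_power2: "(ennreal_sqrt x)\<^sup>2 = x"
proof (cases "x = \<top>")
  case True
  then show ?thesis
    by (simp add: ennreal_sqrt_def power2_eq_square ennreal_top_mult)
next
  case False
  then show ?thesis
    by (simp add: ennreal_sqrt_def ennreal_power less_top)
qed

definition wasserstein2 :: "('b \<Rightarrow> 'b \<Rightarrow> real) \<Rightarrow> 'b measure \<Rightarrow> 'b measure \<Rightarrow> ennreal" where
  "wasserstein2 d \<mu> \<nu> =
    (INF \<pi>\<in>couplings \<mu> \<nu>. ennreal_sqrt (\<integral>\<^sup>+(x, y). ennreal ((d x y)\<^sup>2) \<partial>\<pi>))"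

text \<open>The integral is taken as the integral of the positive part minus that of the negative part,
  because the Bochner integral used in \<^const>\<open>KL_divergence\<close> is \<open>0\<close> where the entropy is infinite.
  The second integral is always finite (at most \<open>1/e\<close>) for probability measures.  Note that
  \<open>absolutely_continuous N M\<close> means that \<open>M\<close> is absolutely continuous with respect to \<open>N\<close>.\<close>

definition relative_entropy :: "'b measure \<Rightarrow> 'b measure \<Rightarrow> ereal" where
  "relative_entropy \<mu> \<nu> =
    (if absolutely_continuous \<nu> \<mu>
     then enn2ereal (\<integral>\<^sup>+x. ennreal (ln (enn2real (RN_deriv \<nu> \<mu> x))) \<partial>\<mu>)
        - enn2ereal (\<integral>\<^sup>+x. ennreal (- ln (enn2real (RN_deriv \<nu> \<mu> x))) \<partial>\<mu>)
     else \<infinity>)"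

subsection \<open>Path space\<close>

text \<open>Paths are functions on \<^typ>\<open>real\<close> that are \<^const>\<open>undefined\<close> outside \<open>{0..T}\<close>.\<close>

definition path_metric :: "real \<Rightarrow> (real \<Rightarrow> 'a::metric_space) metric" where
  "path_metric T = cfunspace (top_of_set {0..T}) euclidean_metric"

lemma mspace_path_metric:
  "mspace (path_metric T) = {\<xi>. continuous_on {0..T} \<xi> \<and> \<xi> \<in> extensional {0..T}}"
proof -
  have "Metric_space.mbounded UNIV dist (\<xi> ` {0..T})" if "continuous_on {0..T} \<xi>"
    for \<xi> :: "real \<Rightarrow> 'a"
  proof -
    have "bounded (\<xi> ` {0..T})"
      using that by (intro compact_imp_bounded compact_continuous_image) auto
    then show ?thesis
      by (simp add: mbounded_iff_bounded)
  qed
  then show ?thesis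
    by (auto simp: path_metric_def)
qed

lemma mdist_path_metric:
  assumes "0 \<le> T" "\<xi> \<in> mspace (path_metric T)" "\<eta> \<in> mspace (path_metric T)"
  shows "mdist (path_metric T) \<xi> \<eta> = (SUP t\<in>{0..T}. dist (\<xi> t) (\<eta> t))"
proof -
  have "\<xi> \<in> Met_TC.fspace {0..T}" "\<eta> \<in> Met_TC.fspace {0..T}"
    using assms(2,3) by (auto simp: path_metric_def Met_TC.fspace_def)
  then show ?thesis
    using assms(1)
    by (simp add: path_metric_def mdist_cfunspace_eq_mdist_funspace Met_TC.fdist_def)
qed

definition path_borel :: "real \<Rightarrow> (real \<Rightarrow> 'a::metric_space) measure" where
  "path_borel T =
    sigma (mspace (path_metric T)) {U. openin (mtopology_of (path_metric T)) U}"

subsection \<open>Markov semigroups and path measures\<close>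

definition markov_semigroup :: "(real \<Rightarrow> 'a::polish_space \<Rightarrow> 'a measure) \<Rightarrow> bool" where
  "markov_semigroup P \<longleftrightarrow>
    (\<forall>t\<ge>0. P t \<in> borel \<rightarrow>\<^sub>M prob_algebra borel) \<and>
    (\<forall>x. P 0 x = return borel x) \<and>
    (\<forall>s\<ge>0. \<forall>t\<ge>0. \<forall>x. P (s + t) x = P s x \<bind> P t)"

text \<open>\<open>iterated_kernel P t A i k x\<close> is the integral over
  \<open>A\<^sub>i\<^sub>+\<^sub>1 \<times> \<dots> \<times> A\<^sub>i\<^sub>+\<^sub>k\<close> of the transitions at the times \<open>t\<^sub>i\<^sub>+\<^sub>1, \<dots>, t\<^sub>i\<^sub>+\<^sub>k\<close>, starting in \<open>x\<close> at time \<open>t\<^sub>i\<close>.\<close>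

primrec iterated_kernel ::
    "(real \<Rightarrow> 'a \<Rightarrow> 'a measure) \<Rightarrow> (nat \<Rightarrow> real) \<Rightarrow> (nat \<Rightarrow> 'a set) \<Rightarrow> nat \<Rightarrow> nat \<Rightarrow> 'a \<Rightarrow> ennreal"
  where
    "iterated_kernel P t A i 0 = (\<lambda>x. 1)"
  | "iterated_kernel P t A i (Suc k) =
      (\<lambda>x. \<integral>\<^sup>+y\<in>A (i + 1). iterated_kernel P t A (i + 1) k y \<partial>P (t (i + 1) - t i) x)"

definition is_path_law ::
    "(real \<Rightarrow> 'a::polish_space \<Rightarrow> 'a measure) \<Rightarrow> real \<Rightarrow> 'a measure \<Rightarrow> (real \<Rightarrow> 'a) measure \<Rightarrow> bool"
  where
  "is_path_law P T \<mu> Q \<longleftrightarrow>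
    Q \<in> space (prob_algebra (path_borel T)) \<and>
    (\<forall>n t A. t 0 = 0 \<and> t n = T \<and> (\<forall>i<n. t i < t (i + 1)) \<and> (\<forall>i\<le>n. A i \<in> sets borel) \<longrightarrow>
      emeasure Q {\<xi> \<in> space Q. \<forall>i\<le>n. \<xi> (t i) \<in> A i}
        = (\<integral>\<^sup>+x\<in>A 0. iterated_kernel P t A 0 n x \<partial>\<mu>))"

definition continuous_markov :: "(real \<Rightarrow> 'a::polish_space \<Rightarrow> 'a measure) \<Rightarrow> real \<Rightarrow> bool" where
  "continuous_markov P T \<longleftrightarrow> (\<forall>\<mu>\<in>space (prob_algebra borel). \<exists>Q. is_path_law P T \<mu> Q)"

definition path_law ::
    "(real \<Rightarrow> 'a::polish_space \<Rightarrow> 'a measure) \<Rightarrow> real \<Rightarrow> 'a measure \<Rightarrow> (real \<Rightarrow> 'a) measure" where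
  "path_law P T \<mu> = (THE Q. is_path_law P T \<mu> Q)"

abbreviation path_law_at ::
    "(real \<Rightarrow> 'a::polish_space \<Rightarrow> 'a measure) \<Rightarrow> real \<Rightarrow> 'a \<Rightarrow> (real \<Rightarrow> 'a) measure" where
  "path_law_at P T x \<equiv> path_law P T (return borel x)"

abbreviation W2 :: "'a::polish_space measure \<Rightarrow> 'a measure \<Rightarrow> ennreal" where
  "W2 \<equiv> wasserstein2 dist"

abbreviation W2_path ::
    "real \<Rightarrow> (real \<Rightarrow> 'a::polish_space) measure \<Rightarrow> (real \<Rightarrow> 'a) measure \<Rightarrow> ennreal" where
  "W2_path T \<equiv> wasserstein2 (mdist (path_metric T))"

end

theory Submission
  imports Defs
begin

text \<open>Let \<open>Q\<close> have density \<open>F\<close> with respect to \<open>P\<^sup>\<mu> = \<integral> P\<^sup>x \<mu>(dx)\<close> and put \<open>f x = \<integral> F dP\<^sup>x\<close>,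
  \<open>\<nu> = f \<mu>\<close> and \<open>Q\<^sup>x = (F / f x) P\<^sup>x\<close>.  Then \<open>Q = \<integral> Q\<^sup>x \<nu>(dx)\<close> and
  \<open>H(Q|P\<^sup>\<mu>) = H(\<nu>|\<mu>) + \<integral> H(Q\<^sup>x|P\<^sup>x) \<nu>(dx)\<close>.  The triangle inequality through \<open>P\<^sup>\<nu>\<close> and the
  convexity of the squared Wasserstein distance under mixtures bound the distance of \<open>Q\<close> and
  \<open>P\<^sup>\<mu>\<close> by these two entropies.  Conversely, for \<open>\<nu> = f \<mu>\<close> the measure with density \<open>f(X\<^sub>0)\<close> with
  respect to \<open>P\<^sup>\<mu>\<close> has the same entropy as \<open>\<nu>\<close> and the evaluation \<open>X\<^sub>0\<close> is a contraction.

  The triangle inequality and the convexity are obtained without disintegration and without a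
  measurable selection theorem: a countable partition into cells of small diameter replaces
  couplings by countable matrices with prescribed row and column sums, up to an arbitrarily small
  error.  Matrices can be glued explicitly, and a near-optimal matrix can be chosen measurably in a
  parameter because it dominates one of countably many finite rational matrices; the small
  remainder is coupled independently.  The cost of the remainder is controlled by the second
  moments of \<open>P\<^sup>x\<close>, whose finiteness follows from the transport inequality applied to \<open>P\<^sup>x\<close>
  conditioned on a ball.\<close>

section \<open>Couplings of countable distributions\<close>

text \<open>Mixing couplings of \<open>Q^x\<close> and \<open>P^x\<close> requires them to depend
  measurably on x. Cells make this a countable question, but a matrix on finitely many cells leaves
  mass over, and small mass alone is no bound on cost when the metric is unbounded; this is why
  second moments enter. Squared distances are likewise stable under passing to cell representatives
  only up to a factor \<open>1 + t\<close> and an additive \<open>t\<close>, both removed by letting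
  t tend to 0. All estimates concern squared costs in the extended nonnegative reals, and Young's
  inequality with a free weight stands in for the triangle inequality of the root. The entropy is
  written with the nonnegative integrand u ln u - u + 1, so that the chain rule needs no subtraction
  of possibly infinite terms. The constant arises because the two legs of the triangle are at most
  sqrt(c1 H) and sqrt(c0 c2 H), H being the total entropy.\<close>

lemma ennreal_suminf_swap:
  fixes f :: "nat \<Rightarrow> nat \<Rightarrow> ennreal"
  shows "(\<Sum>i. \<Sum>j. f i j) = (\<Sum>j. \<Sum>i. f i j)"
proof -
  have "(\<Sum>i. \<Sum>j. f i j) = (\<integral>\<^sup>+i. (\<Sum>j. f i j) \<partial>count_space UNIV)"
    by (simp add: nn_integral_count_space_nat)
  also have "\<dots> = (\<Sum>j. \<integral>\<^sup>+i. f i j \<partial>count_space UNIV)"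
    by (rule nn_integral_suminf) simp
  finally show ?thesis
    by (simp add: nn_integral_count_space_nat)
qed

lemma ennreal_suminf_add: "(\<Sum>i. f i + g i :: ennreal) = (\<Sum>i. f i) + (\<Sum>i. g i)"
  by (simp add: suminf_add)

lemma ennreal_suminf_mono: "(\<And>i. f i \<le> (g i :: ennreal)) \<Longrightarrow> (\<Sum>i. f i) \<le> (\<Sum>i. g i)"
  by (intro suminf_le) auto

lemma ennreal_le_suminf: "f i \<le> (\<Sum>i. f i :: ennreal)"
  using sum_le_suminf[of f "{i}"] by simp

lemma ennreal_mult_divide_self: "(b = 0 \<Longrightarrow> a = 0) \<Longrightarrow> b \<noteq> \<top> \<Longrightarrow> a * b / b = (a :: ennreal)"
  by (metis ennreal_mult_divide_eq mult_zero_left ennreal_zero_divide)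

lemma ennreal_add_diff_self: "a \<le> b \<Longrightarrow> a + (b - a) = (b::ennreal)"
  by (metis add.commute diff_add_cancel_ennreal)

section \<open>Matrices with prescribed row and column sums\<close>

definition matrix_coupling ::
    "(nat \<Rightarrow> ennreal) \<Rightarrow> (nat \<Rightarrow> ennreal) \<Rightarrow> (nat \<Rightarrow> nat \<Rightarrow> ennreal) \<Rightarrow> bool" where
  "matrix_coupling p q a \<longleftrightarrow> (\<forall>i. (\<Sum>j. a i j) = p i) \<and> (\<forall>j. (\<Sum>i. a i j) = q j)"

lemma matrix_coupling_0:
  assumes "matrix_coupling p q a"
  shows "p i = 0 \<Longrightarrow> a i j = 0" and "q j = 0 \<Longrightarrow> a i j = 0"
  using assms ennreal_le_suminf[of "\<lambda>j. a i j" j] ennreal_le_suminf[of "\<lambda>i. a i j" i]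
  by (auto simp: matrix_coupling_def)

lemma matrix_coupling_weighted_fst:
  assumes "matrix_coupling p q a"
  shows "(\<Sum>i. \<Sum>j. a i j * u i) = (\<Sum>i. p i * u i)"
  using assms by (simp add: matrix_coupling_def)

lemma matrix_coupling_weighted_snd:
  assumes "matrix_coupling p q a"
  shows "(\<Sum>i. \<Sum>j. a i j * v j) = (\<Sum>j. q j * v j)"
  using assms by (subst ennreal_suminf_swap) (simp add: matrix_coupling_def)

text \<open>Given the shared index \<open>j\<close>, the indices \<open>i\<close> and
  \<open>k\<close> are made independent: \<open>t\<close> is the resulting three-index array, with
  \<open>a\<close> and \<open>b\<close> as its two-index sums, and the bound on \<open>G13\<close>
  is summed against it. Three separate costs leave room for different weights on the two
  legs.\<close>

lemma matrix_coupling_glue: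
  assumes a: "matrix_coupling p q a" and b: "matrix_coupling q r b"
    and fin: "\<And>j. q j \<noteq> \<top>"
    and G: "\<And>i j k. G13 i k \<le> G12 i j + G23 j k"
  obtains c where "matrix_coupling p r c"
    and "(\<Sum>i. \<Sum>k. c i k * G13 i k) \<le> (\<Sum>i. \<Sum>j. a i j * G12 i j) + (\<Sum>j. \<Sum>k. b j k * G23 j k)"
proof
  define t where "t i j k = a i j * b j k / q j" for i j k
  define c where "c i k = (\<Sum>j. t i j k)" for i k
  have sum_b: "(\<Sum>k. b j k) = q j" and sum_a: "(\<Sum>i. a i j) = q j" for j
    using a b by (auto simp: matrix_coupling_def)
  \<comment> \<open>Where \<open>q j = 0\<close> the \<open>j\<close>-th column of \<open>a\<close>
    vanishes as well, so the value \<open>0 / 0 = 0\<close> restores it.\<close>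
  have a0: "a i j * q j / q j = a i j" for i j
    using matrix_coupling_0(2)[OF a] fin by (intro ennreal_mult_divide_self) auto
  have b0: "q j * b j k / q j = b j k" for j k
    using matrix_coupling_0(1)[OF b, of j k] ennreal_mult_divide_self[of "q j" "b j k"] fin
    by (auto simp: mult.commute)
  have t_k: "(\<Sum>k. t i j k) = a i j" for i j
    using a0 sum_b by (simp add: t_def)
  have t_i: "(\<Sum>i. t i j k) = b j k" for j k
    using b0 sum_a by (simp add: t_def)
  show "matrix_coupling p r c"
    unfolding matrix_coupling_def
  proof safe
    fix i
    have "(\<Sum>k. c i k) = (\<Sum>j. \<Sum>k. t i j k)"
      unfolding c_def by (rule ennreal_suminf_swap)
    then show "(\<Sum>k. c i k) = p i"
      using a by (simp add: t_k matrix_coupling_def)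
  next
    fix k
    have "(\<Sum>i. c i k) = (\<Sum>j. \<Sum>i. t i j k)"
      unfolding c_def by (rule ennreal_suminf_swap)
    then show "(\<Sum>i. c i k) = r k"
      using b by (simp add: t_i matrix_coupling_def)
  qed
  have "(\<Sum>i. \<Sum>k. c i k * G13 i k) = (\<Sum>i. \<Sum>k. \<Sum>j. t i j k * G13 i k)"
    by (simp add: c_def)
  also have "\<dots> \<le> (\<Sum>i. \<Sum>k. \<Sum>j. t i j k * G12 i j + t i j k * G23 j k)"
    using G by (intro ennreal_suminf_mono) (metis distrib_left mult_left_mono zero_le)
  also have "\<dots> = (\<Sum>i. \<Sum>k. \<Sum>j. t i j k * G12 i j) + (\<Sum>i. \<Sum>k. \<Sum>j. t i j k * G23 j k)"
    by (simp add: ennreal_suminf_add)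
  also have "(\<Sum>i. \<Sum>k. \<Sum>j. t i j k * G12 i j) = (\<Sum>i. \<Sum>j. \<Sum>k. t i j k * G12 i j)"
    by (subst (2) ennreal_suminf_swap) rule
  also have "\<dots> = (\<Sum>i. \<Sum>j. a i j * G12 i j)"
    by (simp add: t_k)
  also have "(\<Sum>i. \<Sum>k. \<Sum>j. t i j k * G23 j k) = (\<Sum>k. \<Sum>i. \<Sum>j. t i j k * G23 j k)"
    by (rule ennreal_suminf_swap)
  also have "\<dots> = (\<Sum>k. \<Sum>j. \<Sum>i. t i j k * G23 j k)"
    by (subst (2) ennreal_suminf_swap) rule
  also have "\<dots> = (\<Sum>k. \<Sum>j. b j k * G23 j k)"
    by (simp add: t_i)
  also have "\<dots> = (\<Sum>j. \<Sum>k. b j k * G23 j k)"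
    by (rule ennreal_suminf_swap)
  finally show "(\<Sum>i. \<Sum>k. c i k * G13 i k)
      \<le> (\<Sum>i. \<Sum>j. a i j * G12 i j) + (\<Sum>j. \<Sum>k. b j k * G23 j k)" .
qed

text \<open>Coding by a size and a nested list of numerators over that same size makes the family
  countable, so that \<open>from_nat\<close> can enumerate it.\<close>

definition grid_matrix :: "nat \<times> nat list list \<Rightarrow> nat \<Rightarrow> nat \<Rightarrow> ennreal" where
  "grid_matrix c i j =
    (if i < fst c \<and> j < fst c then ennreal (real (snd c ! i ! j) / real (fst c)) else 0)"

text \<open>Rounding \<open>b\<close> down to multiples of \<open>1 / N\<close> and cutting it off
  at index \<open>N\<close> gives matrices below \<open>b\<close> that converge to it entrywise. The
  weighted error is dominated by the summable \<open>b * w\<close>, so dominated convergence for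
  counting measure on pairs makes it small.\<close>

lemma grid_matrix_approx:
  assumes fin: "\<And>i j. b i j \<noteq> \<top>" and w: "\<And>i j. w i j \<noteq> \<top>"
    and sum: "(\<Sum>i. \<Sum>j. b i j * w i j) \<noteq> \<top>" and e: "e > 0"
  obtains c where "\<And>i j. grid_matrix c i j \<le> b i j"
    and "(\<Sum>i. \<Sum>j. (b i j - grid_matrix c i j) * w i j) \<le> e"
proof -
  define c where "c N = (N, map (\<lambda>i. map (\<lambda>j. nat \<lfloor>real N * enn2real (b i j)\<rfloor>) [0..<N]) [0..<N])"
    for N :: nat
  have grid: "grid_matrix (c N) i j = ennreal (real_of_int \<lfloor>real N * enn2real (b i j)\<rfloor> / real N)"
    if "i < N" "j < N" for N i j
    using that by (simp add: grid_matrix_def c_def)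
  have le: "grid_matrix (c N) i j \<le> b i j" for N i j
  proof (cases "i < N \<and> j < N")
    case True
    have "real_of_int \<lfloor>real N * enn2real (b i j)\<rfloor> / real N \<le> enn2real (b i j)"
      using True by (simp add: divide_le_eq mult.commute)
    then show ?thesis
      using True fin[of i j] by (auto simp: grid less_top intro: order_trans[OF ennreal_leI])
  qed (auto simp: grid_matrix_def c_def)
  define f where "f N ij = (b (fst ij) (snd ij) - grid_matrix (c N) (fst ij) (snd ij)) * w (fst ij) (snd ij)"
    for N ij
  have lim: "(\<lambda>N. f N ij) \<longlonglongrightarrow> 0" for ij
  proof -
    obtain i j where ij: "ij = (i, j)" by force
    obtain \<beta> where \<beta>: "b i j = ennreal \<beta>" "\<beta> \<ge> 0" using fin[of i j] by (cases "b i j") auto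
    obtain \<omega> where \<omega>: "w i j = ennreal \<omega>" "\<omega> \<ge> 0" using w[of i j] by (cases "w i j") auto
    have "(\<lambda>N. ennreal (1 / real N * \<omega>)) \<longlonglongrightarrow> ennreal (0 * \<omega>)"
      by (intro tendsto_ennrealI tendsto_mult lim_1_over_n tendsto_const)
    moreover have "\<forall>\<^sub>F N in sequentially. f N ij \<le> ennreal (1 / real N * \<omega>)"
      using eventually_gt_at_top[of "max i j"]
    proof eventually_elim
      case (elim N)
      then have N: "i < N" "j < N" by auto
      have "\<beta> - real_of_int \<lfloor>real N * \<beta>\<rfloor> / real N \<le> 1 / real N"
      proof -
        have "\<beta> * real N - 1 \<le> real_of_int \<lfloor>real N * \<beta>\<rfloor>"
          using floor_correct[of "real N * \<beta>"] by (simp add: mult.commute)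
        then have "(\<beta> * real N - 1) / real N \<le> real_of_int \<lfloor>real N * \<beta>\<rfloor> / real N"
          by (rule divide_right_mono) simp
        then show ?thesis
          using N by (simp add: diff_divide_distrib)
      qed
      moreover have "f N ij = ennreal ((\<beta> - real_of_int \<lfloor>real N * \<beta>\<rfloor> / real N) * \<omega>)"
        using \<beta> \<omega> by (simp add: f_def ij grid[OF N] ennreal_minus ennreal_mult'')
      ultimately show ?case
        by (metis \<omega>(2) ennreal_leI mult_right_mono)
    qed
    ultimately show ?thesis
      using tendsto_sandwich[of "\<lambda>_. 0" "\<lambda>N. f N ij", OF _ _ tendsto_const] by simp
  qed
  have "(\<lambda>N. \<integral>\<^sup>+ij. f N ij \<partial>count_space UNIV) \<longlonglongrightarrow> (\<integral>\<^sup>+ij. 0 \<partial>count_space (UNIV :: (nat \<times> nat) set))"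
  proof (rule nn_integral_dominated_convergence)
    show "AE ij in count_space UNIV. f N ij \<le> b (fst ij) (snd ij) * w (fst ij) (snd ij)" for N
      by (auto simp: f_def intro!: mult_right_mono diff_le_self_ennreal)
    have "(\<integral>\<^sup>+ij. b (fst ij) (snd ij) * w (fst ij) (snd ij) \<partial>count_space UNIV)
        = (\<Sum>i. \<Sum>j. b i j * w i j)"
      by (subst nn_integral_fst_count_space[symmetric]) (simp add: nn_integral_count_space_nat)
    then show "(\<integral>\<^sup>+ij. b (fst ij) (snd ij) * w (fst ij) (snd ij) \<partial>count_space UNIV) < \<infinity>"
      using sum by (simp add: less_top)
  qed (use lim in auto)
  then have "\<forall>\<^sub>F N in sequentially. (\<integral>\<^sup>+ij. f N ij \<partial>count_space UNIV) < e"
    using e by (intro order_tendstoD(2)[where y=0]) auto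
  then obtain N where "(\<integral>\<^sup>+ij. f N ij \<partial>count_space UNIV) < e"
    by (auto simp: eventually_sequentially)
  moreover have "(\<integral>\<^sup>+ij. f N ij \<partial>count_space UNIV)
      = (\<Sum>i. \<Sum>j. (b i j - grid_matrix (c N) i j) * w i j)"
    by (subst nn_integral_fst_count_space[symmetric]) (simp add: nn_integral_count_space_nat f_def)
  ultimately show thesis
    using that[of "c N"] le by auto
qed

text \<open>If the sub-coupling \<open>c\<close> already has mass 1, the denominator is 0; the numerator then
  vanishes as well, and \<open>0 / 0 = 0\<close>.\<close>

definition residual_completion ::
    "(nat \<Rightarrow> ennreal) \<Rightarrow> (nat \<Rightarrow> ennreal) \<Rightarrow> (nat \<Rightarrow> nat \<Rightarrow> ennreal) \<Rightarrow> nat \<Rightarrow> nat \<Rightarrow> ennreal" where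
  "residual_completion p q c i j = c i j
    + (p i - (\<Sum>j. c i j)) * (q j - (\<Sum>i. c i j)) / (1 - (\<Sum>i. \<Sum>j. c i j))"

text \<open>Residual rows and residual columns have the same total \<open>\<eta>\<close>, so their
  product divided by \<open>\<eta>\<close> couples them. Since \<open>G i j \<le> u i + v j\<close>,
  the cost of that product sees only its marginals, that is, the weighted residual masses bounded by
  \<open>e\<close>.\<close>

lemma residual_completion:
  assumes p: "(\<Sum>i. p i) = 1" and q: "(\<Sum>j. q j) = 1"
    and r_le: "\<And>i. (\<Sum>j. c i j) \<le> p i" and s_le: "\<And>j. (\<Sum>i. c i j) \<le> q j"
    and G: "\<And>i j. G i j \<le> u i + v j"
    and e: "(\<Sum>i. (p i - (\<Sum>j. c i j)) * u i) + (\<Sum>j. (q j - (\<Sum>i. c i j)) * v j) \<le> e"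
  shows "matrix_coupling p q (residual_completion p q c)"
    and "(\<Sum>i. \<Sum>j. residual_completion p q c i j * G i j) \<le> (\<Sum>i. \<Sum>j. c i j * G i j) + e"
proof -
  define r where "r i = (\<Sum>j. c i j)" for i
  define s where "s j = (\<Sum>i. c i j)" for j
  define \<eta> where "\<eta> = 1 - (\<Sum>i. r i)"
  have r_s: "(\<Sum>i. r i) = (\<Sum>j. s j)"
    unfolding r_def s_def by (rule ennreal_suminf_swap)
  have le: "r i \<le> p i" "s j \<le> q j" for i j
    using r_le s_le by (auto simp: r_def s_def)
  have r_fin: "(\<Sum>i. r i) \<noteq> \<top>"
    using ennreal_suminf_mono[of r p] le p by (auto simp: top_unique)
  have p_r: "(\<Sum>i. p i - r i) = \<eta>"
    using ennreal_suminf_minus[of r p] le p r_fin by (simp add: \<eta>_def)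
  have q_s: "(\<Sum>j. q j - s j) = \<eta>"
    using ennreal_suminf_minus[of s q] le q r_fin r_s by (simp add: \<eta>_def)
  have \<eta>_fin: "\<eta> \<noteq> \<top>"
    by (simp add: \<eta>_def)
  have p_r0: "(p i - r i) * \<eta> / \<eta> = p i - r i" for i
    using ennreal_le_suminf[of "\<lambda>i. p i - r i" i] p_r \<eta>_fin by (intro ennreal_mult_divide_self) auto
  have q_s0: "\<eta> * (q j - s j) / \<eta> = q j - s j" for j
    using ennreal_le_suminf[of "\<lambda>j. q j - s j" j] q_s \<eta>_fin
    by (subst mult.commute) (intro ennreal_mult_divide_self, auto)
  define t where "t i j = (p i - r i) * (q j - s j) / \<eta>" for i j
  have comp: "residual_completion p q c i j = c i j + t i j" for i j
    by (simp add: residual_completion_def r_def s_def \<eta>_def t_def)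
  have t: "matrix_coupling (\<lambda>i. p i - r i) (\<lambda>j. q j - s j) t"
    using p_r0 q_s0 by (simp add: matrix_coupling_def t_def p_r q_s)
  show "matrix_coupling p q (residual_completion p q c)"
    unfolding matrix_coupling_def comp using t le
    by (simp add: ennreal_suminf_add matrix_coupling_def ennreal_add_diff_self
        flip: r_def s_def)
  have "(\<Sum>i. \<Sum>j. residual_completion p q c i j * G i j)
      \<le> (\<Sum>i. \<Sum>j. c i j * G i j) + (\<Sum>i. \<Sum>j. t i j * (u i + v j))"
    unfolding comp distrib_right ennreal_suminf_add distrib_left[symmetric]
    using G by (intro add_left_mono ennreal_suminf_mono mult_left_mono) auto
  also have "(\<Sum>i. \<Sum>j. t i j * (u i + v j)) \<le> e"
    unfolding distrib_left ennreal_suminf_add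
      matrix_coupling_weighted_fst[OF t] matrix_coupling_weighted_snd[OF t]
    using e by (simp add: r_def s_def)
  finally show "(\<Sum>i. \<Sum>j. residual_completion p q c i j * G i j) \<le> (\<Sum>i. \<Sum>j. c i j * G i j) + e"
    by (simp add: add_left_mono)
qed

text \<open>For each code \<open>n\<close>, admissibility \<open>ok n x\<close> is a countable
  system of inequalities between measurable functions of \<open>x\<close>, so the least admissible
  code depends measurably on \<open>x\<close>. A coupling \<open>b\<close> of cost at most
  \<open>g x\<close> has an admissible rational matrix below it. Where no code is admissible,
  \<open>a\<close> is still measurable and nothing is claimed about it.\<close>

lemma measurable_matrix_coupling:
  fixes p q :: "'x \<Rightarrow> nat \<Rightarrow> ennreal" and G :: "nat \<Rightarrow> nat \<Rightarrow> ennreal"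
  assumes [measurable]: "\<And>i. (\<lambda>x. p x i) \<in> borel_measurable M"
      "\<And>j. (\<lambda>x. q x j) \<in> borel_measurable M" "g \<in> borel_measurable M"
    and G: "\<And>i j. G i j \<le> u i + v j"
    and u: "\<And>i. u i \<noteq> \<top>" and v: "\<And>j. v j \<noteq> \<top>" and e: "e > 0"
  obtains a where "\<And>i j. (\<lambda>x. a x i j) \<in> borel_measurable M"
    and "\<And>x b. (\<Sum>i. p x i) = 1 \<Longrightarrow> (\<Sum>j. q x j) = 1 \<Longrightarrow> matrix_coupling (p x) (q x) b
      \<Longrightarrow> (\<Sum>i. \<Sum>j. b i j * G i j) \<le> g x
      \<Longrightarrow> (\<Sum>i. p x i * u i) \<noteq> \<top> \<Longrightarrow> (\<Sum>j. q x j * v j) \<noteq> \<top>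
      \<Longrightarrow> matrix_coupling (p x) (q x) (a x) \<and> (\<Sum>i. \<Sum>j. a x i j * G i j) \<le> g x + e"
proof -
  define C where "C n = grid_matrix (from_nat n)" for n
  \<comment> \<open>The last condition is the one demanded by \<open>residual_completion\<close>:
    the unassigned mass has small weighted moments.\<close>
  define ok where "ok n x \<longleftrightarrow> (\<forall>i. (\<Sum>j. C n i j) \<le> p x i) \<and> (\<forall>j. (\<Sum>i. C n i j) \<le> q x j)
      \<and> (\<Sum>i. \<Sum>j. C n i j * G i j) \<le> g x
      \<and> (\<Sum>i. (p x i - (\<Sum>j. C n i j)) * u i) + (\<Sum>j. (q x j - (\<Sum>i. C n i j)) * v j) \<le> e" for n x
  have ok_meas[measurable]: "Measurable.pred M (ok n)" for n
    unfolding ok_def by measurable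
  define k where "k x = (LEAST n. ok n x)" for x
  have k_meas[measurable]: "k \<in> M \<rightarrow>\<^sub>M count_space UNIV"
    unfolding k_def by (intro measurable_Least) simp
  define a where "a x = residual_completion (p x) (q x) (C (k x))" for x
  show thesis
  proof
    show "(\<lambda>x. a x i j) \<in> borel_measurable M" for i j
      unfolding a_def
    proof (rule measurable_compose_countable[OF _ k_meas])
      show "(\<lambda>x. residual_completion (p x) (q x) (C n) i j) \<in> borel_measurable M" for n
        unfolding residual_completion_def by measurable
    qed
  next
    fix x b
    assume p1: "(\<Sum>i. p x i) = 1" and q1: "(\<Sum>j. q x j) = 1"
      and b: "matrix_coupling (p x) (q x) b" and cost: "(\<Sum>i. \<Sum>j. b i j * G i j) \<le> g x"
      and pu: "(\<Sum>i. p x i * u i) \<noteq> \<top>" and qv: "(\<Sum>j. q x j * v j) \<noteq> \<top>"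
    have b_le: "b i j \<le> p x i" for i j
      using b ennreal_le_suminf[of "b i" j] by (simp add: matrix_coupling_def)
    have p_le: "p x i \<le> 1" for i
      using p1 ennreal_le_suminf[of "p x" i] by simp
    have b_fin: "b i j \<noteq> \<top>" for i j
      using order_trans[OF b_le p_le, of i j] by (auto simp: top_unique)
    \<comment> \<open>The dominating sum for the approximation is computed from the marginals alone;
      this is where the finite moments are used.\<close>
    have w: "(\<Sum>i. \<Sum>j. b i j * (u i + v j)) \<noteq> \<top>"
      using pu qv unfolding distrib_left ennreal_suminf_add
        matrix_coupling_weighted_fst[OF b] matrix_coupling_weighted_snd[OF b] by simp
    obtain c where c: "\<And>i j. grid_matrix c i j \<le> b i j"
      and ce: "(\<Sum>i. \<Sum>j. (b i j - grid_matrix c i j) * (u i + v j)) \<le> e"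
      using grid_matrix_approx[of b "\<lambda>i j. u i + v j" e] b_fin w u v e by auto
    define n where "n = to_nat c"
    have Cn: "C n = grid_matrix c"
      by (simp add: C_def n_def)
    have Cb: "C n i j \<le> b i j" for i j using c by (simp add: Cn)
    have rows: "(\<Sum>j. b i j) = p x i" and cols: "(\<Sum>i. b i j) = q x j" for i j
      using b by (auto simp: matrix_coupling_def)
    have r_le: "(\<Sum>j. C n i j) \<le> p x i" for i
      unfolding rows[symmetric] by (intro ennreal_suminf_mono Cb)
    have s_le: "(\<Sum>i. C n i j) \<le> q x j" for j
      unfolding cols[symmetric] by (intro ennreal_suminf_mono Cb)
    have q_le: "q x j \<le> 1" for j
      using q1 ennreal_le_suminf[of "q x" j] by simp
    have "(\<Sum>j. C n i j) \<noteq> \<top>" for i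
      using order_trans[OF r_le p_le, of i] by (auto simp: top_unique)
    then have r: "(\<Sum>j. b i j - C n i j) = p x i - (\<Sum>j. C n i j)" for i
      using ennreal_suminf_minus[of "\<lambda>j. C n i j" "\<lambda>j. b i j"] Cb rows p_le[of i]
      by (metis ennreal_one_neq_top top_unique)
    have "(\<Sum>i. C n i j) \<noteq> \<top>" for j
      using order_trans[OF s_le q_le, of j] by (auto simp: top_unique)
    then have s: "(\<Sum>i. b i j - C n i j) = q x j - (\<Sum>i. C n i j)" for j
      using ennreal_suminf_minus[of "\<lambda>i. C n i j" "\<lambda>i. b i j"] Cb cols q_le[of j]
      by (metis ennreal_one_neq_top top_unique)
    \<comment> \<open>The difference couples the residual marginals, so its weight against
      \<open>u i + v j\<close> is exactly the sum of residual moments in \<open>ok\<close>.\<close>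
    have res: "matrix_coupling (\<lambda>i. p x i - (\<Sum>j. C n i j)) (\<lambda>j. q x j - (\<Sum>i. C n i j))
        (\<lambda>i j. b i j - C n i j)"
      by (simp add: matrix_coupling_def r s)
    have "ok n x"
      unfolding ok_def
    proof (intro conjI allI r_le s_le)
      show "(\<Sum>i. \<Sum>j. C n i j * G i j) \<le> g x"
        by (intro order_trans[OF ennreal_suminf_mono cost] ennreal_suminf_mono mult_right_mono Cb) simp
      show "(\<Sum>i. (p x i - (\<Sum>j. C n i j)) * u i) + (\<Sum>j. (q x j - (\<Sum>i. C n i j)) * v j) \<le> e"
        using ce unfolding distrib_left ennreal_suminf_add Cn[symmetric]
          matrix_coupling_weighted_fst[OF res] matrix_coupling_weighted_snd[OF res] .
    qed
    then have "ok (k x) x"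
      unfolding k_def by (rule LeastI)
    then have okx: "\<And>i. (\<Sum>j. C (k x) i j) \<le> p x i" "\<And>j. (\<Sum>i. C (k x) i j) \<le> q x j"
        "(\<Sum>i. \<Sum>j. C (k x) i j * G i j) \<le> g x"
        "(\<Sum>i. (p x i - (\<Sum>j. C (k x) i j)) * u i)
          + (\<Sum>j. (q x j - (\<Sum>i. C (k x) i j)) * v j) \<le> e"
      unfolding ok_def by blast+
    show "matrix_coupling (p x) (q x) (a x) \<and> (\<Sum>i. \<Sum>j. a x i j * G i j) \<le> g x + e"
      unfolding a_def
      using residual_completion[OF p1 q1 okx(1,2) G okx(4)] okx(3)
      by (meson add_right_mono order_trans)
  qed
qed

section \<open>Couplings and their cell matrices\<close>

text \<open>The square of \<open>wasserstein2\<close>, with the infimum taken over the integrals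
  instead of their roots. Costs of couplings are linear under mixing, their roots are not.\<close>

definition transport_cost :: "('b \<Rightarrow> 'b \<Rightarrow> real) \<Rightarrow> 'b measure \<Rightarrow> 'b measure \<Rightarrow> ennreal" where
  "transport_cost d \<mu> \<nu> = (INF \<pi>\<in>couplings \<mu> \<nu>. \<integral>\<^sup>+(x, y). ennreal ((d x y)\<^sup>2) \<partial>\<pi>)"

lemma ennreal_sqrt_mono: "x \<le> y \<Longrightarrow> ennreal_sqrt x \<le> ennreal_sqrt y"
  by (auto simp: ennreal_sqrt_def top_unique intro!: ennreal_leI enn2real_mono)
    (simp add: less_top)

lemma wasserstein2_power2: "(wasserstein2 d \<mu> \<nu>)\<^sup>2 = transport_cost d \<mu> \<nu>"
proof (rule antisym)
  show "(wasserstein2 d \<mu> \<nu>)\<^sup>2 \<le> transport_cost d \<mu> \<nu>"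
    unfolding transport_cost_def
  proof (rule INF_greatest)
    fix \<pi> assume "\<pi> \<in> couplings \<mu> \<nu>"
    then have "wasserstein2 d \<mu> \<nu> \<le> ennreal_sqrt (\<integral>\<^sup>+(x, y). ennreal ((d x y)\<^sup>2) \<partial>\<pi>)"
      unfolding wasserstein2_def by (rule INF_lower)
    then show "(wasserstein2 d \<mu> \<nu>)\<^sup>2 \<le> (\<integral>\<^sup>+(x, y). ennreal ((d x y)\<^sup>2) \<partial>\<pi>)"
      by (metis ennreal_sqrt_power2 power_mono zero_le)
  qed
  have "ennreal_sqrt (transport_cost d \<mu> \<nu>) \<le> wasserstein2 d \<mu> \<nu>"
    unfolding wasserstein2_def transport_cost_def
    by (intro INF_greatest ennreal_sqrt_mono INF_lower)
  then show "transport_cost d \<mu> \<nu> \<le> (wasserstein2 d \<mu> \<nu>)\<^sup>2"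
    by (metis ennreal_sqrt_power2 power_mono zero_le)
qed

text \<open>\<open>distr\<close> depends on its target only through the measurable sets, so the
  marginal measures that serve as targets in \<open>couplings\<close> may be replaced by the common
  space \<open>S\<close>.\<close>

lemma couplings_iff:
  assumes "sets \<mu> = sets S" "sets \<nu> = sets S"
  shows "\<pi> \<in> couplings \<mu> \<nu> \<longleftrightarrow>
    sets \<pi> = sets (S \<Otimes>\<^sub>M S) \<and> prob_space \<pi> \<and> distr \<pi> S fst = \<mu> \<and> distr \<pi> S snd = \<nu>"
  using sets_pair_measure_cong[OF assms] distr_cong[OF refl assms(1), of \<pi> fst fst]
    distr_cong[OF refl assms(2), of \<pi> snd snd]
  by (auto simp: couplings_def space_prob_algebra)

lemma transport_cost_le:
  "\<pi> \<in> couplings \<mu> \<nu> \<Longrightarrow> transport_cost d \<mu> \<nu> \<le> (\<integral>\<^sup>+z. ennreal ((d (fst z) (snd z))\<^sup>2) \<partial>\<pi>)"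
  unfolding transport_cost_def case_prod_beta by (rule INF_lower)

lemma transport_cost_near_optimal:
  assumes "transport_cost d \<mu> \<nu> \<le> c" "c \<noteq> \<top>" "e > 0"
  obtains \<pi> where "\<pi> \<in> couplings \<mu> \<nu>" "(\<integral>\<^sup>+z. ennreal ((d (fst z) (snd z))\<^sup>2) \<partial>\<pi>) \<le> c + e"
proof -
  have "transport_cost d \<mu> \<nu> < c + e"
    using le_less_trans[OF assms(1), of "c + e"] assms(2,3) by (simp add: ennreal_add_left_cancel_less less_top)
  then show thesis
    unfolding transport_cost_def INF_less_iff case_prod_beta using that less_imp_le by blast
qed

section \<open>Cell masses and the passage between couplings and matrices\<close>

definition cell_mass :: "'b measure \<Rightarrow> ('b \<Rightarrow> nat) \<Rightarrow> nat \<Rightarrow> ennreal" where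
  "cell_mass \<mu> T i = emeasure \<mu> {x \<in> space \<mu>. T x = i}"

lemma nn_integral_cells:
  assumes [measurable]: "T \<in> M \<rightarrow>\<^sub>M count_space UNIV"
  shows "(\<integral>\<^sup>+x. f (T x) \<partial>M) = (\<Sum>i. cell_mass M T i * f i)"
proof -
  have "(\<integral>\<^sup>+x. f (T x) \<partial>M) = (\<integral>\<^sup>+x. (\<Sum>i. f i * indicator {x \<in> space M. T x = i} x) \<partial>M)"
  proof (rule nn_integral_cong)
    fix x assume "x \<in> space M"
    then have "(\<lambda>i. f i * indicator {x \<in> space M. T x = i} x) = (\<lambda>i. if i = T x then f i else 0)"
      by (auto simp: fun_eq_iff)
    then show "f (T x) = (\<Sum>i. f i * indicator {x \<in> space M. T x = i} x)"
      using sums_unique[OF sums_single[of "T x" f]] by simp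
  qed
  also have "\<dots> = (\<Sum>i. \<integral>\<^sup>+x. f i * indicator {x \<in> space M. T x = i} x \<partial>M)"
    by (rule nn_integral_suminf) measurable
  also have "\<dots> = (\<Sum>i. cell_mass M T i * f i)"
    by (simp add: nn_integral_cmult_indicator cell_mass_def mult.commute)
  finally show ?thesis .
qed

lemma measurable_cells_pair:
  assumes "T1 \<in> M \<rightarrow>\<^sub>M count_space (UNIV :: nat set)" "T2 \<in> M \<rightarrow>\<^sub>M count_space (UNIV :: nat set)"
    and "\<And>i j. f i j \<in> space N"
  shows "(\<lambda>z. f (T1 z) (T2 z)) \<in> M \<rightarrow>\<^sub>M N"
proof (rule measurable_compose_countable[OF _ assms(1)])
  show "(\<lambda>z. f i (T2 z)) \<in> M \<rightarrow>\<^sub>M N" for i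
    by (rule measurable_compose[OF assms(2)]) (simp add: assms(3))
qed

lemma suminf_emeasure_cells:
  assumes [measurable]: "T \<in> M \<rightarrow>\<^sub>M count_space UNIV" "A \<in> sets M"
  shows "(\<Sum>i. emeasure M {x \<in> A. T x = (i::nat)}) = emeasure M A"
proof -
  have A: "{x \<in> A. T x = i} = A \<inter> {x \<in> space M. T x = i}" for i
    using sets.sets_into_space[OF assms(2)] by auto
  have "{x \<in> A. T x = i} \<in> sets M" for i
    unfolding A by measurable
  then have "(\<Sum>i. emeasure M {x \<in> A. T x = i}) = emeasure M (\<Union>i. {x \<in> A. T x = i})"
    by (intro suminf_emeasure) (auto simp: disjoint_family_on_def)
  also have "(\<Union>i. {x \<in> A. T x = i}) = A"
    by auto
  finally show ?thesis .
qed

lemma suminf_cell_mass: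
  assumes "T \<in> M \<rightarrow>\<^sub>M count_space UNIV" "prob_space M"
  shows "(\<Sum>i. cell_mass M T i) = 1"
  using suminf_emeasure_cells[OF assms(1) sets.top] prob_space.emeasure_space_1[OF assms(2)]
  by (simp add: cell_mass_def)

lemma cell_mass_neq_top: "prob_space M \<Longrightarrow> cell_mass M T i \<noteq> \<top>"
  unfolding cell_mass_def using prob_space.finite_measure finite_measure.emeasure_finite by fastforce

text \<open>Countably many null cells form a null set. This excludes the cells on which the density
  in \<open>cell_matrix_coupling\<close> would be normalised by 0.\<close>

lemma AE_cell_mass_pos:
  assumes [measurable]: "T \<in> M \<rightarrow>\<^sub>M count_space UNIV"
  shows "AE x in M. cell_mass M T (T x) \<noteq> 0"
proof -
  have "AE x in M. T x = i \<longrightarrow> cell_mass M T i \<noteq> 0" for i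
  proof (cases "cell_mass M T i = 0")
    case True
    then have "{x \<in> space M. T x = i} \<in> null_sets M"
      unfolding cell_mass_def by (intro null_setsI) measurable
    then show ?thesis
      by (rule AE_I') (use True in auto)
  qed simp
  then have "AE x in M. \<forall>i. T x = i \<longrightarrow> cell_mass M T i \<noteq> 0"
    by (subst AE_all_countable) blast
  then show ?thesis by eventually_elim blast
qed

text \<open>The entry \<open>a i j\<close> is the \<open>\<pi>\<close>-mass of the product of cells
  \<open>i\<close> and \<open>j\<close>. The quantified identity lets every cost that depends on
  cells only be read off the same matrix.\<close>

lemma coupling_cell_matrix:
  assumes \<mu>: "sets \<mu> = sets S" and \<nu>: "sets \<nu> = sets S" and T[measurable]: "T \<in> S \<rightarrow>\<^sub>M count_space UNIV"
    and \<pi>: "\<pi> \<in> couplings \<mu> \<nu>"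
  obtains a where "matrix_coupling (cell_mass \<mu> T) (cell_mass \<nu> T) a"
    and "\<forall>G. (\<integral>\<^sup>+z. G (T (fst z)) (T (snd z)) \<partial>\<pi>) = (\<Sum>i. \<Sum>j. a i j * G i j)"
proof
  have \<pi>_sets[measurable_cong]: "sets \<pi> = sets (S \<Otimes>\<^sub>M S)" and \<pi>1: "distr \<pi> S fst = \<mu>" and \<pi>2: "distr \<pi> S snd = \<nu>"
    using \<pi> couplings_iff[OF \<mu> \<nu>] by auto
  define a where "a i j = emeasure \<pi> {z \<in> space \<pi>. T (fst z) = i \<and> T (snd z) = j}" for i j
  have sp: "space \<pi> = space S \<times> space S"
    using sets_eq_imp_space_eq[OF \<pi>_sets] by (simp add: space_pair_measure)
  have m1: "cell_mass \<mu> T i = emeasure \<pi> {z \<in> space \<pi>. T (fst z) = i}" for i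
    unfolding cell_mass_def \<pi>1[symmetric]
    by (subst emeasure_distr) (auto intro!: arg_cong[where f="emeasure \<pi>"] simp: sp)
  have m2: "cell_mass \<nu> T i = emeasure \<pi> {z \<in> space \<pi>. T (snd z) = i}" for i
    unfolding cell_mass_def \<pi>2[symmetric]
    by (subst emeasure_distr) (auto intro!: arg_cong[where f="emeasure \<pi>"] simp: sp)
  have rows: "(\<Sum>j. a i j) = cell_mass \<mu> T i" for i
    using suminf_emeasure_cells[of "\<lambda>z. T (snd z)" \<pi> "{z \<in> space \<pi>. T (fst z) = i}"]
    by (simp add: a_def m1)
  have cols: "(\<Sum>i. a i j) = cell_mass \<nu> T j" for j
    using suminf_emeasure_cells[of "\<lambda>z. T (fst z)" \<pi> "{z \<in> space \<pi>. T (snd z) = j}"]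
    by (simp add: a_def m2 conj_ac)
  show "matrix_coupling (cell_mass \<mu> T) (cell_mass \<nu> T) a"
    by (simp add: matrix_coupling_def rows cols)
  \<comment> \<open>Encoding the pair of cells as one natural number turns the double partition into
    a single one, to which \<open>nn_integral_cells\<close> applies.\<close>
  have enc: "(\<lambda>z. prod_encode (T (fst z), T (snd z))) \<in> \<pi> \<rightarrow>\<^sub>M count_space UNIV"
    by (rule measurable_cells_pair[where f="\<lambda>i j. prod_encode (i, j)"
          and ?T1.0="\<lambda>z. T (fst z)" and ?T2.0="\<lambda>z. T (snd z)"]) simp_all
  show "\<forall>G. (\<integral>\<^sup>+z. G (T (fst z)) (T (snd z)) \<partial>\<pi>) = (\<Sum>i. \<Sum>j. a i j * G i j)"
  proof
    fix G :: "nat \<Rightarrow> nat \<Rightarrow> ennreal"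
    have "(\<integral>\<^sup>+z. G (T (fst z)) (T (snd z)) \<partial>\<pi>)
        = (\<integral>\<^sup>+z. (\<lambda>n. case_prod G (prod_decode n)) (prod_encode (T (fst z), T (snd z))) \<partial>\<pi>)"
      by simp
    also have "\<dots> = (\<integral>\<^sup>+n. cell_mass \<pi> (\<lambda>z. prod_encode (T (fst z), T (snd z))) n
        * case_prod G (prod_decode n) \<partial>count_space UNIV)"
      unfolding nn_integral_count_space_nat by (rule nn_integral_cells[OF enc])
    also have "\<dots> = (\<integral>\<^sup>+ij. cell_mass \<pi> (\<lambda>z. prod_encode (T (fst z), T (snd z))) (prod_encode ij)
        * case_prod G ij \<partial>count_space UNIV)"
      using nn_integral_bij_count_space[OF bij_prod_encode,
          of "\<lambda>n. cell_mass \<pi> (\<lambda>z. prod_encode (T (fst z), T (snd z))) n * case_prod G (prod_decode n)"]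
      by simp
    also have "\<dots> = (\<integral>\<^sup>+ij. a (fst ij) (snd ij) * G (fst ij) (snd ij) \<partial>count_space UNIV)"
      by (auto simp: cell_mass_def a_def case_prod_beta prod_eq_iff intro!: nn_integral_cong)
    also have "\<dots> = (\<Sum>i. \<Sum>j. a i j * G i j)"
      by (subst nn_integral_fst_count_space[symmetric]) (simp add: nn_integral_count_space_nat)
    finally show "(\<integral>\<^sup>+z. G (T (fst z)) (T (snd z)) \<partial>\<pi>) = (\<Sum>i. \<Sum>j. a i j * G i j)" .
  qed
qed

text \<open>Conditionally on the pair of cells the two coordinates are taken independent.\<close>

lemma cell_matrix_coupling:
  assumes \<mu>: "\<mu> \<in> space (prob_algebra S)" and \<nu>: "\<nu> \<in> space (prob_algebra S)"
    and T[measurable]: "T \<in> S \<rightarrow>\<^sub>M count_space UNIV"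
    and a: "matrix_coupling (cell_mass \<mu> T) (cell_mass \<nu> T) a"
  obtains \<pi> where "\<pi> \<in> couplings \<mu> \<nu>"
    and "\<forall>G. (\<integral>\<^sup>+z. G (T (fst z)) (T (snd z)) \<partial>\<pi>) = (\<Sum>i. \<Sum>j. a i j * G i j)"
proof
  have \<mu>_sets[measurable_cong]: "sets \<mu> = sets S" and "prob_space \<mu>"
    and \<nu>_sets[measurable_cong]: "sets \<nu> = sets S" and "prob_space \<nu>"
    using \<mu> \<nu> by (auto simp: space_prob_algebra)
  interpret M: prob_space \<mu> by fact
  interpret N: prob_space \<nu> by fact
  interpret pair_sigma_finite \<mu> \<nu> ..
  define p where "p = cell_mass \<mu> T"
  define q where "q = cell_mass \<nu> T"
  \<comment> \<open>The density \<open>a i j / (p i * q j)\<close> with respect to the product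
    measure spreads the mass \<open>a i j\<close> over the product of cells in proportion to
    \<open>\<mu>\<close> and \<open>\<nu>\<close>. On null rows or columns \<open>a i j = 0\<close>,
    and \<open>0 * \<top> = 0\<close>.\<close>
  define h where "h i j = a i j * (inverse (p i) * inverse (q j))" for i j
  define \<pi> where "\<pi> = density (\<mu> \<Otimes>\<^sub>M \<nu>) (\<lambda>z. h (T (fst z)) (T (snd z)))"
  have a': "matrix_coupling p q a"
    using a by (simp add: p_def q_def)
  have p_fin: "p i \<noteq> \<top>" and q_fin: "q i \<noteq> \<top>" for i
    using cell_mass_neq_top \<open>prob_space \<mu>\<close> \<open>prob_space \<nu>\<close> by (auto simp: p_def q_def)
  have inv_p: "p i \<noteq> 0 \<Longrightarrow> p i * inverse (p i) = 1" and inv_q: "q i \<noteq> 0 \<Longrightarrow> q i * inverse (q i) = 1" for i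
    using p_fin[of i] q_fin[of i] by (metis ennreal_divide_self divide_ennreal_def less_top)+
  have hq: "q j * h i j = a i j * inverse (p i)" for i j
  proof (cases "q j = 0")
    case False
    have "q j * h i j = a i j * inverse (p i) * (q j * inverse (q j))"
      by (simp only: h_def mult_ac)
    then show ?thesis
      using inv_q[OF False] by simp
  qed (use matrix_coupling_0(2)[OF a'] in simp)
  have hp: "p i * h i j = a i j * inverse (q j)" for i j
  proof (cases "p i = 0")
    case False
    have "p i * h i j = a i j * inverse (q j) * (p i * inverse (p i))"
      by (simp only: h_def mult_ac)
    then show ?thesis
      using inv_p[OF False] by simp
  qed (use matrix_coupling_0(1)[OF a'] in simp)
  have ha: "p i * (q j * h i j) = a i j" for i j
  proof (cases "p i = 0")
    case False
    have "p i * (q j * h i j) = a i j * (p i * inverse (p i))"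
      by (simp only: hq mult_ac)
    then show ?thesis
      using inv_p[OF False] by simp
  qed (use matrix_coupling_0(1)[OF a'] in simp)
  have rows: "(\<Sum>j. a i j) = p i" and cols: "(\<Sum>i. a i j) = q j" for i j
    using a' by (auto simp: matrix_coupling_def)
  \<comment> \<open>Over a cell of positive mass the second coordinate has total conditional mass 1,
    which is what makes \<open>\<mu>\<close> the first marginal.\<close>
  have int2: "(\<integral>\<^sup>+z. h i (T z) \<partial>\<nu>) = 1" if "p i \<noteq> 0" for i
  proof -
    have "(\<integral>\<^sup>+z. h i (T z) \<partial>\<nu>) = (\<Sum>j. q j * h i j)"
      unfolding q_def by (rule nn_integral_cells) measurable
    then show ?thesis
      using inv_p[OF that] rows[of i] by (simp add: hq)
  qed
  have int1: "(\<integral>\<^sup>+y. h (T y) j \<partial>\<mu>) = 1" if "q j \<noteq> 0" for j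
  proof -
    have "(\<integral>\<^sup>+y. h (T y) j \<partial>\<mu>) = (\<Sum>i. p i * h i j)"
      unfolding p_def by (rule nn_integral_cells) measurable
    then show ?thesis
      using inv_q[OF that] cols[of j] by (simp add: hp)
  qed
  have \<pi>_sets: "sets \<pi> = sets (S \<Otimes>\<^sub>M S)"
    by (simp add: \<pi>_def sets_pair_measure_cong[OF \<mu>_sets \<nu>_sets])
  have h_meas[measurable]: "(\<lambda>z. h (T (fst z)) (T (snd z))) \<in> borel_measurable (\<mu> \<Otimes>\<^sub>M \<nu>)"
    by (rule measurable_cells_pair[where ?T1.0="\<lambda>z. T (fst z)" and ?T2.0="\<lambda>z. T (snd z)"]) simp_all
  have h_meas1[measurable]: "(\<lambda>y. h (T y) j) \<in> borel_measurable S" for j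
    by (rule measurable_compose[OF T]) simp
  have h_meas2[measurable]: "(\<lambda>z. h i (T z)) \<in> borel_measurable S" for i
    by (rule measurable_compose[OF T]) simp
  have \<pi>1: "distr \<pi> S fst = \<mu>"
  proof (rule measure_eqI)
    fix A assume "A \<in> sets (distr \<pi> S fst)"
    then have A[measurable]: "A \<in> sets S" by simp
    have "emeasure (distr \<pi> S fst) A = (\<integral>\<^sup>+x. indicator A x \<partial>distr \<pi> S fst)"
      by simp
    also have "\<dots> = (\<integral>\<^sup>+z. indicator A (fst z) \<partial>\<pi>)"
      by (subst nn_integral_distr) (auto simp: \<pi>_def)
    also have "\<dots> = (\<integral>\<^sup>+z. h (T (fst z)) (T (snd z)) * indicator A (fst z) \<partial>(\<mu> \<Otimes>\<^sub>M \<nu>))"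
      unfolding \<pi>_def by (rule nn_integral_density) measurable
    also have "\<dots> = (\<integral>\<^sup>+y. \<integral>\<^sup>+z. h (T y) (T z) * indicator A y \<partial>\<nu> \<partial>\<mu>)"
      using N.nn_integral_fst[of "\<lambda>z. h (T (fst z)) (T (snd z)) * indicator A (fst z)" \<mu>] by simp
    also have "\<dots> = (\<integral>\<^sup>+y. (\<integral>\<^sup>+z. h (T y) (T z) \<partial>\<nu>) * indicator A y \<partial>\<mu>)"
      by (intro nn_integral_cong nn_integral_multc) measurable
    also have "\<dots> = (\<integral>\<^sup>+y. indicator A y \<partial>\<mu>)"
    proof (rule nn_integral_cong_AE)
      have "AE y in \<mu>. p (T y) \<noteq> 0"
        unfolding p_def by (rule AE_cell_mass_pos) measurable
      then show "AE y in \<mu>. (\<integral>\<^sup>+z. h (T y) (T z) \<partial>\<nu>) * indicator A y = indicator A y"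
        by eventually_elim (simp add: int2)
    qed
    finally show "emeasure (distr \<pi> S fst) A = emeasure \<mu> A"
      by (simp add: \<mu>_sets)
  qed (simp add: \<mu>_sets)
  have \<pi>2: "distr \<pi> S snd = \<nu>"
  proof (rule measure_eqI)
    fix A assume "A \<in> sets (distr \<pi> S snd)"
    then have A[measurable]: "A \<in> sets S" by simp
    have "emeasure (distr \<pi> S snd) A = (\<integral>\<^sup>+x. indicator A x \<partial>distr \<pi> S snd)"
      by simp
    also have "\<dots> = (\<integral>\<^sup>+z. indicator A (snd z) \<partial>\<pi>)"
      by (subst nn_integral_distr) (auto simp: \<pi>_def)
    also have "\<dots> = (\<integral>\<^sup>+z. h (T (fst z)) (T (snd z)) * indicator A (snd z) \<partial>(\<mu> \<Otimes>\<^sub>M \<nu>))"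
      unfolding \<pi>_def by (rule nn_integral_density) measurable
    also have "\<dots> = (\<integral>\<^sup>+z. \<integral>\<^sup>+y. h (T y) (T z) * indicator A z \<partial>\<mu> \<partial>\<nu>)"
      using nn_integral_snd[of "\<lambda>z. h (T (fst z)) (T (snd z)) * indicator A (snd z)"] by simp
    also have "\<dots> = (\<integral>\<^sup>+z. (\<integral>\<^sup>+y. h (T y) (T z) \<partial>\<mu>) * indicator A z \<partial>\<nu>)"
      by (intro nn_integral_cong nn_integral_multc) measurable
    also have "\<dots> = (\<integral>\<^sup>+z. indicator A z \<partial>\<nu>)"
    proof (rule nn_integral_cong_AE)
      have "AE y in \<nu>. q (T y) \<noteq> 0"
        unfolding q_def by (rule AE_cell_mass_pos) measurable
      then show "AE z in \<nu>. (\<integral>\<^sup>+y. h (T y) (T z) \<partial>\<mu>) * indicator A z = indicator A z"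
        by eventually_elim (simp add: int1)
    qed
    finally show "emeasure (distr \<pi> S snd) A = emeasure \<nu> A"
      by (simp add: \<nu>_sets)
  qed (simp add: \<nu>_sets)
  have "prob_space \<pi>"
  proof (rule prob_space_distrD[of fst \<pi> S])
    show "fst \<in> \<pi> \<rightarrow>\<^sub>M S" using \<pi>_sets by (simp cong: measurable_cong_sets)
    show "prob_space (distr \<pi> S fst)" by (simp add: \<pi>1 M.prob_space_axioms)
  qed
  then show "\<pi> \<in> couplings \<mu> \<nu>"
    using couplings_iff[OF \<mu>_sets \<nu>_sets] \<pi>_sets \<pi>1 \<pi>2 by auto
  show "\<forall>G. (\<integral>\<^sup>+z. G (T (fst z)) (T (snd z)) \<partial>\<pi>) = (\<Sum>i. \<Sum>j. a i j * G i j)"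
  proof
    fix G :: "nat \<Rightarrow> nat \<Rightarrow> ennreal"
    have G_meas[measurable]: "(\<lambda>z. G (T (fst z)) (T (snd z))) \<in> borel_measurable (\<mu> \<Otimes>\<^sub>M \<nu>)"
      by (rule measurable_cells_pair[where ?T1.0="\<lambda>z. T (fst z)" and ?T2.0="\<lambda>z. T (snd z)"]) simp_all
    have "(\<integral>\<^sup>+z. G (T (fst z)) (T (snd z)) \<partial>\<pi>)
        = (\<integral>\<^sup>+z. h (T (fst z)) (T (snd z)) * G (T (fst z)) (T (snd z)) \<partial>(\<mu> \<Otimes>\<^sub>M \<nu>))"
      unfolding \<pi>_def by (rule nn_integral_density) measurable
    also have "\<dots> = (\<integral>\<^sup>+y. \<integral>\<^sup>+z. h (T y) (T z) * G (T y) (T z) \<partial>\<nu> \<partial>\<mu>)"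
      using N.nn_integral_fst[of "\<lambda>z. h (T (fst z)) (T (snd z)) * G (T (fst z)) (T (snd z))" \<mu>] by simp
    also have "\<dots> = (\<integral>\<^sup>+y. (\<Sum>j. q j * (h (T y) j * G (T y) j)) \<partial>\<mu>)"
      unfolding q_def by (intro nn_integral_cong nn_integral_cells) measurable
    also have "\<dots> = (\<Sum>i. p i * (\<Sum>j. q j * (h i j * G i j)))"
      unfolding p_def by (rule nn_integral_cells) measurable
    also have "\<dots> = (\<Sum>i. \<Sum>j. p i * (q j * h i j) * G i j)"
      by (simp add: mult.assoc)
    finally show "(\<integral>\<^sup>+z. G (T (fst z)) (T (snd z)) \<partial>\<pi>) = (\<Sum>i. \<Sum>j. a i j * G i j)"
      by (simp add: ha)
  qed
qed

section \<open>Triangle inequality and convexity of the transport cost\<close>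

text \<open>Young's inequality: the difference of the two sides is
  \<open>(t * u - v)\<^sup>2 / t\<close>. A small weight serves the quantization, weight 1 the
  moment bounds and a tuned weight the triangle inequality.\<close>

lemma power2_add_le:
  fixes u v t :: real
  assumes "t > 0"
  shows "(u + v)\<^sup>2 \<le> (1 + t) * u\<^sup>2 + (1 + 1 / t) * v\<^sup>2"
proof -
  have "(1 + t) * u\<^sup>2 + (1 + 1 / t) * v\<^sup>2 - (u + v)\<^sup>2 = (t * u - v)\<^sup>2 / t"
    using assms by (simp add: power2_eq_square field_simps)
  also have "\<dots> \<ge> 0"
    using assms by simp
  finally show ?thesis by simp
qed

text \<open>For finite \<open>c\<close> the bound is continuous in \<open>t\<close> with value
  \<open>c\<close> at 0. Its inner factor \<open>1 + t\<close> comes from replacing couplings by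
  cell matrices, the outer one from going back, and \<open>k\<close> collects the additive
  errors.\<close>

lemma ennreal_le_limit:
  fixes x c :: ennreal and k :: real
  assumes k: "k \<ge> 0" and le: "\<And>t. t > 0 \<Longrightarrow>
    x \<le> ennreal (1 + t) * (ennreal (1 + t) * (c + ennreal (k * t)) + ennreal (k * t)) + ennreal t"
  shows "x \<le> c"
proof (cases c)
  case (real r)
  define h where "h t = (1 + t) * ((1 + t) * (r + k * t) + k * t) + t" for t
  have "((\<lambda>t. ennreal (h t)) \<longlongrightarrow> ennreal (h 0)) (at_right 0)"
    unfolding h_def by (intro tendsto_ennrealI tendsto_intros)
  moreover have "\<forall>\<^sub>F t in at_right 0. x \<le> ennreal (h t)"
    using eventually_at_right_less[of 0]
  proof eventually_elim
    case (elim t)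
    have "ennreal (h t) =
        ennreal (1 + t) * (ennreal (1 + t) * (c + ennreal (k * t)) + ennreal (k * t)) + ennreal t"
      unfolding h_def using elim k real by (simp add: ennreal_mult ennreal_plus)
    then show ?case
      using le[OF elim] by simp
  qed
  ultimately have "x \<le> ennreal (h 0)"
    by (rule tendsto_lowerbound) simp
  then show ?thesis
    using real by (simp add: h_def)
qed simp

lemma cell_mass_bind:
  assumes m: "m \<in> space (prob_algebra X)" and K: "K \<in> X \<rightarrow>\<^sub>M prob_algebra S"
    and T[measurable]: "T \<in> S \<rightarrow>\<^sub>M count_space UNIV"
  shows "cell_mass (m \<bind> K) T i = (\<integral>\<^sup>+x. cell_mass (K x) T i \<partial>m)"
    and "(\<lambda>x. cell_mass (K x) T i) \<in> borel_measurable X"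
proof -
  have sp: "space (K x) = space S" if "x \<in> space X" for x
    using measurable_space[OF K that] by (auto simp: space_prob_algebra dest: sets_eq_imp_space_eq)
  have spm: "space m = space X"
    using m by (auto simp: space_prob_algebra dest: sets_eq_imp_space_eq)
  have "space (m \<bind> K) = space S"
    using sets_bind'[OF m K] by (rule sets_eq_imp_space_eq)
  then have "cell_mass (m \<bind> K) T i = emeasure (m \<bind> K) {y \<in> space S. T y = i}"
    by (simp add: cell_mass_def)
  also have "\<dots> = (\<integral>\<^sup>+x. emeasure (K x) {y \<in> space S. T y = i} \<partial>m)"
    by (rule emeasure_bind_prob_algebra[OF m K]) measurable
  also have "\<dots> = (\<integral>\<^sup>+x. cell_mass (K x) T i \<partial>m)"
    by (intro nn_integral_cong) (simp add: cell_mass_def sp spm)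
  finally show "cell_mass (m \<bind> K) T i = (\<integral>\<^sup>+x. cell_mass (K x) T i \<partial>m)" .
  have "(\<lambda>x. emeasure (K x) {y \<in> space S. T y = i}) \<in> borel_measurable X"
    using measurable_prob_algebraD[OF K] by measurable
  then show "(\<lambda>x. cell_mass (K x) T i) \<in> borel_measurable X"
    by (rule measurable_cong[THEN iffD1, rotated]) (simp add: cell_mass_def sp)
qed

text \<open>The carrier is the space of a measure, so that paths, which form a subset of a function
  type, are an instance. Separability is stated as countable measurable covers of small diameter
  because these are what cells are cut from.\<close>

locale separable_metric_measurable =
  fixes S :: "'b measure" and d :: "'b \<Rightarrow> 'b \<Rightarrow> real"
  assumes d_nonneg: "\<And>x y. x \<in> space S \<Longrightarrow> y \<in> space S \<Longrightarrow> 0 \<le> d x y"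
    and d_sym: "\<And>x y. x \<in> space S \<Longrightarrow> y \<in> space S \<Longrightarrow> d x y = d y x"
    and d_triangle: "\<And>x y z. x \<in> space S \<Longrightarrow> y \<in> space S \<Longrightarrow> z \<in> space S \<Longrightarrow> d x z \<le> d x y + d y z"
    and d_measurable: "(\<lambda>z. d (fst z) (snd z)) \<in> borel_measurable (S \<Otimes>\<^sub>M S)"
    and small_cover: "\<And>e. e > 0 \<Longrightarrow> \<exists>B :: nat \<Rightarrow> 'b set. (\<forall>n. B n \<in> sets S) \<and> space S \<subseteq> (\<Union>n. B n)
      \<and> (\<forall>n. \<forall>x\<in>B n. \<forall>y\<in>B n. d x y \<le> e)"
begin

text \<open>\<open>T x\<close> is the cell of \<open>x\<close> and \<open>r n\<close> the
  representative of cell \<open>n\<close>. For unbounded \<open>d\<close> a small displacement of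
  the points may change the squared distance by an arbitrarily large amount, hence the factor
  \<open>1 + t\<close> beside the additive error.\<close>

definition quantizer :: "real \<Rightarrow> ('b \<Rightarrow> nat) \<Rightarrow> (nat \<Rightarrow> 'b) \<Rightarrow> bool" where
  "quantizer t T r \<longleftrightarrow> T \<in> S \<rightarrow>\<^sub>M count_space UNIV \<and> (\<forall>n. r n \<in> space S) \<and>
    (\<forall>x\<in>space S. \<forall>y\<in>space S. (d x y)\<^sup>2 \<le> (1 + t) * (d (r (T x)) (r (T y)))\<^sup>2 + t
      \<and> (d (r (T x)) (r (T y)))\<^sup>2 \<le> (1 + t) * (d x y)\<^sup>2 + t)"

lemma quantizer_exists:
  assumes t: "t > 0" and ne: "space S \<noteq> {}"
  obtains T r where "quantizer t T r"
proof -
  \<comment> \<open>Moving both points by at most \<open>e\<close> changes their distance by at most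
    \<open>2 * e\<close>; this \<open>e\<close> makes Young's remainder
    \<open>(1 + 1 / t) * (2 * e)\<^sup>2\<close> equal to \<open>t / (1 + t)\<close>.\<close>
  define e where "e = t / (2 * (1 + t))"
  have "e > 0" using t by (simp add: e_def)
  then obtain B :: "nat \<Rightarrow> 'b set" where B[measurable]: "\<And>n. B n \<in> sets S" and cov: "space S \<subseteq> (\<Union>n. B n)"
    and diam: "\<And>n x y. x \<in> B n \<Longrightarrow> y \<in> B n \<Longrightarrow> d x y \<le> e"
    using small_cover[of e] by blast
  obtain z where z: "z \<in> space S" using ne by auto
  \<comment> \<open>The least index turns the possibly overlapping cover into a partition.\<close>
  define T where "T x = (LEAST n. x \<in> B n)" for x
  have T: "x \<in> B (T x)" if "x \<in> space S" for x
    using cov that unfolding T_def by (metis LeastI UN_E subsetD)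
  \<comment> \<open>An empty cell gets the point \<open>z\<close>, so that all representatives lie
    in the space.\<close>
  define r where "r n = (if \<exists>x\<in>space S. T x = n then SOME x. x \<in> space S \<and> T x = n else z)" for n
  have r1: "r n \<in> space S" for n
  proof (cases "\<exists>x. x \<in> space S \<and> T x = n")
    case True
    then show ?thesis
      using someI_ex[OF True] by (auto simp: r_def)
  qed (use z in \<open>auto simp: r_def\<close>)
  have r2: "T (r (T x)) = T x" if "x \<in> space S" for x
  proof -
    have ex: "\<exists>y. y \<in> space S \<and> T y = T x" using that by auto
    show ?thesis using someI_ex[OF ex] ex by (auto simp: r_def)
  qed
  have near: "d x (r (T x)) \<le> e" if "x \<in> space S" for x
    using diam[OF T[OF that], of "r (T x)"] T[OF r1[of "T x"]] r2[OF that] by simp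
  have err: "(1 + 1 / t) * (2 * e)\<^sup>2 \<le> t"
  proof -
    have "(1 + 1 / t) * (2 * e)\<^sup>2 = t / (1 + t)"
      using t by (simp add: e_def power2_eq_square divide_simps) (simp add: algebra_simps)
    also have "\<dots> \<le> t"
      using t by (simp add: divide_simps)
    finally show ?thesis .
  qed
  have sq: "a\<^sup>2 \<le> (1 + t) * b\<^sup>2 + t" if "a \<le> b + 2 * e" "0 \<le> a" "0 \<le> b" for a b
  proof -
    have "a\<^sup>2 \<le> (b + 2 * e)\<^sup>2"
      using that by (intro power_mono)
    also have "\<dots> \<le> (1 + t) * b\<^sup>2 + (1 + 1 / t) * (2 * e)\<^sup>2"
      by (rule power2_add_le[OF t])
    finally show ?thesis using err by simp
  qed
  have "quantizer t T r"
    unfolding quantizer_def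
  proof (intro conjI allI ballI r1)
    show "T \<in> S \<rightarrow>\<^sub>M count_space UNIV"
      unfolding T_def by (rule measurable_Least) measurable
    fix x y assume x: "x \<in> space S" and y: "y \<in> space S"
    have "d x y \<le> d x (r (T x)) + d (r (T x)) y" "d (r (T x)) y \<le> d (r (T x)) (r (T y)) + d (r (T y)) y"
      "d (r (T x)) (r (T y)) \<le> d (r (T x)) x + d x (r (T y))" "d x (r (T y)) \<le> d x y + d y (r (T y))"
      using x y r1 by (auto intro: d_triangle)
    then show "(d x y)\<^sup>2 \<le> (1 + t) * (d (r (T x)) (r (T y)))\<^sup>2 + t"
      and "(d (r (T x)) (r (T y)))\<^sup>2 \<le> (1 + t) * (d x y)\<^sup>2 + t"
      using near[OF x] near[OF y] d_sym[OF x r1[of "T x"]] d_sym[OF y r1[of "T y"]]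
        d_nonneg[OF x y] d_nonneg[OF r1[of "T x"] r1[of "T y"]]
      by (auto intro!: sq)
  qed
  then show thesis by (rule that)
qed

lemma coupling_space:
  assumes "\<mu> \<in> space (prob_algebra S)" "\<nu> \<in> space (prob_algebra S)" "\<pi> \<in> couplings \<mu> \<nu>" "z \<in> space \<pi>"
  shows "fst z \<in> space S" "snd z \<in> space S"
proof -
  have "sets \<mu> = sets S" "sets \<nu> = sets S"
    using assms(1,2) by (auto simp: space_prob_algebra)
  then have "sets \<pi> = sets (S \<Otimes>\<^sub>M S)"
    using assms(3) couplings_iff by blast
  then have "space \<pi> = space S \<times> space S"
    by (metis sets_eq_imp_space_eq space_pair_measure)
  then show "fst z \<in> space S" "snd z \<in> space S"
    using assms(4) by (simp_all add: mem_Times_iff)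
qed

text \<open>The second quantizer inequality is integrated against a coupling of cost at most
  \<open>c + t\<close>. The inner \<open>t\<close> is the price of near-optimality; the factor
  \<open>1 + t\<close> and the outer \<open>t\<close> come from the quantizer.\<close>

lemma transport_cost_discretize:
  assumes \<mu>: "\<mu> \<in> space (prob_algebra S)" and \<nu>: "\<nu> \<in> space (prob_algebra S)"
    and t: "t > 0" and q: "quantizer t T r"
    and c: "transport_cost d \<mu> \<nu> \<le> c" "c \<noteq> \<top>"
  obtains a where "matrix_coupling (cell_mass \<mu> T) (cell_mass \<nu> T) a"
    and "(\<Sum>i. \<Sum>j. a i j * ennreal ((d (r i) (r j))\<^sup>2)) \<le> ennreal (1 + t) * (c + ennreal t) + ennreal t"
proof -
  have T: "T \<in> S \<rightarrow>\<^sub>M count_space UNIV"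
    and D: "\<And>x y. x \<in> space S \<Longrightarrow> y \<in> space S \<Longrightarrow> (d (r (T x)) (r (T y)))\<^sup>2 \<le> (1 + t) * (d x y)\<^sup>2 + t"
    using q by (auto simp: quantizer_def)
  have sets: "sets \<mu> = sets S" "sets \<nu> = sets S"
    using \<mu> \<nu> by (auto simp: space_prob_algebra)
  obtain \<pi> where \<pi>: "\<pi> \<in> couplings \<mu> \<nu>"
    and cost: "(\<integral>\<^sup>+z. ennreal ((d (fst z) (snd z))\<^sup>2) \<partial>\<pi>) \<le> c + ennreal t"
    using transport_cost_near_optimal[OF c, of "ennreal t"] t by auto
  have \<pi>': "sets \<pi> = sets (S \<Otimes>\<^sub>M S)" "prob_space \<pi>"
    using \<pi> couplings_iff[OF sets] by auto
  have [measurable]: "(\<lambda>z. d (fst z) (snd z)) \<in> borel_measurable \<pi>"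
    using d_measurable \<pi>'(1) by (simp cong: measurable_cong_sets)
  obtain a where a: "matrix_coupling (cell_mass \<mu> T) (cell_mass \<nu> T) a"
    and int: "\<forall>G. (\<integral>\<^sup>+z. G (T (fst z)) (T (snd z)) \<partial>\<pi>) = (\<Sum>i. \<Sum>j. a i j * G i j)"
    by (rule coupling_cell_matrix[OF sets T \<pi>])
  have "(\<Sum>i. \<Sum>j. a i j * ennreal ((d (r i) (r j))\<^sup>2))
      = (\<integral>\<^sup>+z. ennreal ((d (r (T (fst z))) (r (T (snd z))))\<^sup>2) \<partial>\<pi>)"
    using int[rule_format, of "\<lambda>i j. ennreal ((d (r i) (r j))\<^sup>2)"] by simp
  also have "\<dots> \<le> (\<integral>\<^sup>+z. ennreal (1 + t) * ennreal ((d (fst z) (snd z))\<^sup>2) + ennreal t \<partial>\<pi>)"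
  proof (rule nn_integral_mono)
    fix z assume "z \<in> space \<pi>"
    then have "ennreal ((d (r (T (fst z))) (r (T (snd z))))\<^sup>2) \<le> ennreal ((1 + t) * (d (fst z) (snd z))\<^sup>2 + t)"
      using coupling_space[OF \<mu> \<nu> \<pi>] by (intro ennreal_leI D)
    then show "ennreal ((d (r (T (fst z))) (r (T (snd z))))\<^sup>2)
        \<le> ennreal (1 + t) * ennreal ((d (fst z) (snd z))\<^sup>2) + ennreal t"
      using t by (simp add: ennreal_plus ennreal_mult)
  qed
  also have "\<dots> = ennreal (1 + t) * (\<integral>\<^sup>+z. ennreal ((d (fst z) (snd z))\<^sup>2) \<partial>\<pi>) + ennreal t"
    using prob_space.emeasure_space_1[OF \<pi>'(2)] by (simp add: nn_integral_add nn_integral_cmult)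
  also have "\<dots> \<le> ennreal (1 + t) * (c + ennreal t) + ennreal t"
    using cost by (intro add_mono mult_left_mono) auto
  finally show thesis
    using that[OF a] by simp
qed

text \<open>The matrix is realised by a coupling that is independent inside products of cells, and
  the first quantizer inequality bounds its cost by that of the representatives.\<close>

lemma transport_cost_undiscretize:
  assumes \<mu>: "\<mu> \<in> space (prob_algebra S)" and \<nu>: "\<nu> \<in> space (prob_algebra S)"
    and t: "t > 0" and q: "quantizer t T r"
    and a: "matrix_coupling (cell_mass \<mu> T) (cell_mass \<nu> T) a"
  shows "transport_cost d \<mu> \<nu>
    \<le> ennreal (1 + t) * (\<Sum>i. \<Sum>j. a i j * ennreal ((d (r i) (r j))\<^sup>2)) + ennreal t"
proof -
  have T[measurable]: "T \<in> S \<rightarrow>\<^sub>M count_space UNIV"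
    and D: "\<And>x y. x \<in> space S \<Longrightarrow> y \<in> space S \<Longrightarrow> (d x y)\<^sup>2 \<le> (1 + t) * (d (r (T x)) (r (T y)))\<^sup>2 + t"
    using q by (auto simp: quantizer_def)
  have sets: "sets \<mu> = sets S" "sets \<nu> = sets S"
    using \<mu> \<nu> by (auto simp: space_prob_algebra)
  obtain \<pi> where \<pi>: "\<pi> \<in> couplings \<mu> \<nu>"
    and int: "\<forall>G. (\<integral>\<^sup>+z. G (T (fst z)) (T (snd z)) \<partial>\<pi>) = (\<Sum>i. \<Sum>j. a i j * G i j)"
    by (rule cell_matrix_coupling[OF \<mu> \<nu> T a])
  have \<pi>_sets[measurable_cong]: "sets \<pi> = sets (S \<Otimes>\<^sub>M S)" and \<pi>_prob: "prob_space \<pi>"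
    using \<pi> couplings_iff[OF sets] by auto
  have [measurable]: "(\<lambda>z. ennreal ((d (r (T (fst z))) (r (T (snd z))))\<^sup>2)) \<in> borel_measurable \<pi>"
    by (rule measurable_cells_pair[where f="\<lambda>i j. ennreal ((d (r i) (r j))\<^sup>2)"
          and ?T1.0="\<lambda>z. T (fst z)" and ?T2.0="\<lambda>z. T (snd z)"]) simp_all
  have "transport_cost d \<mu> \<nu> \<le> (\<integral>\<^sup>+z. ennreal ((d (fst z) (snd z))\<^sup>2) \<partial>\<pi>)"
    by (rule transport_cost_le[OF \<pi>])
  also have "\<dots> \<le> (\<integral>\<^sup>+z. ennreal (1 + t) * ennreal ((d (r (T (fst z))) (r (T (snd z))))\<^sup>2) + ennreal t \<partial>\<pi>)"
  proof (rule nn_integral_mono)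
    fix z assume "z \<in> space \<pi>"
    then have "ennreal ((d (fst z) (snd z))\<^sup>2) \<le> ennreal ((1 + t) * (d (r (T (fst z))) (r (T (snd z))))\<^sup>2 + t)"
      using coupling_space[OF \<mu> \<nu> \<pi>] by (intro ennreal_leI D)
    then show "ennreal ((d (fst z) (snd z))\<^sup>2)
        \<le> ennreal (1 + t) * ennreal ((d (r (T (fst z))) (r (T (snd z))))\<^sup>2) + ennreal t"
      using t by (simp add: ennreal_plus ennreal_mult)
  qed
  also have "\<dots> = ennreal (1 + t) * (\<integral>\<^sup>+z. ennreal ((d (r (T (fst z))) (r (T (snd z))))\<^sup>2) \<partial>\<pi>) + ennreal t"
    using prob_space.emeasure_space_1[OF \<pi>_prob] by (simp add: nn_integral_add nn_integral_cmult)
  finally show ?thesis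
    using int[rule_format, of "\<lambda>i j. ennreal ((d (r i) (r j))\<^sup>2)"] by simp
qed

lemma prob_algebra_not_empty:
  assumes "\<mu> \<in> space (prob_algebra S)"
  shows "space S \<noteq> {}"
proof -
  have "sets \<mu> = sets S" "prob_space \<mu>"
    using assms by (auto simp: space_prob_algebra)
  then show ?thesis
    using prob_space.not_empty[of \<mu>] sets_eq_imp_space_eq[of \<mu> S] by simp
qed

text \<open>Gluing the cell matrices needs no disintegration of the couplings themselves.\<close>

lemma transport_cost_triangle:
  assumes \<mu>1: "\<mu>1 \<in> space (prob_algebra S)" and \<mu>2: "\<mu>2 \<in> space (prob_algebra S)"
    and \<mu>3: "\<mu>3 \<in> space (prob_algebra S)" and s: "s > 0"
  shows "transport_cost d \<mu>1 \<mu>3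
    \<le> ennreal (1 + s) * transport_cost d \<mu>1 \<mu>2 + ennreal (1 + 1 / s) * transport_cost d \<mu>2 \<mu>3"
proof (cases "transport_cost d \<mu>1 \<mu>2 = \<top> \<or> transport_cost d \<mu>2 \<mu>3 = \<top>")
  case True
  \<comment> \<open>Both weights are positive, so an infinite cost on either leg makes the
    right-hand side infinite.\<close>
  then show ?thesis
    using s by (auto simp: ennreal_mult_top add_pos_pos)
next
  case False
  define c1 where "c1 = transport_cost d \<mu>1 \<mu>2"
  define c2 where "c2 = transport_cost d \<mu>2 \<mu>3"
  \<comment> \<open>The additive errors of each leg are multiplied by the weight of that leg;
    \<open>k\<close> is the sum of the two weights.\<close>
  define k where "k = (1 + s) + (1 + 1 / s)"
  have k: "k \<ge> 0" using s by (simp add: k_def)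
  show ?thesis
    unfolding c1_def[symmetric] c2_def[symmetric]
  proof (rule ennreal_le_limit[OF k])
    fix t :: real assume t: "t > 0"
    \<comment> \<open>A single quantizer for all three measures makes the second marginal of
      \<open>a\<close> and the first marginal of \<open>b\<close> the same sequence.\<close>
    obtain T r where q: "quantizer t T r"
      using quantizer_exists[OF t prob_algebra_not_empty[OF \<mu>1]] by auto
    have r: "r n \<in> space S" for n
      using q by (simp add: quantizer_def)
    define G where "G i j = ennreal ((d (r i) (r j))\<^sup>2)" for i j
    obtain a where a: "matrix_coupling (cell_mass \<mu>1 T) (cell_mass \<mu>2 T) a"
      and a_le: "(\<Sum>i. \<Sum>j. a i j * G i j) \<le> ennreal (1 + t) * (c1 + ennreal t) + ennreal t"
      using transport_cost_discretize[OF \<mu>1 \<mu>2 t q, of c1] False by (auto simp: c1_def G_def)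
    obtain b where b: "matrix_coupling (cell_mass \<mu>2 T) (cell_mass \<mu>3 T) b"
      and b_le: "(\<Sum>i. \<Sum>j. b i j * G i j) \<le> ennreal (1 + t) * (c2 + ennreal t) + ennreal t"
      using transport_cost_discretize[OF \<mu>2 \<mu>3 t q, of c2] False by (auto simp: c2_def G_def)
    have G: "G i k \<le> ennreal (1 + s) * G i j + ennreal (1 + 1 / s) * G j k" for i j k
    proof -
      have "(d (r i) (r k))\<^sup>2 \<le> (d (r i) (r j) + d (r j) (r k))\<^sup>2"
        using r d_nonneg d_triangle by (intro power_mono) auto
      also have "\<dots> \<le> (1 + s) * (d (r i) (r j))\<^sup>2 + (1 + 1 / s) * (d (r j) (r k))\<^sup>2"
        by (rule power2_add_le[OF s])
      finally have "G i k \<le> ennreal ((1 + s) * (d (r i) (r j))\<^sup>2 + (1 + 1 / s) * (d (r j) (r k))\<^sup>2)"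
        unfolding G_def by (rule ennreal_leI)
      then show ?thesis
        using s by (simp add: G_def ennreal_plus ennreal_mult)
    qed
    have "cell_mass \<mu>2 T j \<noteq> \<top>" for j
      using \<mu>2 by (intro cell_mass_neq_top) (simp add: space_prob_algebra)
    note fin = this
    obtain c where c: "matrix_coupling (cell_mass \<mu>1 T) (cell_mass \<mu>3 T) c"
      and c_le: "(\<Sum>i. \<Sum>k. c i k * G i k) \<le> (\<Sum>i. \<Sum>j. a i j * (ennreal (1 + s) * G i j))
        + (\<Sum>j. \<Sum>k. b j k * (ennreal (1 + 1 / s) * G j k))"
      by (rule matrix_coupling_glue[OF a b fin G])
    have e1: "(\<Sum>i. \<Sum>j. a i j * (ennreal (1 + s) * G i j)) = ennreal (1 + s) * (\<Sum>i. \<Sum>j. a i j * G i j)"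
      by (simp only: mult.left_commute[of _ "ennreal (1 + s)"] ennreal_suminf_cmult)
    have e2: "(\<Sum>i. \<Sum>j. b i j * (ennreal (1 + 1 / s) * G i j))
        = ennreal (1 + 1 / s) * (\<Sum>i. \<Sum>j. b i j * G i j)"
      by (simp only: mult.left_commute[of _ "ennreal (1 + 1 / s)"] ennreal_suminf_cmult)
    have "(\<Sum>i. \<Sum>k. c i k * G i k)
        \<le> ennreal (1 + s) * (ennreal (1 + t) * (c1 + ennreal t) + ennreal t)
          + ennreal (1 + 1 / s) * (ennreal (1 + t) * (c2 + ennreal t) + ennreal t)"
      using c_le unfolding e1 e2
      by (rule order_trans) (intro add_mono mult_left_mono a_le b_le zero_le)
    also have "\<dots> = ennreal (1 + t) * ((ennreal (1 + s) * c1 + ennreal (1 + 1 / s) * c2)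
        + (ennreal (1 + s) * ennreal t + ennreal (1 + 1 / s) * ennreal t))
        + (ennreal (1 + s) * ennreal t + ennreal (1 + 1 / s) * ennreal t)"
      by (simp only: distrib_left distrib_right mult_ac add_ac)
    also have "ennreal (1 + s) * ennreal t + ennreal (1 + 1 / s) * ennreal t = ennreal (k * t)"
      using s t by (simp add: k_def distrib_right flip: ennreal_mult ennreal_plus)
    finally have "ennreal (1 + t) * (\<Sum>i. \<Sum>k. c i k * G i k) + ennreal t
        \<le> ennreal (1 + t) * (ennreal (1 + t) * (ennreal (1 + s) * c1 + ennreal (1 + 1 / s) * c2 + ennreal (k * t))
          + ennreal (k * t)) + ennreal t"
      by (intro add_right_mono mult_left_mono) auto
    then show "transport_cost d \<mu>1 \<mu>3 \<le> ennreal (1 + t) * (ennreal (1 + t)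
        * (ennreal (1 + s) * c1 + ennreal (1 + 1 / s) * c2 + ennreal (k * t)) + ennreal (k * t)) + ennreal t"
      using transport_cost_undiscretize[OF \<mu>1 \<mu>3 t q c] unfolding G_def by (rule order_trans[rotated])
  qed
qed

lemma d_measurable_fst:
  assumes "z \<in> space S"
  shows "(\<lambda>y. d y z) \<in> borel_measurable S"
proof -
  have "(\<lambda>y. (y, z)) \<in> S \<rightarrow>\<^sub>M S \<Otimes>\<^sub>M S"
    using assms by measurable
  from measurable_compose[OF this d_measurable] show ?thesis
    by simp
qed

text \<open>The quantizer compares the distance to \<open>z\<close> with the distance to the
  representative of its cell. The finiteness obtained is the moment hypothesis of
  \<open>measurable_matrix_coupling\<close>.\<close>

lemma cell_moment_finite:
  assumes \<mu>: "\<mu> \<in> space (prob_algebra S)" and o: "z \<in> space S" and t: "t > 0" and q: "quantizer t T r"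
    and fin: "(\<integral>\<^sup>+y. ennreal ((d y z)\<^sup>2) \<partial>\<mu>) \<noteq> \<top>"
  shows "(\<Sum>i. cell_mass \<mu> T i * ennreal ((d (r i) (r (T z)))\<^sup>2)) \<noteq> \<top>"
proof -
  have T: "T \<in> S \<rightarrow>\<^sub>M count_space UNIV"
    and D: "\<And>x y. x \<in> space S \<Longrightarrow> y \<in> space S \<Longrightarrow> (d (r (T x)) (r (T y)))\<^sup>2 \<le> (1 + t) * (d x y)\<^sup>2 + t"
    using q by (auto simp: quantizer_def)
  have \<mu>_sets[measurable_cong]: "sets \<mu> = sets S" and "prob_space \<mu>"
    using \<mu> by (auto simp: space_prob_algebra)
  have sp: "space \<mu> = space S"
    using \<mu>_sets by (rule sets_eq_imp_space_eq)
  note d_measurable_fst[OF o, measurable]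
  have "(\<Sum>i. cell_mass \<mu> T i * ennreal ((d (r i) (r (T z)))\<^sup>2)) = (\<integral>\<^sup>+y. ennreal ((d (r (T y)) (r (T z)))\<^sup>2) \<partial>\<mu>)"
    using T by (intro nn_integral_cells[symmetric]) (simp cong: measurable_cong_sets)
  also have "\<dots> \<le> (\<integral>\<^sup>+y. ennreal (1 + t) * ennreal ((d y z)\<^sup>2) + ennreal t \<partial>\<mu>)"
  proof (rule nn_integral_mono)
    fix y assume "y \<in> space \<mu>"
    then have "ennreal ((d (r (T y)) (r (T z)))\<^sup>2) \<le> ennreal ((1 + t) * (d y z)\<^sup>2 + t)"
      using o sp by (intro ennreal_leI D) auto
    then show "ennreal ((d (r (T y)) (r (T z)))\<^sup>2) \<le> ennreal (1 + t) * ennreal ((d y z)\<^sup>2) + ennreal t"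
      using t by (simp add: ennreal_plus ennreal_mult)
  qed
  also have "\<dots> = ennreal (1 + t) * (\<integral>\<^sup>+y. ennreal ((d y z)\<^sup>2) \<partial>\<mu>) + ennreal t"
    using prob_space.emeasure_space_1[OF \<open>prob_space \<mu>\<close>] by (simp add: nn_integral_add nn_integral_cmult)
  also have "\<dots> < \<top>"
    using fin by (simp add: ennreal_mult_less_top less_top)
  finally show ?thesis by simp
qed

text \<open>The matrices of near-optimal couplings can be chosen measurably in the parameter, because
  only countably many matrices are needed up to a small residual.\<close>

lemma transport_cost_bind_le:
  assumes m: "m \<in> space (prob_algebra X)"
    and K: "K \<in> X \<rightarrow>\<^sub>M prob_algebra S" and L: "L \<in> X \<rightarrow>\<^sub>M prob_algebra S"
    and g[measurable]: "g \<in> borel_measurable X" and z: "z \<in> space S"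
    and le: "AE x in m. transport_cost d (K x) (L x) \<le> g x"
    and finK: "AE x in m. (\<integral>\<^sup>+y. ennreal ((d y z)\<^sup>2) \<partial>K x) \<noteq> \<top>"
    and finL: "AE x in m. (\<integral>\<^sup>+y. ennreal ((d y z)\<^sup>2) \<partial>L x) \<noteq> \<top>"
  shows "transport_cost d (m \<bind> K) (m \<bind> L) \<le> (\<integral>\<^sup>+x. g x \<partial>m)"
proof (cases "(\<integral>\<^sup>+x. g x \<partial>m) = \<top>")
  case False
  have m_sets[measurable_cong]: "sets m = sets X" and m_prob: "prob_space m"
    using m by (auto simp: space_prob_algebra)
  have m_space: "space m = space X"
    using m_sets by (rule sets_eq_imp_space_eq)
  have mK: "m \<bind> K \<in> space (prob_algebra S)" and mL: "m \<bind> L \<in> space (prob_algebra S)"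
    using prob_space_bind'[OF m K] sets_bind'[OF m K] prob_space_bind'[OF m L] sets_bind'[OF m L]
    by (auto simp: space_prob_algebra)
  have Kx: "K x \<in> space (prob_algebra S)" and Lx: "L x \<in> space (prob_algebra S)" if "x \<in> space X" for x
    using measurable_space[OF K that] measurable_space[OF L that] by auto
  \<comment> \<open>Near-optimal couplings need a finite bound, which the finite integral provides
    almost everywhere.\<close>
  have g_fin: "AE x in m. g x \<noteq> \<top>"
    using nn_integral_PInf_AE[of g m] False by simp
  show ?thesis
  \<comment> \<open>Here \<open>k = 2\<close>: one outer additive \<open>t\<close> comes from
    discretizing at each \<open>x\<close>, the other from the measurable choice with tolerance
    \<open>t\<close>.\<close>
  proof (rule ennreal_le_limit[of 2])
    fix t :: real assume t: "t > 0"
    obtain T r where q: "quantizer t T r"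
      using quantizer_exists[OF t] z by auto
    have r: "r n \<in> space S" for n
      using q by (simp add: quantizer_def)
    have T[measurable]: "T \<in> S \<rightarrow>\<^sub>M count_space UNIV"
      using q by (simp add: quantizer_def)
    define G where "G i j = ennreal ((d (r i) (r j))\<^sup>2)" for i j
    \<comment> \<open>Young's inequality with weight 1, through the representative of the cell of
      \<open>z\<close>, produces the factor 2 in \<open>G i j \<le> u i + u j\<close>.\<close>
    define u where "u i = 2 * ennreal ((d (r i) (r (T z)))\<^sup>2)" for i
    define g' where "g' x = ennreal (1 + t) * (g x + ennreal t) + ennreal t" for x
    have G: "G i j \<le> u i + u j" for i j
    proof -
      have "d (r i) (r j) \<le> d (r i) (r (T z)) + d (r j) (r (T z))"
        using d_triangle[OF r[of i] r[of "T z"] r[of j]] d_sym[OF r[of "T z"] r[of j]] by simp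
      then have "(d (r i) (r j))\<^sup>2 \<le> (d (r i) (r (T z)) + d (r j) (r (T z)))\<^sup>2"
        using d_nonneg[OF r r] by (intro power_mono)
      also have "\<dots> \<le> 2 * (d (r i) (r (T z)))\<^sup>2 + 2 * (d (r j) (r (T z)))\<^sup>2"
        using power2_add_le[of 1 "d (r i) (r (T z))" "d (r j) (r (T z))"] by simp
      finally have "G i j \<le> ennreal (2 * (d (r i) (r (T z)))\<^sup>2 + 2 * (d (r j) (r (T z)))\<^sup>2)"
        unfolding G_def by (rule ennreal_leI)
      then show ?thesis
        by (simp add: u_def ennreal_plus ennreal_mult)
    qed
    have u_fin: "u i \<noteq> \<top>" for i
      by (simp add: u_def ennreal_mult_eq_top_iff)
    have g'_meas: "g' \<in> borel_measurable X"
      unfolding g'_def by measurable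
    have t': "ennreal t > 0"
      using t by simp
    obtain a where a_meas[measurable]: "\<And>i j. (\<lambda>x. a x i j) \<in> borel_measurable X"
      and a: "\<And>x b. (\<Sum>i. cell_mass (K x) T i) = 1 \<Longrightarrow> (\<Sum>j. cell_mass (L x) T j) = 1
        \<Longrightarrow> matrix_coupling (cell_mass (K x) T) (cell_mass (L x) T) b
        \<Longrightarrow> (\<Sum>i. \<Sum>j. b i j * G i j) \<le> g' x
        \<Longrightarrow> (\<Sum>i. cell_mass (K x) T i * u i) \<noteq> \<top> \<Longrightarrow> (\<Sum>j. cell_mass (L x) T j * u j) \<noteq> \<top>
        \<Longrightarrow> matrix_coupling (cell_mass (K x) T) (cell_mass (L x) T) (a x)
          \<and> (\<Sum>i. \<Sum>j. a x i j * G i j) \<le> g' x + ennreal t"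
      by (rule measurable_matrix_coupling[where p="\<lambda>x. cell_mass (K x) T"
            and q="\<lambda>x. cell_mass (L x) T" and G=G and u=u and v=u and e="ennreal t",
            OF cell_mass_bind(2)[OF m K T] cell_mass_bind(2)[OF m L T] g'_meas G u_fin u_fin t'])
        (rule that)
    have good: "AE x in m. matrix_coupling (cell_mass (K x) T) (cell_mass (L x) T) (a x)
        \<and> (\<Sum>i. \<Sum>j. a x i j * G i j) \<le> g' x + ennreal t"
      using le finK finL g_fin AE_space
    proof eventually_elim
      case (elim x)
      then have x: "x \<in> space X" by (simp add: m_space)
      obtain b where b: "matrix_coupling (cell_mass (K x) T) (cell_mass (L x) T) b"
        "(\<Sum>i. \<Sum>j. b i j * ennreal ((d (r i) (r j))\<^sup>2)) \<le> ennreal (1 + t) * (g x + ennreal t) + ennreal t"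
        by (rule transport_cost_discretize[OF Kx[OF x] Lx[OF x] t q elim(1,4)])
      have TK: "T \<in> K x \<rightarrow>\<^sub>M count_space UNIV" "prob_space (K x)"
        and TL: "T \<in> L x \<rightarrow>\<^sub>M count_space UNIV" "prob_space (L x)"
        using Kx[OF x] Lx[OF x] T by (auto simp: space_prob_algebra cong: measurable_cong_sets)
      have mom: "(\<Sum>i. cell_mass \<mu> T i * u i) \<noteq> \<top>"
        if "\<mu> \<in> space (prob_algebra S)" "(\<integral>\<^sup>+y. ennreal ((d y z)\<^sup>2) \<partial>\<mu>) \<noteq> \<top>" for \<mu>
      proof -
        have "(\<Sum>i. cell_mass \<mu> T i * u i) = 2 * (\<Sum>i. cell_mass \<mu> T i * ennreal ((d (r i) (r (T z)))\<^sup>2))"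
          unfolding u_def by (simp only: mult.left_commute[of _ 2] ennreal_suminf_cmult)
        then show ?thesis
          using cell_moment_finite[OF that(1) z t q that(2)] by (simp add: ennreal_mult_eq_top_iff)
      qed
      show ?case
        using a[of x b, OF suminf_cell_mass[OF TK] suminf_cell_mass[OF TL] b(1) _
            mom[OF Kx[OF x] elim(2)] mom[OF Lx[OF x] elim(3)]] b(2)
        by (simp add: G_def g'_def)
    qed
    \<comment> \<open>Row sums, column sums and cost are linear in the matrix, so the averaged
      matrix couples the cell masses of the two mixtures at the averaged cost.\<close>
    define A where "A i j = (\<integral>\<^sup>+x. a x i j \<partial>m)" for i j
    have "(\<Sum>j. A i j) = cell_mass (m \<bind> K) T i" for i
    proof -
      have "(\<Sum>j. A i j) = (\<integral>\<^sup>+x. (\<Sum>j. a x i j) \<partial>m)"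
        unfolding A_def by (rule nn_integral_suminf[symmetric]) measurable
      also have "\<dots> = (\<integral>\<^sup>+x. cell_mass (K x) T i \<partial>m)"
        by (rule nn_integral_cong_AE, rule eventually_mono[OF good]) (simp add: matrix_coupling_def)
      finally show ?thesis
        by (simp add: cell_mass_bind(1)[OF m K T])
    qed
    moreover have "(\<Sum>i. A i j) = cell_mass (m \<bind> L) T j" for j
    proof -
      have "(\<Sum>i. A i j) = (\<integral>\<^sup>+x. (\<Sum>i. a x i j) \<partial>m)"
        unfolding A_def by (rule nn_integral_suminf[symmetric]) measurable
      also have "\<dots> = (\<integral>\<^sup>+x. cell_mass (L x) T j \<partial>m)"
        by (rule nn_integral_cong_AE, rule eventually_mono[OF good]) (simp add: matrix_coupling_def)
      finally show ?thesis
        by (simp add: cell_mass_bind(1)[OF m L T])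
    qed
    ultimately have A: "matrix_coupling (cell_mass (m \<bind> K) T) (cell_mass (m \<bind> L) T) A"
      by (simp add: matrix_coupling_def)
    have "(\<Sum>i. \<Sum>j. A i j * G i j) = (\<Sum>i. \<Sum>j. \<integral>\<^sup>+x. a x i j * G i j \<partial>m)"
      unfolding A_def by (simp add: nn_integral_multc)
    also have "\<dots> = (\<Sum>i. \<integral>\<^sup>+x. (\<Sum>j. a x i j * G i j) \<partial>m)"
      by (subst nn_integral_suminf) auto
    also have "\<dots> = (\<integral>\<^sup>+x. (\<Sum>i. \<Sum>j. a x i j * G i j) \<partial>m)"
      by (rule nn_integral_suminf[symmetric]) measurable
    also have "\<dots> \<le> (\<integral>\<^sup>+x. g' x + ennreal t \<partial>m)"
      by (rule nn_integral_mono_AE, rule eventually_mono[OF good]) simp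
    also have "\<dots> = ennreal (1 + t) * ((\<integral>\<^sup>+x. g x \<partial>m) + ennreal t) + ennreal t + ennreal t"
      unfolding g'_def using prob_space.emeasure_space_1[OF m_prob]
      by (simp add: nn_integral_add nn_integral_cmult)
    also have "\<dots> \<le> ennreal (1 + t) * ((\<integral>\<^sup>+x. g x \<partial>m) + ennreal (2 * t)) + ennreal (2 * t)"
    proof -
      have t2: "ennreal t + ennreal t = ennreal (2 * t)"
        using t by (simp flip: ennreal_plus)
      show ?thesis
        unfolding add.assoc t2 using t by (intro add_right_mono mult_left_mono add_left_mono ennreal_leI) auto
    qed
    finally have "ennreal (1 + t) * (\<Sum>i. \<Sum>j. A i j * G i j) + ennreal t
      \<le> ennreal (1 + t) * (ennreal (1 + t) * ((\<integral>\<^sup>+x. g x \<partial>m) + ennreal (2 * t)) + ennreal (2 * t)) + ennreal t"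
      by (intro add_right_mono mult_left_mono) auto
    then show "transport_cost d (m \<bind> K) (m \<bind> L)
      \<le> ennreal (1 + t) * (ennreal (1 + t) * ((\<integral>\<^sup>+x. g x \<partial>m) + ennreal (2 * t)) + ennreal (2 * t)) + ennreal t"
      using transport_cost_undiscretize[OF mK mL t q A] unfolding G_def by (rule order_trans[rotated])
  qed simp
qed simp

text \<open>Along a coupling of finite cost, the squared distance of one coordinate to
  \<open>z\<close> is at most twice the transport term plus twice the squared distance of the other.
  Finite cost is accepted in either order because both orders occur in the applications.\<close>

lemma second_moment_finite_transfer:
  assumes \<mu>: "\<mu> \<in> space (prob_algebra S)" and \<nu>: "\<nu> \<in> space (prob_algebra S)" and z: "z \<in> space S"
    and cost: "transport_cost d \<mu> \<nu> \<noteq> \<top> \<or> transport_cost d \<nu> \<mu> \<noteq> \<top>"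
    and fin: "(\<integral>\<^sup>+y. ennreal ((d y z)\<^sup>2) \<partial>\<mu>) \<noteq> \<top>"
  shows "(\<integral>\<^sup>+y. ennreal ((d y z)\<^sup>2) \<partial>\<nu>) \<noteq> \<top>"
proof -
  have \<mu>_sets: "sets \<mu> = sets S" and \<nu>_sets: "sets \<nu> = sets S"
    using \<mu> \<nu> by (auto simp: space_prob_algebra)
  \<comment> \<open>Naming the two coordinate maps \<open>f\<close> and \<open>h\<close> reduces
    both orders to one computation.\<close>
  have "\<exists>(\<pi> :: ('b \<times> 'b) measure) f h. f \<in> \<pi> \<rightarrow>\<^sub>M S \<and> h \<in> \<pi> \<rightarrow>\<^sub>M S \<and> distr \<pi> S f = \<mu> \<and> distr \<pi> S h = \<nu>
    \<and> (\<lambda>w. d (f w) (h w)) \<in> borel_measurable \<pi> \<and> (\<integral>\<^sup>+w. ennreal ((d (f w) (h w))\<^sup>2) \<partial>\<pi>) \<noteq> \<top>"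
    using cost
  proof
    assume "transport_cost d \<mu> \<nu> \<noteq> \<top>"
    then obtain \<pi> where \<pi>: "\<pi> \<in> couplings \<mu> \<nu>"
      "(\<integral>\<^sup>+w. ennreal ((d (fst w) (snd w))\<^sup>2) \<partial>\<pi>) \<le> transport_cost d \<mu> \<nu> + 1"
      using transport_cost_near_optimal[of d \<mu> \<nu> "transport_cost d \<mu> \<nu>" 1] by auto
    then have "(\<integral>\<^sup>+w. ennreal ((d (fst w) (snd w))\<^sup>2) \<partial>\<pi>) \<noteq> \<top>"
      using \<open>transport_cost d \<mu> \<nu> \<noteq> \<top>\<close> by (auto simp: top_unique)
    then show ?thesis
      using \<pi>(1) couplings_iff[OF \<mu>_sets \<nu>_sets, of \<pi>] d_measurable
      by (intro exI[of _ \<pi>] exI[of _ fst] exI[of _ snd]) (auto cong: measurable_cong_sets)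
  next
    assume "transport_cost d \<nu> \<mu> \<noteq> \<top>"
    then obtain \<pi> where \<pi>: "\<pi> \<in> couplings \<nu> \<mu>"
      "(\<integral>\<^sup>+w. ennreal ((d (fst w) (snd w))\<^sup>2) \<partial>\<pi>) \<le> transport_cost d \<nu> \<mu> + 1"
      using transport_cost_near_optimal[of d \<nu> \<mu> "transport_cost d \<nu> \<mu>" 1] by auto
    then have fin': "(\<integral>\<^sup>+w. ennreal ((d (fst w) (snd w))\<^sup>2) \<partial>\<pi>) \<noteq> \<top>"
      using \<open>transport_cost d \<nu> \<mu> \<noteq> \<top>\<close> by (auto simp: top_unique)
    have \<pi>': "sets \<pi> = sets (S \<Otimes>\<^sub>M S)" "distr \<pi> S fst = \<nu>" "distr \<pi> S snd = \<mu>"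
      using \<pi>(1) couplings_iff[OF \<nu>_sets \<mu>_sets, of \<pi>] by auto
    have sym: "d (snd w) (fst w) = d (fst w) (snd w)" if "w \<in> space \<pi>" for w
      using coupling_space[OF \<nu> \<mu> \<pi>(1) that] by (rule d_sym[symmetric])
    have "(\<lambda>w. d (snd w) (fst w)) \<in> borel_measurable \<pi>"
      using d_measurable \<pi>'(1) sym by (subst measurable_cong[OF sym]) (simp_all cong: measurable_cong_sets)
    moreover have "(\<integral>\<^sup>+w. ennreal ((d (snd w) (fst w))\<^sup>2) \<partial>\<pi>) \<noteq> \<top>"
      using fin' sym by (simp cong: nn_integral_cong_simp)
    ultimately show ?thesis
      using \<pi>' by (intro exI[of _ \<pi>] exI[of _ snd] exI[of _ fst]) (auto cong: measurable_cong_sets)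
  qed
  then obtain \<pi> :: "('b \<times> 'b) measure" and f h where f[measurable]: "f \<in> \<pi> \<rightarrow>\<^sub>M S" and h[measurable]: "h \<in> \<pi> \<rightarrow>\<^sub>M S"
    and \<pi>f: "distr \<pi> S f = \<mu>" and \<pi>h: "distr \<pi> S h = \<nu>"
    and fh[measurable]: "(\<lambda>w. d (f w) (h w)) \<in> borel_measurable \<pi>"
    and c: "(\<integral>\<^sup>+w. ennreal ((d (f w) (h w))\<^sup>2) \<partial>\<pi>) \<noteq> \<top>"
    by blast
  note d_measurable_fst[OF z, measurable]
  have "(\<integral>\<^sup>+y. ennreal ((d y z)\<^sup>2) \<partial>\<nu>) = (\<integral>\<^sup>+w. ennreal ((d (h w) z)\<^sup>2) \<partial>\<pi>)"
    unfolding \<pi>h[symmetric] by (rule nn_integral_distr) measurable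
  also have "\<dots> \<le> (\<integral>\<^sup>+w. 2 * ennreal ((d (f w) (h w))\<^sup>2) + 2 * ennreal ((d (f w) z)\<^sup>2) \<partial>\<pi>)"
  proof (rule nn_integral_mono)
    fix w assume "w \<in> space \<pi>"
    then have fw: "f w \<in> space S" and hw: "h w \<in> space S"
      using measurable_space[OF f] measurable_space[OF h] by auto
    have "(d (h w) z)\<^sup>2 \<le> (d (f w) (h w) + d (f w) z)\<^sup>2"
      using d_triangle[OF hw fw z] d_sym[OF hw fw] d_nonneg[OF hw z] by (intro power_mono) auto
    also have "\<dots> \<le> 2 * (d (f w) (h w))\<^sup>2 + 2 * (d (f w) z)\<^sup>2"
      using power2_add_le[of 1 "d (f w) (h w)" "d (f w) z"] by simp
    finally have "ennreal ((d (h w) z)\<^sup>2) \<le> ennreal (2 * (d (f w) (h w))\<^sup>2 + 2 * (d (f w) z)\<^sup>2)"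
      by (rule ennreal_leI)
    then show "ennreal ((d (h w) z)\<^sup>2) \<le> 2 * ennreal ((d (f w) (h w))\<^sup>2) + 2 * ennreal ((d (f w) z)\<^sup>2)"
      by (simp add: ennreal_plus ennreal_mult)
  qed
  also have "\<dots> = 2 * (\<integral>\<^sup>+w. ennreal ((d (f w) (h w))\<^sup>2) \<partial>\<pi>) + 2 * (\<integral>\<^sup>+w. ennreal ((d (f w) z)\<^sup>2) \<partial>\<pi>)"
    by (simp add: nn_integral_add nn_integral_cmult)
  also have "(\<integral>\<^sup>+w. ennreal ((d (f w) z)\<^sup>2) \<partial>\<pi>) = (\<integral>\<^sup>+y. ennreal ((d y z)\<^sup>2) \<partial>\<mu>)"
    unfolding \<pi>f[symmetric] by (rule nn_integral_distr[symmetric]) measurable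
  finally show ?thesis
    using c fin by (auto simp: top_unique ennreal_mult_eq_top_iff)
qed

end

section \<open>Relative entropy\<close>

text \<open>The integrand \<open>u * ln u\<close> of the entropy with \<open>1 - u\<close> added.
  For a density the added term integrates to 0, while the sum is nonnegative, so that entropies
  become integrals in \<open>ennreal\<close>.\<close>

definition entropy_fun :: "real \<Rightarrow> real" where
  "entropy_fun u = u * ln u - u + 1"

lemma entropy_fun_nonneg: "u \<ge> 0 \<Longrightarrow> entropy_fun u \<ge> 0"
proof (cases "u = 0")
  case False
  assume "u \<ge> 0"
  then have u: "u > 0" using False by simp
  have "- ln u \<le> 1 / u - 1"
    using ln_le_minus_one[of "1 / u"] u by (simp add: ln_div)
  then have "u * (- ln u) \<le> u * (1 / u - 1)"
    using u by (intro mult_left_mono) auto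
  then show ?thesis
    using u by (simp add: entropy_fun_def right_diff_distrib)
qed (simp add: entropy_fun_def)

lemma entropy_fun_0: "entropy_fun 0 = 1"
  by (simp add: entropy_fun_def)

lemma entropy_fun_measurable[measurable]: "entropy_fun \<in> borel_measurable borel"
  unfolding entropy_fun_def by measurable

text \<open>With \<open>A\<close> and \<open>B\<close> the integrals of the positive and negative
  parts of \<open>F * ln F\<close>, the integrands behind \<open>E + B + 1\<close> and
  \<open>A + 1\<close> agree pointwise, the 1 on the left being the integral of \<open>F\<close>.
  Since \<open>B \<le> 1\<close>, it may be subtracted.\<close>

lemma relative_entropy_density:
  assumes N: "prob_space N" and F[measurable]: "F \<in> borel_measurable N" and pos: "\<And>x. F x \<ge> 0"
    and one: "(\<integral>\<^sup>+x. ennreal (F x) \<partial>N) = 1"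
  shows "relative_entropy (density N (\<lambda>x. ennreal (F x))) N
    = enn2ereal (\<integral>\<^sup>+x. ennreal (entropy_fun (F x)) \<partial>N)"
proof -
  interpret prob_space N by fact
  define Q where "Q = density N (\<lambda>x. ennreal (F x))"
  have ac: "absolutely_continuous N Q"
    unfolding Q_def by (intro absolutely_continuousI_density) measurable
  have "AE x in N. ennreal (F x) = RN_deriv N Q x"
    using RN_deriv_unique[of "\<lambda>x. ennreal (F x)" Q] by (simp add: Q_def)
  then have RN: "AE x in N. enn2real (RN_deriv N Q x) = F x"
    by eventually_elim (metis enn2real_ennreal pos)
  \<comment> \<open>The cases \<open>s = 1\<close> and \<open>s = -1\<close> are the two parts in
    \<open>relative_entropy\<close>.\<close>
  have int: "(\<integral>\<^sup>+x. ennreal (s * ln (enn2real (RN_deriv N Q x))) \<partial>Q)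
      = (\<integral>\<^sup>+x. ennreal (F x * max 0 (s * ln (F x))) \<partial>N)" for s
  proof -
    have "(\<integral>\<^sup>+x. ennreal (s * ln (enn2real (RN_deriv N Q x))) \<partial>Q)
        = (\<integral>\<^sup>+x. ennreal (F x) * ennreal (s * ln (enn2real (RN_deriv N Q x))) \<partial>N)"
      unfolding Q_def by (rule nn_integral_density) measurable
    also have "\<dots> = (\<integral>\<^sup>+x. ennreal (F x * max 0 (s * ln (F x))) \<partial>N)"
      using RN
      by (intro nn_integral_cong_AE, elim eventually_mono)
        (auto simp: ennreal_mult pos max_def ennreal_neg)
    finally show ?thesis .
  qed
  define A where "A = (\<integral>\<^sup>+x. ennreal (F x * max 0 (ln (F x))) \<partial>N)"
  define B where "B = (\<integral>\<^sup>+x. ennreal (F x * max 0 (- ln (F x))) \<partial>N)"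
  define E where "E = (\<integral>\<^sup>+x. ennreal (entropy_fun (F x)) \<partial>N)"
  have B_le: "F x * max 0 (- ln (F x)) \<le> 1" for x
    using entropy_fun_nonneg[OF pos[of x]] pos[of x] by (auto simp: entropy_fun_def max_def)
  have "B \<le> (\<integral>\<^sup>+x. 1 \<partial>N)"
    unfolding B_def using B_le by (intro nn_integral_mono) (simp add: ennreal_le_1)
  then have B_fin: "B \<noteq> \<top>"
    by (auto simp: emeasure_space_1 top_unique)
  have "E + B + 1 = (\<integral>\<^sup>+x. ennreal (entropy_fun (F x)) + ennreal (F x * max 0 (- ln (F x))) + ennreal (F x) \<partial>N)"
    unfolding E_def B_def by (simp add: nn_integral_add one)
  also have "\<dots> = (\<integral>\<^sup>+x. ennreal (F x * max 0 (ln (F x))) + 1 \<partial>N)"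
  proof (rule nn_integral_cong)
    fix x
    have "entropy_fun (F x) + F x * max 0 (- ln (F x)) + F x = F x * max 0 (ln (F x)) + 1"
      by (auto simp: entropy_fun_def max_def algebra_simps)
    then have "ennreal (entropy_fun (F x) + F x * max 0 (- ln (F x)) + F x) = ennreal (F x * max 0 (ln (F x)) + 1)"
      by simp
    then show "ennreal (entropy_fun (F x)) + ennreal (F x * max 0 (- ln (F x))) + ennreal (F x)
        = ennreal (F x * max 0 (ln (F x))) + 1"
      using pos entropy_fun_nonneg by (subst (asm) ennreal_plus; simp)
  qed
  also have "\<dots> = A + 1"
    unfolding A_def by (simp add: nn_integral_add emeasure_space_1)
  finally have "1 + A = 1 + (E + B)"
    by (simp add: add_ac)
  then have A: "A = E + B"
    by (simp add: ennreal_add_left_cancel)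
  have "relative_entropy Q N = enn2ereal A - enn2ereal B"
    unfolding relative_entropy_def using ac int[of 1] int[of "-1"] by (simp add: A_def B_def)
  also have "\<dots> = enn2ereal E"
    using B_fin unfolding A plus_ennreal.rep_eq
    by (cases B; cases "enn2ereal E") (auto simp: )
  finally show ?thesis
    by (simp add: Q_def E_def)
qed

text \<open>Finite entropy forces absolute continuity. The Radon-Nikodym derivative of a finite
  measure is finite almost everywhere, so the real-valued \<open>F\<close> differs from it on a null
  set only.\<close>

lemma relative_entropy_finite_density:
  assumes N: "prob_space N" and Q: "prob_space Q" and sets: "sets Q = sets N"
    and fin: "relative_entropy Q N \<noteq> \<infinity>"
  obtains F :: "'a \<Rightarrow> real" where "F \<in> borel_measurable N" "\<And>x. F x \<ge> 0"
    "(\<integral>\<^sup>+x. ennreal (F x) \<partial>N) = 1" "Q = density N (\<lambda>x. ennreal (F x))"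
proof
  interpret prob_space N by fact
  interpret Q: prob_space Q by fact
  define F where "F x = enn2real (RN_deriv N Q x)" for x
  have ac: "absolutely_continuous N Q"
    using fin by (auto simp: relative_entropy_def split: if_splits)
  have "AE x in N. RN_deriv N Q x \<noteq> \<infinity>"
    using ac sets by (intro RN_deriv_finite) (auto intro: Q.sigma_finite_measure)
  then have eq: "AE x in N. ennreal (F x) = RN_deriv N Q x"
    by eventually_elim (simp add: F_def less_top)
  show F[measurable]: "F \<in> borel_measurable N"
    unfolding F_def by measurable
  show "F x \<ge> 0" for x
    by (simp add: F_def)
  have "density N (\<lambda>x. ennreal (F x)) = density N (RN_deriv N Q)"
    using eq by (intro density_cong) auto
  then show Q: "Q = density N (\<lambda>x. ennreal (F x))"
    using density_RN_deriv[OF ac sets] by simp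
  have "emeasure Q (space N) = (\<integral>\<^sup>+x. ennreal (F x) \<partial>N)"
    by (subst Q, subst emeasure_density) (auto intro!: nn_integral_cong)
  then show "(\<integral>\<^sup>+x. ennreal (F x) \<partial>N) = 1"
    using Q.emeasure_space_1 sets_eq_imp_space_eq[OF sets] by simp
qed

text \<open>This is the chain rule on a single fibre, \<open>c\<close> being the mass of
  \<open>F\<close> there; it rests on \<open>ln (F x / c) = ln (F x) - ln c\<close>.\<close>

lemma nn_integral_entropy_fun_scale:
  assumes N: "prob_space N" and F[measurable]: "F \<in> borel_measurable N" and pos: "\<And>x. F x \<ge> 0"
    and c: "(\<integral>\<^sup>+x. ennreal (F x) \<partial>N) = ennreal c" "c > 0"
  shows "(\<integral>\<^sup>+x. ennreal (entropy_fun (F x)) \<partial>N)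
    = ennreal (entropy_fun c) + ennreal c * (\<integral>\<^sup>+x. ennreal (entropy_fun (F x / c)) \<partial>N)"
proof -
  interpret prob_space N by fact
  define E where "E = (\<integral>\<^sup>+x. ennreal (entropy_fun (F x)) \<partial>N)"
  define E' where "E' = (\<integral>\<^sup>+x. ennreal (entropy_fun (F x / c)) \<partial>N)"
  \<comment> \<open>\<open>ln c\<close> may be negative, so its parts \<open>p\<close> and
    \<open>n\<close> are kept as nonnegative terms on suitable sides; after integration both sides
    carry \<open>(n + p) * c\<close>, which is finite and cancels.\<close>
  define p where "p = max 0 (ln c)"
  define n where "n = max 0 (- ln c)"
  have pn: "p \<ge> 0" "n \<ge> 0" "ln c = p - n"
    by (auto simp: p_def n_def max_def)
  have id: "entropy_fun (F x) + (n * F x + p * c)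
      = entropy_fun c + (c * entropy_fun (F x / c) + (p * F x + n * c))" for x
  \<comment> \<open>The splitting of the logarithm needs \<open>F x > 0\<close>.\<close>
  proof (cases "F x = 0")
    case True
    then show ?thesis
      by (simp add: entropy_fun_def pn(3) algebra_simps)
  next
    case False
    then have "F x > 0" using pos[of x] by simp
    then have ln: "ln (F x / c) = ln (F x) - ln c"
      using c by (simp add: ln_div)
    have "c * entropy_fun (F x / c) = F x * ln (F x) - F x * ln c - F x + c"
      unfolding entropy_fun_def ln using c(2) by (simp add: field_simps)
    then show ?thesis
      by (simp add: entropy_fun_def pn(3) algebra_simps)
  qed
  have "E + (ennreal n * ennreal c + ennreal p * ennreal c)
      = (\<integral>\<^sup>+x. ennreal (entropy_fun (F x)) + (ennreal n * ennreal (F x) + ennreal p * ennreal c) \<partial>N)"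
    unfolding E_def by (simp add: nn_integral_add nn_integral_cmult c(1) emeasure_space_1)
  also have "\<dots> = (\<integral>\<^sup>+x. ennreal (entropy_fun c) + (ennreal c * ennreal (entropy_fun (F x / c))
      + (ennreal p * ennreal (F x) + ennreal n * ennreal c)) \<partial>N)"
  proof (rule nn_integral_cong)
    fix x
    have nn: "entropy_fun (F x) \<ge> 0" "entropy_fun c \<ge> 0" "entropy_fun (F x / c) \<ge> 0" "F x \<ge> 0"
      using pos[of x] c(2) by (auto intro!: entropy_fun_nonneg)
    have "ennreal (entropy_fun (F x)) + (ennreal n * ennreal (F x) + ennreal p * ennreal c)
        = ennreal (entropy_fun (F x) + (n * F x + p * c))"
      using nn pn c(2) by (simp add: ennreal_mult)
    also have "\<dots> = ennreal (entropy_fun c + (c * entropy_fun (F x / c) + (p * F x + n * c)))"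
      by (simp only: id)
    also have "\<dots> = ennreal (entropy_fun c) + (ennreal c * ennreal (entropy_fun (F x / c))
        + (ennreal p * ennreal (F x) + ennreal n * ennreal c))"
      using nn pn c(2) by (simp add: ennreal_mult)
    finally show "ennreal (entropy_fun (F x)) + (ennreal n * ennreal (F x) + ennreal p * ennreal c) = \<dots>" .
  qed
  also have "\<dots> = ennreal (entropy_fun c) + (ennreal c * E' + (ennreal p * ennreal c + ennreal n * ennreal c))"
    unfolding E'_def by (simp add: nn_integral_add nn_integral_cmult c(1) emeasure_space_1)
  finally have "(ennreal n * ennreal c + ennreal p * ennreal c) + E
      = (ennreal n * ennreal c + ennreal p * ennreal c) + (ennreal (entropy_fun c) + ennreal c * E')"
    by (simp add: add_ac)
  moreover have "ennreal n * ennreal c + ennreal p * ennreal c \<noteq> \<top>"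
    by (simp add: ennreal_mult_eq_top_iff)
  ultimately show ?thesis
    unfolding E_def[symmetric] E'_def[symmetric] by (simp add: ennreal_add_left_cancel)
qed

text \<open>Integrating the fibrewise chain rule against \<open>m\<close> gives the entropy
  identity, and joint measurability of \<open>G\<close> makes the fibres a kernel. The facts are
  bundled because they must hold for the same \<open>f\<close> and \<open>G\<close>.\<close>

lemma entropy_disintegration:
  fixes F :: "'b \<Rightarrow> real"
  assumes m: "m \<in> space (prob_algebra X)" and K: "K \<in> X \<rightarrow>\<^sub>M prob_algebra S"
    and F[measurable]: "F \<in> borel_measurable S" and pos: "\<And>y. F y \<ge> 0"
    and one: "(\<integral>\<^sup>+y. ennreal (F y) \<partial>(m \<bind> K)) = 1"
  obtains f :: "'a \<Rightarrow> real" and G :: "'a \<Rightarrow> 'b \<Rightarrow> real"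
  where "f \<in> borel_measurable X" "\<And>x. f x \<ge> 0" "(\<integral>\<^sup>+x. ennreal (f x) \<partial>m) = 1"
    "\<And>x. x \<in> space X \<Longrightarrow> G x \<in> borel_measurable S" "\<And>x y. G x y \<ge> 0"
    "\<And>x. x \<in> space X \<Longrightarrow> (\<integral>\<^sup>+y. ennreal (G x y) \<partial>K x) = 1"
    "(\<lambda>x. density (K x) (\<lambda>y. ennreal (G x y))) \<in> X \<rightarrow>\<^sub>M prob_algebra S"
    "(\<lambda>x. \<integral>\<^sup>+y. ennreal (entropy_fun (G x y)) \<partial>K x) \<in> borel_measurable X"
    "density (m \<bind> K) (\<lambda>y. ennreal (F y))
      = density m (\<lambda>x. ennreal (f x)) \<bind> (\<lambda>x. density (K x) (\<lambda>y. ennreal (G x y)))"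
    "(\<integral>\<^sup>+y. ennreal (entropy_fun (F y)) \<partial>(m \<bind> K)) = (\<integral>\<^sup>+x. ennreal (entropy_fun (f x)) \<partial>m)
      + (\<integral>\<^sup>+x. (\<integral>\<^sup>+y. ennreal (entropy_fun (G x y)) \<partial>K x) \<partial>density m (\<lambda>x. ennreal (f x)))"
proof
  note Ks[measurable] = measurable_prob_algebraD[OF K]
  have m_sets[measurable_cong]: "sets m = sets X" and m_prob: "prob_space m"
    using m by (auto simp: space_prob_algebra)
  have m_space: "space m = space X"
    using m_sets by (rule sets_eq_imp_space_eq)
  have K_prob: "prob_space (K x)" and K_sets: "sets (K x) = sets S" if "x \<in> space X" for x
    using measurable_space[OF K that] by (auto simp: space_prob_algebra)
  have K_space: "space (K x) = space S" if "x \<in> space X" for x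
    using K_sets[OF that] by (rule sets_eq_imp_space_eq)
  have bind: "(\<integral>\<^sup>+y. h y \<partial>(m \<bind> K)) = (\<integral>\<^sup>+x. \<integral>\<^sup>+y. h y \<partial>K x \<partial>m)"
    if "h \<in> borel_measurable S" for h
    using that by (rule nn_integral_bind) measurable
  define I where "I x = (\<integral>\<^sup>+y. ennreal (F y) \<partial>K x)" for x
  have I[measurable]: "I \<in> borel_measurable X"
    unfolding I_def by measurable
  define f where "f x = enn2real (I x)" for x
  show f[measurable]: "f \<in> borel_measurable X"
    unfolding f_def by measurable
  show f_pos: "f x \<ge> 0" for x
    by (simp add: f_def)
  have I1: "(\<integral>\<^sup>+x. I x \<partial>m) = 1"
    using one bind[of "\<lambda>y. ennreal (F y)"] by (simp add: I_def)
  then have "AE x in m. I x \<noteq> \<top>"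
    using nn_integral_PInf_AE[of I m] by simp
  then have fI: "AE x in m. ennreal (f x) = I x"
    by eventually_elim (simp add: f_def less_top)
  show f1: "(\<integral>\<^sup>+x. ennreal (f x) \<partial>m) = 1"
    using nn_integral_cong_AE[OF fI] I1 by simp
  \<comment> \<open>If the fibre mass is 0, or infinite and hence turned into 0 by
    \<open>enn2real\<close>, the density is set to 1: every fibre stays a probability measure, and
    \<open>f\<close> gives such fibres no weight.\<close>
  define G where "G x y = (if f x > 0 then F y / f x else 1)" for x y
  have GG[measurable]: "(\<lambda>z. G (fst z) (snd z)) \<in> borel_measurable (X \<Otimes>\<^sub>M S)"
    unfolding G_def by measurable
  show G[measurable]: "G x \<in> borel_measurable S" for x
    unfolding G_def by measurable
  show G_pos: "G x y \<ge> 0" for x y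
    using pos f_pos by (simp add: G_def)
  \<comment> \<open>On a fibre of mass 0 \<open>F\<close> vanishes almost everywhere, so the choice
    of \<open>G\<close> there affects neither the mixture nor the entropy.\<close>
  have F0: "AE y in K x. F y = 0" if "x \<in> space X" "ennreal (f x) = I x" "f x = 0" for x
  proof -
    have "(\<integral>\<^sup>+y. ennreal (F y) \<partial>K x) = 0"
      using that by (simp add: I_def)
    then have "AE y in K x. ennreal (F y) = 0"
      using K_sets[OF that(1)] by (subst (asm) nn_integral_0_iff_AE) (auto cong: measurable_cong_sets)
    then show ?thesis
      by eventually_elim (metis ennreal_eq_0_iff order_antisym pos)
  qed
  show G1: "(\<integral>\<^sup>+y. ennreal (G x y) \<partial>K x) = 1" if x: "x \<in> space X" for x
  proof (cases "f x > 0")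
    case True
    then have I: "I x = ennreal (f x)"
      by (auto simp: f_def enn2real_positive_iff)
    have "(\<integral>\<^sup>+y. ennreal (G x y) \<partial>K x) = (\<integral>\<^sup>+y. ennreal (F y) / ennreal (f x) \<partial>K x)"
      using True pos by (simp add: G_def divide_ennreal)
    also have "\<dots> = I x / ennreal (f x)"
      unfolding I_def using K_sets[OF x] by (intro nn_integral_divide) (simp cong: measurable_cong_sets)
    finally show ?thesis
      using True by (simp add: I)
  next
    case False
    then show ?thesis
      using prob_space.emeasure_space_1[OF K_prob[OF x]] by (simp add: G_def)
  qed
  define Q where "Q x = density (K x) (\<lambda>y. ennreal (G x y))" for x
  have Q_sets: "sets (Q x) = sets S" if "x \<in> space X" for x
    using K_sets[OF that] by (simp add: Q_def)
  have Q_int: "(\<integral>\<^sup>+y. h y \<partial>Q x) = (\<integral>\<^sup>+y. ennreal (G x y) * h y \<partial>K x)"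
    if "x \<in> space X" "h \<in> borel_measurable S" for x h
    unfolding Q_def using K_sets[OF that(1)] that(2)
    by (intro nn_integral_density) (simp_all cong: measurable_cong_sets)
  have Q: "Q \<in> X \<rightarrow>\<^sub>M prob_algebra S"
  proof (rule measurable_prob_algebraI)
    show Q_prob: "prob_space (Q x)" if "x \<in> space X" for x
    proof
      have "emeasure (Q x) (space (Q x)) = (\<integral>\<^sup>+y. 1 \<partial>Q x)"
        by simp
      also have "\<dots> = 1"
        using Q_int[OF that, of "\<lambda>_. 1"] G1[OF that] by simp
      finally show "emeasure (Q x) (space (Q x)) = 1" .
    qed
    show "Q \<in> X \<rightarrow>\<^sub>M subprob_algebra S"
    proof (rule measurable_subprob_algebra)
      show "subprob_space (Q x)" if "x \<in> space X" for x
        using Q_prob[OF that] by (rule prob_space_imp_subprob_space)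
      fix A assume A[measurable]: "A \<in> sets S"
      have "(\<lambda>x. \<integral>\<^sup>+y. ennreal (G x y) * indicator A y \<partial>K x) \<in> borel_measurable X"
        by (rule nn_integral_measurable_subprob_algebra2[OF _ Ks])
          (simp add: case_prod_beta)
      then show "(\<lambda>x. emeasure (Q x) A) \<in> borel_measurable X"
      proof (rule measurable_cong[THEN iffD1, rotated])
        fix x assume x: "x \<in> space X"
        show "(\<integral>\<^sup>+y. ennreal (G x y) * indicator A y \<partial>K x) = emeasure (Q x) A"
          using Q_int[OF x, of "indicator A"] Q_sets[OF x] A by simp
      qed
    qed (rule Q_sets)
  qed
  then show "(\<lambda>x. density (K x) (\<lambda>y. ennreal (G x y))) \<in> X \<rightarrow>\<^sub>M prob_algebra S"
    by (simp add: Q_def[abs_def])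
  show H[measurable]: "(\<lambda>x. \<integral>\<^sup>+y. ennreal (entropy_fun (G x y)) \<partial>K x) \<in> borel_measurable X"
    by (rule nn_integral_measurable_subprob_algebra2[OF _ Ks]) (simp add: case_prod_beta)
  define \<nu> where "\<nu> = density m (\<lambda>x. ennreal (f x))"
  have \<nu>: "\<nu> \<in> space (prob_algebra X)"
  proof -
    have "emeasure \<nu> (space \<nu>) = 1"
      using f1 unfolding \<nu>_def
      by (subst emeasure_density) (auto simp: m_space cong: nn_integral_cong_simp simp flip: m_space)
    then show ?thesis
      by (auto simp: space_prob_algebra \<nu>_def m_sets intro: prob_spaceI)
  qed
  show "density (m \<bind> K) (\<lambda>y. ennreal (F y)) = density m (\<lambda>x. ennreal (f x)) \<bind> (\<lambda>x. density (K x) (\<lambda>y. ennreal (G x y)))"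
    unfolding \<nu>_def[symmetric] Q_def[symmetric]
  proof (rule measure_eqI)
    show "sets (density (m \<bind> K) (\<lambda>y. ennreal (F y))) = sets (\<nu> \<bind> Q)"
      using sets_bind'[OF m K] sets_bind'[OF \<nu> Q] by simp
    fix A assume "A \<in> sets (density (m \<bind> K) (\<lambda>y. ennreal (F y)))"
    then have A[measurable]: "A \<in> sets S"
      using sets_bind'[OF m K] by simp
    have "emeasure (density (m \<bind> K) (\<lambda>y. ennreal (F y))) A = (\<integral>\<^sup>+y. ennreal (F y) * indicator A y \<partial>(m \<bind> K))"
      using sets_bind'[OF m K] by (intro emeasure_density) (auto cong: measurable_cong_sets)
    also have "\<dots> = (\<integral>\<^sup>+x. \<integral>\<^sup>+y. ennreal (F y) * indicator A y \<partial>K x \<partial>m)"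
      by (rule bind) measurable
    also have "\<dots> = (\<integral>\<^sup>+x. ennreal (f x) * emeasure (Q x) A \<partial>m)"
    proof (rule nn_integral_cong_AE)
      show "AE x in m. (\<integral>\<^sup>+y. ennreal (F y) * indicator A y \<partial>K x) = ennreal (f x) * emeasure (Q x) A"
        using fI AE_space
      proof eventually_elim
        case (elim x)
        then have x: "x \<in> space X" by (simp add: m_space)
        have m1: "(\<lambda>y. ennreal (G x y) * indicator A y) \<in> borel_measurable (K x)"
          using K_sets[OF x] by (simp cong: measurable_cong_sets)
        have "ennreal (f x) * emeasure (Q x) A = ennreal (f x) * (\<integral>\<^sup>+y. ennreal (G x y) * indicator A y \<partial>K x)"
          using Q_int[OF x, of "indicator A"] Q_sets[OF x] A by simp
        also have "\<dots> = (\<integral>\<^sup>+y. ennreal (f x) * (ennreal (G x y) * indicator A y) \<partial>K x)"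
          by (rule nn_integral_cmult[OF m1, symmetric])
        also have "\<dots> = (\<integral>\<^sup>+y. ennreal (F y) * indicator A y \<partial>K x)"
        proof (cases "f x > 0")
          case True
          have "ennreal (f x) * ennreal (G x y) = ennreal (F y)" for y
            using True pos[of y] by (simp add: G_def flip: ennreal_mult)
          then show ?thesis
            by (simp flip: mult.assoc)
        next
          case False
          then have f0: "f x = 0" using f_pos[of x] by simp
          show ?thesis
            using F0[OF x elim(1) f0] f0 by (intro nn_integral_cong_AE) (auto elim: eventually_mono)
        qed
        finally show ?case by simp
      qed
    qed
    also have "\<dots> = (\<integral>\<^sup>+x. emeasure (Q x) A \<partial>\<nu>)"
    proof -
      have eQ: "(\<lambda>x. emeasure (Q x) A) \<in> borel_measurable m"
        using measurable_prob_algebraD[OF Q] by measurable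
      show ?thesis
        unfolding \<nu>_def by (rule nn_integral_density[OF _ eQ, symmetric]) measurable
    qed
    also have "\<dots> = emeasure (\<nu> \<bind> Q) A"
      by (rule emeasure_bind_prob_algebra[OF \<nu> Q A, symmetric])
    finally show "emeasure (density (m \<bind> K) (\<lambda>y. ennreal (F y))) A = emeasure (\<nu> \<bind> Q) A" .
  qed
  have "(\<integral>\<^sup>+y. ennreal (entropy_fun (F y)) \<partial>(m \<bind> K)) = (\<integral>\<^sup>+x. \<integral>\<^sup>+y. ennreal (entropy_fun (F y)) \<partial>K x \<partial>m)"
    by (rule bind) measurable
  also have "\<dots> = (\<integral>\<^sup>+x. ennreal (entropy_fun (f x)) + ennreal (f x) * (\<integral>\<^sup>+y. ennreal (entropy_fun (G x y)) \<partial>K x) \<partial>m)"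
  proof (rule nn_integral_cong_AE)
    show "AE x in m. (\<integral>\<^sup>+y. ennreal (entropy_fun (F y)) \<partial>K x)
        = ennreal (entropy_fun (f x)) + ennreal (f x) * (\<integral>\<^sup>+y. ennreal (entropy_fun (G x y)) \<partial>K x)"
      using fI AE_space
    proof eventually_elim
      case (elim x)
      then have x: "x \<in> space X" by (simp add: m_space)
      show ?case
      proof (cases "f x > 0")
        case True
        have "F \<in> borel_measurable (K x)"
          using K_sets[OF x] by (simp cong: measurable_cong_sets)
        from nn_integral_entropy_fun_scale[OF K_prob[OF x] this pos _ True]
        show ?thesis
          using elim(1) True by (simp add: I_def G_def)
      next
        case False
        \<comment> \<open>A vanishing density contributes \<open>entropy_fun 0 = 1\<close> on both
          sides.\<close>
        then have f0: "f x = 0" using f_pos[of x] by simp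
        have "(\<integral>\<^sup>+y. ennreal (entropy_fun (F y)) \<partial>K x) = (\<integral>\<^sup>+y. 1 \<partial>K x)"
          using F0[OF x elim(1) f0]
          by (intro nn_integral_cong_AE) (auto elim: eventually_mono simp: entropy_fun_0)
        then show ?thesis
          using prob_space.emeasure_space_1[OF K_prob[OF x]] f0 by (simp add: entropy_fun_0)
      qed
    qed
  qed
  also have "\<dots> = (\<integral>\<^sup>+x. ennreal (entropy_fun (f x)) \<partial>m)
      + (\<integral>\<^sup>+x. ennreal (f x) * (\<integral>\<^sup>+y. ennreal (entropy_fun (G x y)) \<partial>K x) \<partial>m)"
    by (rule nn_integral_add) measurable
  also have "(\<integral>\<^sup>+x. ennreal (f x) * (\<integral>\<^sup>+y. ennreal (entropy_fun (G x y)) \<partial>K x) \<partial>m)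
      = (\<integral>\<^sup>+x. (\<integral>\<^sup>+y. ennreal (entropy_fun (G x y)) \<partial>K x) \<partial>density m (\<lambda>x. ennreal (f x)))"
    by (rule nn_integral_density[symmetric]) measurable
  finally show "(\<integral>\<^sup>+y. ennreal (entropy_fun (F y)) \<partial>(m \<bind> K)) = (\<integral>\<^sup>+x. ennreal (entropy_fun (f x)) \<partial>m)
      + (\<integral>\<^sup>+x. (\<integral>\<^sup>+y. ennreal (entropy_fun (G x y)) \<partial>K x) \<partial>density m (\<lambda>x. ennreal (f x)))" .
qed

section \<open>Path space\<close>

abbreviation path_space :: "real \<Rightarrow> (real \<Rightarrow> 'a::metric_space) set" where
  "path_space T \<equiv> mspace (path_metric T)"

abbreviation path_dist :: "real \<Rightarrow> (real \<Rightarrow> 'a::metric_space) \<Rightarrow> (real \<Rightarrow> 'a) \<Rightarrow> real" where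
  "path_dist T \<equiv> mdist (path_metric T)"

lemma openin_path_topology:
  "openin (mtopology_of (path_metric T)) U \<longleftrightarrow>
    U \<subseteq> path_space T \<and> (\<forall>\<xi>\<in>U. \<exists>r>0. \<forall>\<eta>\<in>path_space T. path_dist T \<xi> \<eta> < r \<longrightarrow> \<eta> \<in> U)"
proof -
  interpret Metric_space "path_space T" "path_dist T"
    by (rule Metric_space_mspace_mdist)
  show ?thesis
    unfolding mtopology_of_def openin_mtopology subset_eq in_mball Ball_def by blast
qed

lemma space_path_borel[simp]: "space (path_borel T) = path_space T"
  unfolding path_borel_def by (rule space_measure_of) (auto simp: openin_path_topology)

lemma sets_path_borel:
  "sets (path_borel T) = sigma_sets (path_space T) {U. openin (mtopology_of (path_metric T)) U}"
  unfolding path_borel_def by (rule sets_measure_of) (auto simp: openin_path_topology)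

text \<open>Compactness of the time interval bounds the distances along two paths, so the real
  supremum is a genuine one.\<close>

lemma path_dist_le_iff:
  assumes "0 \<le> T" "\<xi> \<in> path_space T" "\<eta> \<in> path_space T"
  shows "path_dist T \<xi> \<eta> \<le> c \<longleftrightarrow> (\<forall>t\<in>{0..T}. dist (\<xi> t) (\<eta> t) \<le> c)"
proof -
  have cont: "continuous_on {0..T} (\<lambda>t. dist (\<xi> t) (\<eta> t))"
    using assms by (intro continuous_on_dist) (auto simp: mspace_path_metric)
  then have "compact ((\<lambda>t. dist (\<xi> t) (\<eta> t)) ` {0..T})"
    by (intro compact_continuous_image) auto
  then have "bdd_above ((\<lambda>t. dist (\<xi> t) (\<eta> t)) ` {0..T})"
    by (intro bounded_imp_bdd_above compact_imp_bounded)
  then show ?thesis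
    using assms by (simp add: mdist_path_metric cSUP_le_iff)
qed

lemma dist_le_path_dist:
  assumes "\<xi> \<in> path_space T" "\<eta> \<in> path_space T" "t \<in> {0..T}"
  shows "dist (\<xi> t) (\<eta> t) \<le> path_dist T \<xi> \<eta>"
  using path_dist_le_iff[of T \<xi> \<eta> "path_dist T \<xi> \<eta>"] assms by auto

text \<open>Continuity carries a bound from the rational interior times to their closure
  \<open>{0..T}\<close>. Closed balls thereby become countable intersections of conditions on single
  coordinates.\<close>

lemma path_dist_le_iff_Rats:
  assumes T: "T > 0" and \<xi>: "\<xi> \<in> path_space T" and \<eta>: "\<eta> \<in> path_space T"
  shows "path_dist T \<xi> \<eta> \<le> c \<longleftrightarrow> (\<forall>t\<in>{0<..<T} \<inter> \<rat>. dist (\<xi> t) (\<eta> t) \<le> c)"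
proof -
  have cl: "closure ({0<..<T} \<inter> \<rat>) = {0..T}"
    using T by (simp add: closure_open_Int_superset Rats_closure_real)
  have cont: "continuous_on {0..T} (\<lambda>t. dist (\<xi> t) (\<eta> t))"
    using assms by (intro continuous_on_dist) (auto simp: mspace_path_metric)
  have "dist (\<xi> t) (\<eta> t) \<le> c" if "\<forall>t\<in>{0<..<T} \<inter> \<rat>. dist (\<xi> t) (\<eta> t) \<le> c" "t \<in> {0..T}" for t
    using continuous_le_on_closure[of "{0<..<T} \<inter> \<rat>" "\<lambda>t. dist (\<xi> t) (\<eta> t)" t c] cl cont that by auto
  then show ?thesis
    using T \<xi> \<eta> by (auto simp: path_dist_le_iff)
qed

text \<open>Evaluation is 1-Lipschitz for the uniform distance, so preimages of open sets are
  open.\<close>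

lemma eval_measurable:
  assumes t: "t \<in> {0..T}"
  shows "(\<lambda>\<xi>. \<xi> t :: 'a::metric_space) \<in> path_borel T \<rightarrow>\<^sub>M borel"
proof (rule borel_measurableI)
  fix U :: "'a set" assume U: "open U"
  have "openin (mtopology_of (path_metric T)) {\<xi> \<in> path_space T. \<xi> t \<in> U}"
    unfolding openin_path_topology
  proof (intro conjI ballI)
    fix \<xi> assume \<xi>: "\<xi> \<in> {\<xi> \<in> path_space T. \<xi> t \<in> U}"
    then obtain r where r: "r > 0" "\<And>y. dist y (\<xi> t) < r \<Longrightarrow> y \<in> U"
      using U by (auto simp: open_dist)
    have "\<eta> \<in> {\<xi> \<in> path_space T. \<xi> t \<in> U}" if "\<eta> \<in> path_space T" "path_dist T \<xi> \<eta> < r" for \<eta>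
      using r(2)[of "\<eta> t"] dist_le_path_dist[of \<xi> T \<eta> t] \<xi> that t by (auto simp: dist_commute)
    then show "\<exists>r>0. \<forall>\<eta>\<in>path_space T. path_dist T \<xi> \<eta> < r \<longrightarrow> \<eta> \<in> {\<xi> \<in> path_space T. \<xi> t \<in> U}"
      using r(1) by blast
  qed auto
  then have "{\<xi> \<in> path_space T. \<xi> t \<in> U} \<in> sets (path_borel T)"
    unfolding sets_path_borel by (intro sigma_sets.Basic) simp
  moreover have "(\<lambda>\<xi>. \<xi> t) -` U \<inter> space (path_borel T) = {\<xi> \<in> path_space T. \<xi> t \<in> U}"
    by auto
  ultimately show "(\<lambda>\<xi>. \<xi> t) -` U \<inter> space (path_borel T) \<in> sets (path_borel T)"
    by simp
qed

text \<open>A path is determined up to \<open>4 * r\<close> by a mesh on which it oscillates by less than \<open>r\<close> and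
  by points of a countable dense set near its values at the mesh points.\<close>

lemma path_space_countable_net:
  assumes T: "T > 0" and e: "e > 0"
  obtains A :: "(real \<Rightarrow> 'a::{metric_space, second_countable_topology}) set"
    where "countable A" "A \<subseteq> path_space T" "\<And>\<xi>. \<xi> \<in> path_space T \<Longrightarrow> \<exists>\<eta>\<in>A. path_dist T \<xi> \<eta> \<le> e"
proof -
  \<comment> \<open>Four errors add up: the oscillation of each path between \<open>t\<close> and a
    mesh point, and the distance of each path there to the common point
    \<open>xs ! i\<close>.\<close>
  define r where "r = e / 4"
  have r: "r > 0" and e4: "e = 4 * r"
    using e by (auto simp: r_def)
  obtain D :: "'a set" where D: "countable D" "\<And>X. open X \<Longrightarrow> X \<noteq> {} \<Longrightarrow> \<exists>d\<in>D. d \<in> X"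
    using countable_dense_exists by blast
  define cell where "cell n xs = {\<xi> \<in> path_space T.
      (\<forall>s\<in>{0..T}. \<forall>t\<in>{0..T}. \<bar>s - t\<bar> \<le> T / real n \<longrightarrow> dist (\<xi> s) (\<xi> t) < r)
      \<and> (\<forall>i\<le>n. dist (\<xi> (real i * T / real n)) (xs ! i) < r)}" for n :: nat and xs :: "'a list"
  have close: "path_dist T \<xi> \<eta> \<le> e" if \<xi>: "\<xi> \<in> cell n xs" and \<eta>: "\<eta> \<in> cell n xs" and n: "n > 0" for \<xi> \<eta> n xs
  proof -
    have "dist (\<xi> t) (\<eta> t) \<le> e" if t: "t \<in> {0..T}" for t
    proof -
      \<comment> \<open>The mesh point \<open>s\<close> with this index is the last one not
        exceeding \<open>t\<close>.\<close>
      define i where "i = nat \<lfloor>t * real n / T\<rfloor>"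
      define s where "s = real i * T / real n"
      have x0: "t * real n / T \<ge> 0" using t T by auto
      have i: "real i \<le> t * real n / T" "t * real n / T < real i + 1"
        using x0 unfolding i_def by linarith+
      have "t * real n / T \<le> real n"
        using t T by (simp add: divide_le_eq mult.commute mult_right_mono)
      then have "i \<le> n" using i by linarith
      have st: "s \<le> t" using i(1) n T by (simp add: s_def field_simps)
      have ts: "t - s \<le> T / real n"
      proof -
        have "t \<le> (real i + 1) * T / real n"
          using i(2) n T by (simp add: field_simps)
        then show ?thesis by (simp add: s_def distrib_right add_divide_distrib)
      qed
      have s: "s \<in> {0..T}" using st t T by (auto simp: s_def)
      have "dist (\<xi> t) (\<xi> s) < r" "dist (\<eta> s) (\<eta> t) < r" "dist (\<xi> s) (xs ! i) < r" "dist (\<eta> s) (xs ! i) < r"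
        using \<xi> \<eta> s t st ts \<open>i \<le> n\<close> by (auto simp: cell_def s_def)
      moreover have "dist (\<xi> t) (\<eta> t) \<le> dist (\<xi> t) (\<xi> s) + dist (\<xi> s) (xs ! i) + dist (\<eta> s) (xs ! i) + dist (\<eta> s) (\<eta> t)"
        using dist_triangle[of "\<xi> t" "\<eta> t" "\<xi> s"] dist_triangle[of "\<xi> s" "\<eta> t" "xs ! i"]
          dist_triangle[of "xs ! i" "\<eta> t" "\<eta> s"] by (simp add: dist_commute)
      ultimately show ?thesis unfolding e4 by linarith
    qed
    then show ?thesis
      using \<xi> \<eta> T by (simp add: path_dist_le_iff cell_def)
  qed
  have cover: "\<exists>n xs. n > 0 \<and> xs \<in> lists D \<and> \<xi> \<in> cell n xs" if \<xi>: "\<xi> \<in> path_space T" for \<xi>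
  proof -
    have "uniformly_continuous_on {0..T} \<xi>"
      using \<xi> by (intro compact_uniformly_continuous) (auto simp: mspace_path_metric)
    then obtain \<delta> where \<delta>: "\<delta> > 0" "\<And>s t. s \<in> {0..T} \<Longrightarrow> t \<in> {0..T} \<Longrightarrow> dist s t < \<delta> \<Longrightarrow> dist (\<xi> s) (\<xi> t) < r"
      using r unfolding uniformly_continuous_on_def by metis
    obtain n where n: "T / \<delta> < real n"
      using reals_Archimedean2 by blast
    then have n0: "n > 0"
      using T \<delta>(1) by (metis divide_pos_pos less_trans of_nat_0_less_iff)
    have small: "T / real n < \<delta>"
      using n n0 \<delta>(1) by (simp add: field_simps)
    have "\<exists>y\<in>D. dist (\<xi> (real i * T / real n)) y < r" for i
    proof -
      obtain y where "y \<in> D" "y \<in> ball (\<xi> (real i * T / real n)) r"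
        using D(2)[of "ball (\<xi> (real i * T / real n)) r"] r by auto
      then show ?thesis by auto
    qed
    then obtain y where y: "\<And>i. y i \<in> D" "\<And>i. dist (\<xi> (real i * T / real n)) (y i) < r"
      by metis
    \<comment> \<open>The mesh has \<open>n + 1\<close> points, both ends included.\<close>
    have "map y [0..<Suc n] \<in> lists D"
      using y(1) by auto
    moreover have "\<xi> \<in> cell n (map y [0..<Suc n])"
      using \<xi> y(2) \<delta>(2) small by (auto simp: cell_def dist_real_def simp del: upt_Suc)
    ultimately show ?thesis
      using n0 by blast
  qed
  define rep where "rep nx = (SOME \<xi>. \<xi> \<in> cell (fst nx) (snd nx))" for nx
  \<comment> \<open>Only inhabited cells are kept, so that \<open>rep\<close> picks a genuine path
    in each.\<close>
  define I where "I = {nx \<in> UNIV \<times> lists D. fst nx > 0 \<and> cell (fst nx) (snd nx) \<noteq> {}}"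
  have rep: "rep nx \<in> cell (fst nx) (snd nx)" if "nx \<in> I" for nx
    using that by (simp add: rep_def I_def some_in_eq)
  show thesis
  proof
    have "countable (UNIV \<times> lists D :: (nat \<times> 'a list) set)"
      using D(1) by auto
    then show "countable (rep ` I)"
      unfolding I_def by (intro countable_image) (rule countable_subset[rotated], auto)
    show "rep ` I \<subseteq> path_space T"
      using rep by (force simp: cell_def)
    fix \<xi> :: "real \<Rightarrow> 'a" assume \<xi>: "\<xi> \<in> path_space T"
    obtain n xs where "n > 0" "xs \<in> lists D" "\<xi> \<in> cell n xs"
      using cover[OF \<xi>] by blast
    then have "(n, xs) \<in> I" by (auto simp: I_def)
    with close[OF \<open>\<xi> \<in> cell n xs\<close> _ \<open>n > 0\<close>, of "rep (n, xs)"] rep[OF this]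
    show "\<exists>\<eta>\<in>rep ` I. path_dist T \<xi> \<eta> \<le> e"
      by auto
  qed
qed

section \<open>Cylinder sets and the Borel sigma-algebra of path space\<close>

definition cylinder :: "real \<Rightarrow> real set \<Rightarrow> (real \<Rightarrow> 'a::metric_space set) \<Rightarrow> (real \<Rightarrow> 'a) set" where
  "cylinder T F A = {\<xi> \<in> path_space T. \<forall>t\<in>F. \<xi> t \<in> A t}"

text \<open>Arbitrary finite sets of times, not only grids from 0 to \<open>T\<close>, make
  stability under intersection immediate: the time sets are united.\<close>

definition cylinders :: "real \<Rightarrow> (real \<Rightarrow> 'a::metric_space) set set" where
  "cylinders T = {cylinder T F A | F A. finite F \<and> F \<subseteq> {0..T} \<and> (\<forall>t\<in>F. A t \<in> sets borel)}"

lemma Int_stable_cylinders: "Int_stable (cylinders T)"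
proof (rule Int_stableI)
  fix a b :: "(real \<Rightarrow> 'a) set" assume "a \<in> cylinders T" "b \<in> cylinders T"
  then obtain F A G B where a: "a = cylinder T F A" "finite F" "F \<subseteq> {0..T}" "\<forall>t\<in>F. A t \<in> sets borel"
    and b: "b = cylinder T G B" "finite G" "G \<subseteq> {0..T}" "\<forall>t\<in>G. B t \<in> sets borel"
    unfolding cylinders_def by blast
  define C where "C t = (if t \<in> F then A t else UNIV) \<inter> (if t \<in> G then B t else UNIV)" for t
  have "a \<inter> b = cylinder T (F \<union> G) C"
    by (auto simp: a b cylinder_def C_def)
  moreover have "\<forall>t\<in>F \<union> G. C t \<in> sets borel"
    using a b by (auto simp: C_def)
  ultimately show "a \<inter> b \<in> cylinders T"
    unfolding cylinders_def using a b by blast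
qed

lemma cylinders_subset: "cylinders T \<subseteq> Pow (path_space T)"
  by (auto simp: cylinders_def cylinder_def)

lemma cylinder_measurable:
  assumes "finite F" "F \<subseteq> {0..T}" "\<And>t. t \<in> F \<Longrightarrow> A t \<in> sets borel"
  shows "cylinder T F A \<in> sets (path_borel T)"
proof -
  have "{\<xi> \<in> space (path_borel T). \<forall>t\<in>F. \<xi> t \<in> A t} \<in> sets (path_borel T)"
  proof (rule sets.sets_Collect_finite_All[OF _ assms(1)])
    fix t assume t: "t \<in> F"
    have "(\<lambda>\<xi>. \<xi> t) \<in> path_borel T \<rightarrow>\<^sub>M (borel :: 'a measure)"
      using assms(2) t by (intro eval_measurable) auto
    from measurable_sets[OF this assms(3)[OF t]]
    show "{\<xi> \<in> space (path_borel T). \<xi> t \<in> A t} \<in> sets (path_borel T)"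
      by (simp add: vimage_def Int_def conj_commute)
  qed
  then show ?thesis
    by (simp add: cylinder_def)
qed

text \<open>Closed balls lie in the cylinder sigma-algebra because rational times determine the
  uniform distance. By separability an open set is the union of the closed balls of radius
  \<open>1 / Suc k\<close> around net points that it contains, and these are countably many.\<close>

lemma sets_path_borel_cylinders:
  assumes T: "T > 0"
  shows "sets (path_borel T :: (real \<Rightarrow> 'a::{metric_space, second_countable_topology}) measure)
    = sigma_sets (path_space T) (cylinders T)"
proof
  show "sigma_sets (path_space T) (cylinders T) \<subseteq> sets (path_borel T :: (real \<Rightarrow> 'a) measure)"
    by (rule sets.sigma_sets_subset[where M="path_borel T", simplified])
      (auto simp: cylinders_def intro!: cylinder_measurable)
  interpret sigma_algebra "path_space T :: (real \<Rightarrow> 'a) set" "sigma_sets (path_space T) (cylinders T)"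
    by (rule sigma_algebra_sigma_sets[OF cylinders_subset])
  have ball: "{\<xi> \<in> path_space T. path_dist T \<xi> \<eta> \<le> c} \<in> sigma_sets (path_space T) (cylinders T)"
    if \<eta>: "\<eta> \<in> path_space T" for \<eta> :: "real \<Rightarrow> 'a" and c
  proof -
    have "{\<xi> \<in> path_space T. path_dist T \<xi> \<eta> \<le> c}
        = {\<xi> \<in> path_space T. \<forall>t\<in>{0<..<T} \<inter> \<rat>. dist (\<xi> t) (\<eta> t) \<le> c}"
      using path_dist_le_iff_Rats[OF T _ \<eta>] by auto
    also have "\<dots> \<in> sigma_sets (path_space T) (cylinders T)"
    proof (rule sets_Collect_countable_All')
      fix t assume "t \<in> {0<..<T} \<inter> \<rat>"
      then have "cylinder T {t} (\<lambda>t. {y. dist y (\<eta> t) \<le> c}) \<in> cylinders T"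
        unfolding cylinders_def
        by (auto intro!: exI[of _ "{t}"] exI[of _ "\<lambda>t. {y. dist y (\<eta> t) \<le> c}"])
      then show "{\<xi> \<in> path_space T. dist (\<xi> t) (\<eta> t) \<le> c} \<in> sigma_sets (path_space T) (cylinders T)"
        by (auto simp: cylinder_def intro: sigma_sets.Basic)
    qed (simp add: countable_rat)
    finally show ?thesis .
  qed
  show "sets (path_borel T :: (real \<Rightarrow> 'a) measure) \<subseteq> sigma_sets (path_space T) (cylinders T)"
    unfolding sets_path_borel
  proof (rule sigma_sets_mono, safe)
    fix U :: "(real \<Rightarrow> 'a) set" assume U: "openin (mtopology_of (path_metric T)) U"
    have "\<exists>A :: (real \<Rightarrow> 'a) set. countable A \<and> A \<subseteq> path_space T
        \<and> (\<forall>\<xi>\<in>path_space T. \<exists>\<eta>\<in>A. path_dist T \<xi> \<eta> \<le> 1 / real (Suc k))" for k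
      by (rule path_space_countable_net[OF T, of "1 / real (Suc k)"]) auto
    then obtain A :: "nat \<Rightarrow> (real \<Rightarrow> 'a) set" where A: "\<And>k. countable (A k)" "\<And>k. A k \<subseteq> path_space T"
      "\<And>k \<xi>. \<xi> \<in> path_space T \<Longrightarrow> \<exists>\<eta>\<in>A k. path_dist T \<xi> \<eta> \<le> 1 / real (Suc k)"
      by metis
    define B where "B k \<eta> = {\<xi> \<in> path_space T. path_dist T \<xi> \<eta> \<le> 1 / real (Suc k)}" for k and \<eta> :: "real \<Rightarrow> 'a"
    define I where "I = {k\<eta> \<in> Sigma UNIV A. B (fst k\<eta>) (snd k\<eta>) \<subseteq> U}"
    have "U = (\<Union>k\<eta>\<in>I. B (fst k\<eta>) (snd k\<eta>))"
    proof (intro equalityI subsetI)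
      fix \<xi> assume "\<xi> \<in> U"
      then have \<xi>: "\<xi> \<in> path_space T" and "\<exists>r>0. \<forall>\<eta>\<in>path_space T. path_dist T \<xi> \<eta> < r \<longrightarrow> \<eta> \<in> U"
        using U by (auto simp: openin_path_topology)
      then obtain r where r: "r > 0" "\<And>\<eta>. \<eta> \<in> path_space T \<Longrightarrow> path_dist T \<xi> \<eta> < r \<Longrightarrow> \<eta> \<in> U"
        by blast
      \<comment> \<open>All points of a ball of radius \<open>1 / Suc k\<close> that contains
        \<open>\<xi>\<close> are then closer than \<open>r\<close> to \<open>\<xi>\<close>.\<close>
      obtain k where k: "1 / real (Suc k) < r / 2"
        using r(1) nat_approx_posE[of "r / 2"] by (metis half_gt_zero)
      obtain \<eta> where \<eta>: "\<eta> \<in> A k" "path_dist T \<xi> \<eta> \<le> 1 / real (Suc k)"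
        using A(3)[OF \<xi>] by blast
      have \<eta>T: "\<eta> \<in> path_space T" using \<eta>(1) A(2) by blast
      have "B k \<eta> \<subseteq> U"
      proof
        fix \<zeta> assume "\<zeta> \<in> B k \<eta>"
        then have \<zeta>: "\<zeta> \<in> path_space T" "path_dist T \<zeta> \<eta> \<le> 1 / real (Suc k)"
          by (auto simp: B_def)
        have "path_dist T \<xi> \<zeta> \<le> path_dist T \<xi> \<eta> + path_dist T \<eta> \<zeta>"
          using mdist_triangle[OF \<xi> \<eta>T \<zeta>(1)] .
        then have "path_dist T \<xi> \<zeta> < r"
          using \<eta>(2) \<zeta>(2) k mdist_commute[of "path_metric T" \<eta> \<zeta>] by linarith
        then show "\<zeta> \<in> U" by (rule r(2)[OF \<zeta>(1)])
      qed
      then have "(k, \<eta>) \<in> I" using \<eta>(1) by (simp add: I_def)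
      moreover have "\<xi> \<in> B k \<eta>" using \<xi> \<eta>(2) by (simp add: B_def)
      ultimately show "\<xi> \<in> (\<Union>k\<eta>\<in>I. B (fst k\<eta>) (snd k\<eta>))" by force
    qed (auto simp: I_def)
    also have "\<dots> \<in> sigma_sets (path_space T) (cylinders T)"
    proof (rule countable_UN')
      have "countable (Sigma UNIV A)" using A(1) by auto
      then show "countable I" unfolding I_def by (rule countable_subset[rotated]) auto
      show "(\<lambda>k\<eta>. B (fst k\<eta>) (snd k\<eta>)) ` I \<subseteq> sigma_sets (path_space T) (cylinders T)"
        using ball A(2) by (force simp: B_def I_def)
    qed
    finally show "U \<in> sigma_sets (path_space T) (cylinders T)" .
  qed
qed

text \<open>Sublevel sets reduce to countably many conditions on pairs of coordinates, which belong
  to the product of the two sigma-algebras.\<close>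

lemma path_dist_measurable:
  assumes T: "T > 0"
  shows "(\<lambda>z. path_dist T (fst z) (snd z) :: real) \<in> borel_measurable
    (path_borel T \<Otimes>\<^sub>M (path_borel T :: (real \<Rightarrow> 'a::{metric_space, second_countable_topology}) measure))"
proof (rule borel_measurableI_le)
  fix c :: real
  let ?M = "path_borel T \<Otimes>\<^sub>M (path_borel T :: (real \<Rightarrow> 'a) measure)"
  have "{z \<in> space ?M. path_dist T (fst z) (snd z) \<le> c}
      = {z \<in> space ?M. \<forall>t\<in>{0<..<T} \<inter> \<rat>. dist (fst z t) (snd z t) \<le> c}"
    by (rule Collect_cong) (auto simp: space_pair_measure path_dist_le_iff_Rats[OF T])
  also have "\<dots> \<in> sets ?M"
  proof (rule sets.sets_Collect_countable_All')
    fix t assume "t \<in> {0<..<T} \<inter> \<rat>"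
    then have [measurable]: "(\<lambda>\<xi>. \<xi> t) \<in> path_borel T \<rightarrow>\<^sub>M (borel :: 'a measure)"
      by (intro eval_measurable) auto
    show "{z \<in> space ?M. dist (fst z t) (snd z t) \<le> c} \<in> sets ?M"
      by measurable
  qed (simp add: countable_rat)
  finally show "{z \<in> space ?M. path_dist T (fst z) (snd z) \<le> c} \<in> sets ?M" .
qed

lemma path_space_not_empty: "path_space T \<noteq> ({} :: (real \<Rightarrow> 'a::metric_space) set)"
proof -
  have "continuous_on {0..T} (\<lambda>t\<in>{0..T}. undefined :: 'a)"
    by (subst continuous_on_cong[OF refl, of _ _ "\<lambda>_. undefined"]) auto
  then have "(\<lambda>t\<in>{0..T}. undefined :: 'a) \<in> path_space T"
    by (simp add: mspace_path_metric)
  then show ?thesis by blast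
qed

lemma path_space_separable_metric_measurable:
  assumes T: "T > 0"
  shows "separable_metric_measurable
    (path_borel T :: (real \<Rightarrow> 'a::{metric_space, second_countable_topology}) measure) (path_dist T)"
proof
  fix \<xi> \<eta> :: "real \<Rightarrow> 'a" assume "\<xi> \<in> space (path_borel T)" "\<eta> \<in> space (path_borel T)"
  then show "0 \<le> path_dist T \<xi> \<eta>" "path_dist T \<xi> \<eta> = path_dist T \<eta> \<xi>"
    by (auto simp: mdist_commute)
next
  fix \<xi> \<eta> \<zeta> :: "real \<Rightarrow> 'a"
  assume "\<xi> \<in> space (path_borel T)" "\<eta> \<in> space (path_borel T)" "\<zeta> \<in> space (path_borel T)"
  then show "path_dist T \<xi> \<zeta> \<le> path_dist T \<xi> \<eta> + path_dist T \<eta> \<zeta>"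
    by (auto intro: mdist_triangle)
next
  show "(\<lambda>z. path_dist T (fst z) (snd z)) \<in> borel_measurable (path_borel T \<Otimes>\<^sub>M (path_borel T :: (real \<Rightarrow> 'a) measure))"
    by (rule path_dist_measurable[OF T])
next
  fix e :: real assume e: "e > 0"
  obtain A :: "(real \<Rightarrow> 'a) set" where A: "countable A" "A \<subseteq> path_space T"
    "\<And>\<xi>. \<xi> \<in> path_space T \<Longrightarrow> \<exists>\<eta>\<in>A. path_dist T \<xi> \<eta> \<le> e / 2"
    using path_space_countable_net[OF T, of "e / 2"] e by auto
  have "A \<noteq> {}"
    using A(3) path_space_not_empty[of T] by blast
  define a where "a = from_nat_into A"
  have a: "a n \<in> path_space T" for n
    using from_nat_into[OF \<open>A \<noteq> {}\<close>, of n] A(2) by (auto simp: a_def)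
  have a_surj: "\<exists>n. a n = \<eta>" if "\<eta> \<in> A" for \<eta>
    using from_nat_into_surj[OF A(1) that] by (simp add: a_def)
  define B where "B n = {\<xi> \<in> space (path_borel T). path_dist T \<xi> (a n) \<le> e / 2}" for n
  have "B n \<in> sets (path_borel T)" for n
  proof -
    have "(\<lambda>\<xi>. (\<xi>, a n)) \<in> path_borel T \<rightarrow>\<^sub>M path_borel T \<Otimes>\<^sub>M path_borel T"
      using a[of n] by (intro measurable_Pair measurable_ident_sets measurable_const) auto
    from measurable_compose[OF this path_dist_measurable[OF T]]
    have [measurable]: "(\<lambda>\<xi>. path_dist T \<xi> (a n)) \<in> borel_measurable (path_borel T)"
      by simp
    show ?thesis
      unfolding B_def by measurable
  qed
  moreover have "space (path_borel T) \<subseteq> (\<Union>n. B n)"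
    using A(3) a_surj by (fastforce simp: B_def)
  moreover have "path_dist T \<xi> \<eta> \<le> e" if "\<xi> \<in> B n" "\<eta> \<in> B n" for n \<xi> \<eta>
    using that mdist_triangle[of \<xi> "path_metric T" "a n" \<eta>] a[of n] mdist_commute[of "path_metric T" \<eta> "a n"]
    by (auto simp: B_def)
  ultimately show "\<exists>B :: nat \<Rightarrow> (real \<Rightarrow> 'a) set. (\<forall>n. B n \<in> sets (path_borel T)) \<and> space (path_borel T) \<subseteq> (\<Union>n. B n)
      \<and> (\<forall>n. \<forall>\<xi>\<in>B n. \<forall>\<eta>\<in>B n. path_dist T \<xi> \<eta> \<le> e)"
    by blast
qed

section \<open>Path laws\<close>

text \<open>\<open>is_path_law\<close> speaks only of strictly increasing grids from 0 to
  \<open>T\<close>. The times 0 and \<open>T\<close> are joined to \<open>F\<close>, unconstrained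
  where they are new, and sorting yields such a grid.\<close>

lemma cylinder_grid:
  fixes A :: "real \<Rightarrow> 'a::metric_space set"
  assumes T: "T > 0" and F: "finite F" "F \<subseteq> {0..T}" and A: "\<forall>t\<in>F. A t \<in> sets borel"
  obtains n :: nat and t B where "t 0 = 0" "t n = T" "\<And>i. i < n \<Longrightarrow> t i < t (i + 1)" "\<And>i. i \<le> n \<Longrightarrow> B i \<in> sets borel"
    "cylinder T F A = {\<xi> \<in> path_space T. \<forall>i\<le>n. \<xi> (t i) \<in> B i}"
proof -
  define l where "l = sorted_list_of_set (F \<union> {0, T})"
  define n where "n = length l - 1"
  define B where "B i = (if l ! i \<in> F then A (l ! i) else UNIV)" for i
  have set_l: "set l = F \<union> {0, T}"
    unfolding l_def using F(1) by (intro set_sorted_list_of_set) simp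
  have strict: "sorted_wrt (<) l"
    unfolding l_def by (rule strict_sorted_list_of_set)
  have less: "l ! i < l ! j" if "i < j" "j < length l" for i j
    using sorted_wrt_nth_less[OF strict that] .
  have len: "length l > 0"
    using set_l by (cases l) auto
  have range: "l ! i \<in> {0..T}" if "i < length l" for i
    using set_l nth_mem[OF that] F(2) T by auto
  have l0: "l ! 0 = 0"
  proof -
    obtain i where i: "i < length l" "l ! i = 0"
      using set_l by (metis UnI2 in_set_conv_nth insertI1)
    then show ?thesis
      using less[of 0 i] range[OF len] by (cases "i = 0") auto
  qed
  have ln: "l ! n = T"
  proof -
    obtain i where i: "i < length l" "l ! i = T"
      using set_l by (metis UnI2 in_set_conv_nth insertI1 insertI2)
    show ?thesis
    proof (cases "i = n")
      case False
      then have "i < n" "n < length l"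
        using i(1) len by (auto simp: n_def)
      then show ?thesis
        using less[of i n] range[of n] i(2) by auto
    qed (use i in simp)
  qed
  have "cylinder T F A = {\<xi> \<in> path_space T. \<forall>i\<le>n. \<xi> (l ! i) \<in> B i}"
  proof -
    have le_n: "i \<le> n \<longleftrightarrow> i < length l" for i
      using len unfolding n_def by linarith
    have "(\<forall>t\<in>F. \<xi> t \<in> A t) \<longleftrightarrow> (\<forall>i\<le>n. \<xi> (l ! i) \<in> B i)" for \<xi>
    proof -
      have "(\<forall>t\<in>F. \<xi> t \<in> A t) \<longleftrightarrow> (\<forall>t\<in>set l. t \<in> F \<longrightarrow> \<xi> t \<in> A t)"
        using set_l by auto
      also have "\<dots> \<longleftrightarrow> (\<forall>i\<le>n. \<xi> (l ! i) \<in> B i)"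
        by (auto simp: all_set_conv_all_nth le_n B_def)
      finally show ?thesis .
    qed
    then show ?thesis
      by (simp add: cylinder_def)
  qed
  moreover have "B i \<in> sets borel" for i
    using A by (simp add: B_def)
  ultimately show thesis
    using that[of "\<lambda>i. l ! i" n B] l0 ln less by (auto simp: n_def)
qed

text \<open>Increasing times keep the arguments of \<open>P\<close> nonnegative, where its kernels
  are measurable. The induction generalises \<open>i\<close> because the recursion shifts it by
  one.\<close>

lemma iterated_kernel_measurable:
  assumes P: "\<forall>s\<ge>0. P s \<in> borel \<rightarrow>\<^sub>M prob_algebra borel"
    and t: "\<And>j. i \<le> j \<Longrightarrow> j < i + k \<Longrightarrow> t j < t (j + 1)"
    and A: "\<And>j. i < j \<Longrightarrow> j \<le> i + k \<Longrightarrow> A j \<in> sets borel"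
  shows "iterated_kernel P t A i k \<in> borel_measurable borel"
  using t A
proof (induction k arbitrary: i)
  case (Suc k)
  have [measurable]: "iterated_kernel P t A (i + 1) k \<in> borel_measurable borel"
    using Suc.prems by (intro Suc.IH) auto
  have [measurable]: "A (i + 1) \<in> sets borel"
    using Suc.prems(2)[of "i + 1"] by simp
  have "P (t (i + 1) - t i) \<in> borel \<rightarrow>\<^sub>M subprob_algebra borel"
    using Suc.prems(1)[of i] P by (intro measurable_prob_algebraD) simp
  then have "(\<lambda>x. \<integral>\<^sup>+y. iterated_kernel P t A (i + 1) k y * indicator (A (i + 1)) y \<partial>P (t (i + 1) - t i) x)
      \<in> borel_measurable borel"
    by (rule measurable_compose) (rule nn_integral_measurable_subprob_algebra, measurable)
  then show ?case
    by simp
qed simp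

text \<open>The same \<open>g\<close> serves all \<open>\<mu>\<close> and \<open>Q\<close>. It gives
  uniqueness of the path law, measurability of \<open>path_law_at P T\<close> through Dirac
  measures, and the mixture formula.\<close>

lemma is_path_law_cylinder:
  assumes T: "T > 0" and P: "\<forall>s\<ge>0. P s \<in> borel \<rightarrow>\<^sub>M prob_algebra borel"
    and C: "C \<in> cylinders T"
  obtains g where "g \<in> borel_measurable borel" "\<And>\<mu> Q. is_path_law P T \<mu> Q \<Longrightarrow> emeasure Q C = (\<integral>\<^sup>+x. g x \<partial>\<mu>)"
proof -
  obtain F A where C: "C = cylinder T F A" and F: "finite F" "F \<subseteq> {0..T}" "\<forall>t\<in>F. A t \<in> sets borel"
    using C by (auto simp: cylinders_def)
  obtain n :: nat and t B where t: "t 0 = 0" "t n = T" "\<And>i. i < n \<Longrightarrow> t i < t (i + 1)" "\<And>i. i \<le> n \<Longrightarrow> B i \<in> sets borel"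
    and eq: "cylinder T F A = {\<xi> \<in> path_space T. \<forall>i\<le>n. \<xi> (t i) \<in> B i}"
    by (rule cylinder_grid[OF T F]) (rule that)
  have [measurable]: "iterated_kernel P t B 0 n \<in> borel_measurable borel"
    using t by (intro iterated_kernel_measurable P) auto
  have [measurable]: "B 0 \<in> sets borel"
    using t(4)[of 0] by simp
  show thesis
  proof
    show "(\<lambda>x. iterated_kernel P t B 0 n x * indicator (B 0) x) \<in> borel_measurable borel"
      by measurable
    fix \<mu> Q assume Q: "is_path_law P T \<mu> Q"
    then have "sets Q = sets (path_borel T)"
      by (simp add: is_path_law_def space_prob_algebra)
    then have "space Q = path_space T"
      using sets_eq_imp_space_eq[of Q "path_borel T"] by simp
    then show "emeasure Q C = (\<integral>\<^sup>+x. iterated_kernel P t B 0 n x * indicator (B 0) x \<partial>\<mu>)"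
      using Q t unfolding is_path_law_def C eq by auto
  qed
qed

lemma path_measure_eqI:
  fixes Q R :: "(real \<Rightarrow> 'a::{metric_space, second_countable_topology}) measure"
  assumes T: "T > 0"
    and Q: "Q \<in> space (prob_algebra (path_borel T))" and R: "R \<in> space (prob_algebra (path_borel T))"
    and eq: "\<And>C. C \<in> cylinders T \<Longrightarrow> emeasure Q C = emeasure R C"
  shows "Q = R"
proof (rule measure_eqI_generator_eq[where A="\<lambda>_. path_space T" and \<Omega>="path_space T",
      OF Int_stable_cylinders cylinders_subset eq])
  have sets: "sets Q = sets (path_borel T)" "sets R = sets (path_borel T)" and "prob_space Q"
    using Q R by (auto simp: space_prob_algebra)
  then show "sets Q = sigma_sets (path_space T) (cylinders T)" "sets R = sigma_sets (path_space T) (cylinders T)"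
    using sets_path_borel_cylinders[OF T] by auto
  have "path_space T = cylinder T {} (\<lambda>_. {})"
    by (auto simp: cylinder_def)
  then show "range (\<lambda>_. path_space T) \<subseteq> cylinders T"
    by (auto simp: cylinders_def intro!: exI[of _ "{}"])
  interpret prob_space Q by fact
  show "emeasure Q (path_space T) \<noteq> \<infinity>" for i :: nat
    by simp
qed auto

lemma is_path_law_unique:
  fixes P :: "real \<Rightarrow> 'a::polish_space \<Rightarrow> 'a measure"
  assumes T: "T > 0" and P: "\<forall>s\<ge>0. P s \<in> borel \<rightarrow>\<^sub>M prob_algebra borel"
    and Q: "is_path_law P T \<mu> Q" and R: "is_path_law P T \<mu> R"
  shows "Q = R"
proof (rule path_measure_eqI[OF T])
  fix C :: "(real \<Rightarrow> 'a) set" assume C: "C \<in> cylinders T"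
  obtain g where "\<And>\<mu> Q. is_path_law P T \<mu> Q \<Longrightarrow> emeasure Q C = (\<integral>\<^sup>+x. g x \<partial>\<mu>)"
    by (rule is_path_law_cylinder[OF T P C]) (rule that)
  from this[OF Q] this[OF R] show "emeasure Q C = emeasure R C"
    by simp
qed (use Q R in \<open>auto simp: is_path_law_def\<close>)

section \<open>Path laws of the given process as a measurable kernel\<close>

context
  fixes P :: "real \<Rightarrow> 'a::polish_space \<Rightarrow> 'a measure" and T :: real
  assumes T: "T > 0" and semigroup: "markov_semigroup P" and continuous: "continuous_markov P T"
begin

lemma kernel_measurable: "\<forall>s\<ge>0. P s \<in> borel \<rightarrow>\<^sub>M prob_algebra borel"
  using semigroup by (simp add: markov_semigroup_def)

lemma is_path_law_path_law:
  assumes "\<mu> \<in> space (prob_algebra borel)"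
  shows "is_path_law P T \<mu> (path_law P T \<mu>)"
  unfolding path_law_def
proof (rule theI')
  obtain Q where "is_path_law P T \<mu> Q"
    using continuous assms by (auto simp: continuous_markov_def)
  then show "\<exists>!Q. is_path_law P T \<mu> Q"
    using is_path_law_unique[OF T kernel_measurable] by blast
qed

lemma return_in_prob_algebra: "return borel x \<in> space (prob_algebra (borel :: 'a measure))"
  by (simp add: space_prob_algebra prob_space_return)

lemma path_law_prob_algebra:
  "\<mu> \<in> space (prob_algebra borel) \<Longrightarrow> path_law P T \<mu> \<in> space (prob_algebra (path_borel T))"
  using is_path_law_path_law by (auto simp: is_path_law_def)

text \<open>Measurability may be tested on the intersection-stable generator of cylinders, where the
  mass is \<open>g x\<close>, since integrating \<open>g\<close> against
  \<open>return borel x\<close> evaluates it.\<close>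

lemma path_law_at_measurable: "path_law_at P T \<in> borel \<rightarrow>\<^sub>M prob_algebra (path_borel T)"
proof (rule measurable_prob_algebra_generated[OF sets_path_borel_cylinders[OF T] Int_stable_cylinders cylinders_subset])
  fix x :: 'a
  show "prob_space (path_law_at P T x)" "sets (path_law_at P T x) = sets (path_borel T)"
    using path_law_prob_algebra[OF return_in_prob_algebra] by (auto simp: space_prob_algebra)
next
  fix C :: "(real \<Rightarrow> 'a) set" assume C: "C \<in> cylinders T"
  obtain g where g: "g \<in> borel_measurable borel"
    "\<And>\<mu> Q. is_path_law P T \<mu> Q \<Longrightarrow> emeasure Q C = (\<integral>\<^sup>+x. g x \<partial>\<mu>)"
    by (rule is_path_law_cylinder[OF T kernel_measurable C]) (rule that)
  have "emeasure (path_law_at P T x) C = g x" for x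
    using g(2)[OF is_path_law_path_law[OF return_in_prob_algebra]] g(1) by (simp add: nn_integral_return)
  then show "(\<lambda>x. emeasure (path_law_at P T x) C) \<in> borel_measurable borel"
    using g(1) by simp
qed

text \<open>On a cylinder both sides are the integral of the same \<open>g\<close> against
  \<open>\<mu>\<close>.\<close>

lemma path_law_eq_bind:
  assumes \<mu>: "\<mu> \<in> space (prob_algebra borel)"
  shows "path_law P T \<mu> = \<mu> \<bind> path_law_at P T"
proof (rule path_measure_eqI[OF T path_law_prob_algebra[OF \<mu>]])
  show "\<mu> \<bind> path_law_at P T \<in> space (prob_algebra (path_borel T))"
    using sets_bind'[OF \<mu> path_law_at_measurable] prob_space_bind'[OF \<mu> path_law_at_measurable]
    by (simp add: space_prob_algebra)
  fix C :: "(real \<Rightarrow> 'a) set" assume C: "C \<in> cylinders T"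
  obtain g where g: "g \<in> borel_measurable borel"
    "\<And>\<mu> Q. is_path_law P T \<mu> Q \<Longrightarrow> emeasure Q C = (\<integral>\<^sup>+x. g x \<partial>\<mu>)"
    by (rule is_path_law_cylinder[OF T kernel_measurable C]) (rule that)
  have "C \<in> sets (path_borel T)"
    using C by (auto simp: sets_path_borel_cylinders[OF T] intro: sigma_sets.Basic)
  then have "emeasure (\<mu> \<bind> path_law_at P T) C = (\<integral>\<^sup>+x. emeasure (path_law_at P T x) C \<partial>\<mu>)"
    by (rule emeasure_bind_prob_algebra[OF \<mu> path_law_at_measurable])
  also have "\<dots> = (\<integral>\<^sup>+x. g x \<partial>\<mu>)"
    using g(2)[OF is_path_law_path_law[OF return_in_prob_algebra]] g(1) by (simp add: nn_integral_return)
  finally show "emeasure (path_law P T \<mu>) C = emeasure (\<mu> \<bind> path_law_at P T) C"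
    using g(2)[OF is_path_law_path_law[OF \<mu>]] by simp
qed

lemma distr_path_law_initial:
  assumes \<mu>: "\<mu> \<in> space (prob_algebra borel)"
  shows "distr (path_law P T \<mu>) borel (\<lambda>\<xi>. \<xi> 0) = \<mu>"
proof (rule measure_eqI)
  have \<mu>_sets: "sets \<mu> = sets borel"
    using \<mu> by (simp add: space_prob_algebra)
  then show "sets (distr (path_law P T \<mu>) borel (\<lambda>\<xi>. \<xi> 0)) = sets \<mu>"
    by simp
  fix A assume "A \<in> sets (distr (path_law P T \<mu>) borel (\<lambda>\<xi>. \<xi> 0))"
  then have A: "A \<in> sets borel" by simp
  have law: "is_path_law P T \<mu> (path_law P T \<mu>)"
    by (rule is_path_law_path_law[OF \<mu>])
  then have sets: "sets (path_law P T \<mu>) = sets (path_borel T)"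
    by (simp add: is_path_law_def space_prob_algebra)
  have ev: "(\<lambda>\<xi>. \<xi> 0) \<in> path_law P T \<mu> \<rightarrow>\<^sub>M borel"
    using eval_measurable[of 0 T] T sets by (simp cong: measurable_cong_sets)
  \<comment> \<open>The shortest admissible grid consists of 0 and \<open>T\<close>; with
    \<open>UNIV\<close> at time \<open>T\<close> the transition kernel integrates to 1 and only the
    condition at time 0 remains.\<close>
  define t where "t i = (if i = 0 then 0 else T)" for i :: nat
  define B where "B i = (if i = 0 then A else UNIV)" for i :: nat
  have PT: "prob_space (P T x)" for x
    using measurable_space[OF kernel_measurable[rule_format, of T], of x] T by (simp add: space_prob_algebra)
  have "emeasure (distr (path_law P T \<mu>) borel (\<lambda>\<xi>. \<xi> 0)) A
      = emeasure (path_law P T \<mu>) {\<xi> \<in> space (path_law P T \<mu>). \<forall>i\<le>1. \<xi> (t i) \<in> B i}"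
    using A by (subst emeasure_distr[OF ev]) (auto intro!: arg_cong[where f="emeasure _"] simp: t_def B_def)
  also have "\<dots> = (\<integral>\<^sup>+x\<in>B 0. iterated_kernel P t B 0 1 x \<partial>\<mu>)"
  proof -
    have "t 0 = 0 \<and> t 1 = T \<and> (\<forall>i<1. t i < t (i + 1)) \<and> (\<forall>i\<le>1. B i \<in> sets borel)"
      using T A by (auto simp: t_def B_def)
    then show ?thesis
      using law unfolding is_path_law_def by blast
  qed
  also have "iterated_kernel P t B 0 1 = (\<lambda>x. 1)"
    using prob_space.emeasure_space_1[OF PT] by (simp add: t_def B_def)
  also have "(\<integral>\<^sup>+x\<in>B 0. 1 \<partial>\<mu>) = emeasure \<mu> A"
    using A \<mu>_sets by (simp add: B_def)
  finally show "emeasure (distr (path_law P T \<mu>) borel (\<lambda>\<xi>. \<xi> 0)) A = emeasure \<mu> A" .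
qed

end

section \<open>Transport-entropy inequalities for mixtures and images\<close>

lemma enn2ereal_cmult: "c \<ge> 0 \<Longrightarrow> enn2ereal (ennreal c * y) = ereal c * enn2ereal y"
  by (simp add: times_ennreal.rep_eq)

lemma enn2ereal_le_cmult_iff:
  "c \<ge> 0 \<Longrightarrow> enn2ereal x \<le> ereal c * enn2ereal y \<longleftrightarrow> x \<le> ennreal c * y"
  by (simp add: less_eq_ennreal.rep_eq enn2ereal_cmult)

lemma density_in_prob_algebra:
  assumes N: "N \<in> space (prob_algebra S)" and F: "F \<in> borel_measurable S"
    and one: "(\<integral>\<^sup>+x. ennreal (F x) \<partial>N) = 1"
  shows "density N (\<lambda>x. ennreal (F x)) \<in> space (prob_algebra S)"
proof -
  have N_sets[measurable_cong]: "sets N = sets S"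
    using N by (simp add: space_prob_algebra)
  note F[measurable]
  have "emeasure (density N (\<lambda>x. ennreal (F x))) (space N) = (\<integral>\<^sup>+x. ennreal (F x) * indicator (space N) x \<partial>N)"
    by (rule emeasure_density) auto
  also have "\<dots> = (\<integral>\<^sup>+x. ennreal (F x) \<partial>N)"
    by (intro nn_integral_cong) auto
  finally show ?thesis
    using one by (auto simp: space_prob_algebra N_sets intro!: prob_spaceI)
qed

text \<open>A coupling of \<open>Q\<close> and \<open>N\<close> is pushed forward by
  \<open>f\<close> in both coordinates; the cost does not grow, as \<open>f\<close> is 1-Lipschitz
  from \<open>d\<close> to \<open>\<rho>\<close>.\<close>

lemma transport_cost_distr_le:
  assumes Q: "Q \<in> space (prob_algebra S)" and N: "N \<in> space (prob_algebra S)"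
    and f[measurable]: "f \<in> S \<rightarrow>\<^sub>M X"
    and \<rho>_measurable: "(\<lambda>z. \<rho> (fst z) (snd z)) \<in> borel_measurable (X \<Otimes>\<^sub>M X)"
    and nonneg: "\<And>x y. 0 \<le> \<rho> x y"
    and le: "\<And>x y. x \<in> space S \<Longrightarrow> y \<in> space S \<Longrightarrow> \<rho> (f x) (f y) \<le> d x y"
  shows "transport_cost \<rho> (distr Q X f) (distr N X f) \<le> transport_cost d Q N"
  unfolding transport_cost_def[of d]
proof (rule INF_greatest)
  fix \<pi> assume \<pi>: "\<pi> \<in> couplings Q N"
  have sets: "sets Q = sets S" "sets N = sets S"
    using Q N by (auto simp: space_prob_algebra)
  have \<pi>_sets[measurable_cong]: "sets \<pi> = sets (S \<Otimes>\<^sub>M S)" and \<pi>_prob: "prob_space \<pi>"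
    and \<pi>1: "distr \<pi> S fst = Q" and \<pi>2: "distr \<pi> S snd = N"
    using \<pi> couplings_iff[OF sets] by auto
  have \<pi>_space: "space \<pi> = space S \<times> space S"
    using sets_eq_imp_space_eq[OF \<pi>_sets] by (simp add: space_pair_measure)
  define g where "g z = (f (fst z), f (snd z))" for z
  have g[measurable]: "g \<in> \<pi> \<rightarrow>\<^sub>M X \<Otimes>\<^sub>M X"
    unfolding g_def by measurable
  define \<pi>' where "\<pi>' = distr \<pi> (X \<Otimes>\<^sub>M X) g"
  have "distr \<pi>' X fst = distr \<pi> X (\<lambda>z. f (fst z))"
    unfolding \<pi>'_def by (subst distr_distr) (auto simp: comp_def g_def)
  also have "\<dots> = distr Q X f"
    unfolding \<pi>1[symmetric] by (subst distr_distr) (auto simp: comp_def)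
  finally have 1: "distr \<pi>' X fst = distr Q X f" .
  have "distr \<pi>' X snd = distr \<pi> X (\<lambda>z. f (snd z))"
    unfolding \<pi>'_def by (subst distr_distr) (auto simp: comp_def g_def)
  also have "\<dots> = distr N X f"
    unfolding \<pi>2[symmetric] by (subst distr_distr) (auto simp: comp_def)
  finally have 2: "distr \<pi>' X snd = distr N X f" .
  have "prob_space \<pi>'"
    unfolding \<pi>'_def by (rule prob_space.prob_space_distr[OF \<pi>_prob g])
  then have "\<pi>' \<in> couplings (distr Q X f) (distr N X f)"
    using couplings_iff[of "distr Q X f" X "distr N X f" \<pi>'] 1 2 by (simp add: \<pi>'_def)
  then have "transport_cost \<rho> (distr Q X f) (distr N X f) \<le> (\<integral>\<^sup>+z. ennreal ((\<rho> (fst z) (snd z))\<^sup>2) \<partial>\<pi>')"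
    by (rule transport_cost_le)
  also have "\<dots> = (\<integral>\<^sup>+z. ennreal ((\<rho> (fst (g z)) (snd (g z)))\<^sup>2) \<partial>\<pi>)"
    unfolding \<pi>'_def using \<rho>_measurable by (intro nn_integral_distr) measurable
  also have "\<dots> \<le> (\<integral>\<^sup>+z. ennreal ((d (fst z) (snd z))\<^sup>2) \<partial>\<pi>)"
    using le nonneg \<pi>_space by (intro nn_integral_mono ennreal_leI power_mono) (auto simp: g_def)
  finally show "transport_cost \<rho> (distr Q X f) (distr N X f) \<le> (\<integral>\<^sup>+(x, y). ennreal ((d x y)\<^sup>2) \<partial>\<pi>)"
    unfolding case_prod_beta .
qed

lemma transport_entropy_distr:
  assumes N: "N \<in> space (prob_algebra S)"
    and f[measurable]: "f \<in> S \<rightarrow>\<^sub>M X"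
    and \<rho>_measurable: "(\<lambda>z. \<rho> (fst z) (snd z)) \<in> borel_measurable (X \<Otimes>\<^sub>M X)"
    and nonneg: "\<And>x y. 0 \<le> \<rho> x y"
    and le: "\<And>x y. x \<in> space S \<Longrightarrow> y \<in> space S \<Longrightarrow> \<rho> (f x) (f y) \<le> d x y"
    and C: "C > 0"
    and T2: "\<And>Q. Q \<in> space (prob_algebra S) \<Longrightarrow>
      enn2ereal (transport_cost d Q N) \<le> ereal C * relative_entropy Q N"
    and \<nu>: "\<nu> \<in> space (prob_algebra X)"
  shows "enn2ereal (transport_cost \<rho> \<nu> (distr N X f)) \<le> ereal C * relative_entropy \<nu> (distr N X f)"
proof (cases "relative_entropy \<nu> (distr N X f) = \<infinity>")
  case True
  then show ?thesis using C by simp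
next
  case False
  define m where "m = distr N X f"
  have N_sets[measurable_cong]: "sets N = sets S" and N_prob: "prob_space N"
    using N by (auto simp: space_prob_algebra)
  have m_prob: "prob_space m"
    unfolding m_def by (rule prob_space.prob_space_distr[OF N_prob]) simp
  have "prob_space \<nu>" "sets \<nu> = sets m"
    using \<nu> by (auto simp: space_prob_algebra m_def)
  then obtain F where F: "F \<in> borel_measurable m" "\<And>x. F x \<ge> 0" "(\<integral>\<^sup>+x. ennreal (F x) \<partial>m) = 1"
    and \<nu>_eq: "\<nu> = density m (\<lambda>x. ennreal (F x))"
    using relative_entropy_finite_density[OF m_prob _ _ False[folded m_def]] by metis
  have F_meas[measurable]: "F \<in> borel_measurable X"
    using F(1) by (simp add: m_def)
  define Q where "Q = density N (\<lambda>y. ennreal (F (f y)))"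
  have Ff: "(\<integral>\<^sup>+y. ennreal (F (f y)) \<partial>N) = 1"
    using F(3) unfolding m_def by (subst (asm) nn_integral_distr) simp_all
  have Q: "Q \<in> space (prob_algebra S)"
    unfolding Q_def by (rule density_in_prob_algebra[OF N _ Ff]) measurable
  \<comment> \<open>A density that factors through \<open>f\<close> pushes forward to its factor on
    the image, so the lifted measure projects onto \<open>\<nu>\<close> itself.\<close>
  have Q_distr: "distr Q X f = \<nu>"
    unfolding \<nu>_eq m_def Q_def by (rule density_distr[symmetric]) measurable
  have "relative_entropy Q N = enn2ereal (\<integral>\<^sup>+y. ennreal (entropy_fun (F (f y))) \<partial>N)"
    unfolding Q_def using F(2) Ff by (intro relative_entropy_density[OF N_prob]) auto
  also have "(\<integral>\<^sup>+y. ennreal (entropy_fun (F (f y))) \<partial>N) = (\<integral>\<^sup>+x. ennreal (entropy_fun (F x)) \<partial>m)"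
    unfolding m_def by (rule nn_integral_distr[symmetric]) measurable
  also have "enn2ereal \<dots> = relative_entropy \<nu> m"
    unfolding \<nu>_eq using F by (intro relative_entropy_density[OF m_prob, symmetric]) auto
  finally have RE: "relative_entropy Q N = relative_entropy \<nu> m" .
  have "transport_cost \<rho> \<nu> m \<le> transport_cost d Q N"
    unfolding Q_distr[symmetric] m_def by (rule transport_cost_distr_le[OF Q N f \<rho>_measurable nonneg le])
  then have "enn2ereal (transport_cost \<rho> \<nu> m) \<le> enn2ereal (transport_cost d Q N)"
    by (simp add: less_eq_ennreal.rep_eq)
  also have "\<dots> \<le> ereal C * relative_entropy \<nu> m"
    using T2[OF Q] by (simp add: RE)
  finally show ?thesis
    by (simp add: m_def)
qed

section \<open>Moments of the kernels and the inequality for mixtures\<close>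

context separable_metric_measurable
begin

text \<open>Conditioning on a ball of positive mass produces a measure of finite entropy and bounded
  support, at finite transport cost.\<close>

lemma second_moment_finite:
  assumes N: "N \<in> space (prob_algebra S)" and z: "z \<in> space S"
    and cost: "\<And>Q. Q \<in> space (prob_algebra S) \<Longrightarrow> relative_entropy Q N \<noteq> \<infinity> \<Longrightarrow> transport_cost d Q N \<noteq> \<top>"
  shows "(\<integral>\<^sup>+y. ennreal ((d y z)\<^sup>2) \<partial>N) \<noteq> \<top>"
proof -
  have N_sets[measurable_cong]: "sets N = sets S" and N_prob: "prob_space N"
    using N by (auto simp: space_prob_algebra)
  interpret prob_space N by fact
  have N_space: "space N = space S"
    using N_sets by (rule sets_eq_imp_space_eq)
  note d_measurable_fst[OF z, measurable]
  define B where "B n = {y \<in> space S. d y z \<le> real n}" for n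
  have B[measurable]: "B n \<in> sets S" for n
    unfolding B_def by measurable
  have "\<exists>n. emeasure N (B n) \<noteq> 0"
  proof (rule ccontr)
    assume "\<not> ?thesis"
    then have "emeasure N (\<Union>n. B n) = 0"
      by (intro emeasure_UN_eq_0) (auto simp: N_sets)
    moreover have "(\<Union>n. B n) = space N"
      using real_arch_simple by (auto simp: B_def N_space)
    ultimately show False
      using emeasure_space_1 by simp
  qed
  then obtain n where n: "emeasure N (B n) \<noteq> 0" by blast
  define p where "p = measure N (B n)"
  have p: "p > 0" "emeasure N (B n) = ennreal p"
    using n by (auto simp: p_def emeasure_eq_measure zero_less_measure_iff)
  define F where "F y = indicator (B n) y / p" for y
  have F[measurable]: "F \<in> borel_measurable S"
    unfolding F_def by measurable
  have F_pos: "F y \<ge> 0" for y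
    using p by (simp add: F_def)
  have "(\<integral>\<^sup>+y. ennreal (F y) \<partial>N) = (\<integral>\<^sup>+y. ennreal (1 / p) * indicator (B n) y \<partial>N)"
    by (intro nn_integral_cong) (auto simp: F_def indicator_def)
  also have "\<dots> = ennreal (1 / p) * emeasure N (B n)"
    by (rule nn_integral_cmult_indicator) (simp add: N_sets)
  also have "\<dots> = 1"
    using p by (simp flip: ennreal_mult)
  finally have F1: "(\<integral>\<^sup>+y. ennreal (F y) \<partial>N) = 1" .
  \<comment> \<open>The density of the conditioned measure takes only the values 0 and
    \<open>1 / p\<close>, which bounds its entropy; its second moment about \<open>z\<close> is at
    most \<open>n\<^sup>2\<close>.\<close>
  define Q where "Q = density N (\<lambda>y. ennreal (F y))"
  have Q: "Q \<in> space (prob_algebra S)"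
    unfolding Q_def by (rule density_in_prob_algebra[OF N F F1])
  have "(\<integral>\<^sup>+y. ennreal (entropy_fun (F y)) \<partial>N) \<le> (\<integral>\<^sup>+y. ennreal (1 + entropy_fun (1 / p)) \<partial>N)"
    using entropy_fun_nonneg[of "1 / p"] p
    by (intro nn_integral_mono ennreal_leI) (auto simp: F_def indicator_def entropy_fun_0)
  also have "\<dots> < \<top>"
    by (simp add: emeasure_space_1)
  finally have "relative_entropy Q N \<noteq> \<infinity>"
    unfolding Q_def using F_pos F1 N_prob
    by (subst relative_entropy_density) (auto simp: less_top[symmetric] cong: measurable_cong_sets)
  then have cost': "transport_cost d Q N \<noteq> \<top>"
    by (rule cost[OF Q])
  have "(\<integral>\<^sup>+y. ennreal ((d y z)\<^sup>2) \<partial>Q) = (\<integral>\<^sup>+y. ennreal (F y) * ennreal ((d y z)\<^sup>2) \<partial>N)"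
    unfolding Q_def by (rule nn_integral_density) measurable
  also have "\<dots> \<le> (\<integral>\<^sup>+y. ennreal (F y) * ennreal ((real n)\<^sup>2) \<partial>N)"
  proof (rule nn_integral_mono)
    fix y assume "y \<in> space N"
    show "ennreal (F y) * ennreal ((d y z)\<^sup>2) \<le> ennreal (F y) * ennreal ((real n)\<^sup>2)"
    proof (cases "y \<in> B n")
      case True
      then have "(d y z)\<^sup>2 \<le> (real n)\<^sup>2"
        using d_nonneg[of y z] z by (intro power_mono) (auto simp: B_def)
      then show ?thesis by (intro mult_left_mono ennreal_leI) auto
    qed (simp add: F_def)
  qed
  also have "\<dots> = ennreal ((real n)\<^sup>2)"
    by (simp add: nn_integral_multc F1)
  finally have "(\<integral>\<^sup>+y. ennreal ((d y z)\<^sup>2) \<partial>Q) \<noteq> \<top>"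
    by (auto simp: top_unique)
  then show ?thesis
    using second_moment_finite_transfer[OF Q N z] cost' by blast
qed

text \<open>\<open>c1\<close> pays for changing the fibres from \<open>K\<close> to
  \<open>L'\<close>, \<open>c0 * c2\<close> for changing the initial law from \<open>m\<close> to
  \<open>\<nu>\<close>, and the chain rule splits the entropy into exactly these two shares.\<close>

lemma transport_entropy_bind:
  assumes c: "c0 > 0" "c1 > 0" "c2 > 0"
    and m: "m \<in> space (prob_algebra X)" and K: "K \<in> X \<rightarrow>\<^sub>M prob_algebra S"
    and \<rho>_measurable: "(\<lambda>z. \<rho> (fst z) (snd z)) \<in> borel_measurable (X \<Otimes>\<^sub>M X)"
    and T2_K: "\<And>x Q. x \<in> space X \<Longrightarrow> Q \<in> space (prob_algebra S) \<Longrightarrow>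
      enn2ereal (transport_cost d Q (K x)) \<le> ereal c1 * relative_entropy Q (K x)"
    and lip_K: "\<And>x y. x \<in> space X \<Longrightarrow> y \<in> space X \<Longrightarrow>
      transport_cost d (K x) (K y) \<le> ennreal (c2 * (\<rho> x y)\<^sup>2)"
    and T2_m: "\<And>\<nu>. \<nu> \<in> space (prob_algebra X) \<Longrightarrow>
      enn2ereal (transport_cost \<rho> \<nu> m) \<le> ereal c0 * relative_entropy \<nu> m"
    and Q: "Q \<in> space (prob_algebra S)"
  shows "enn2ereal (transport_cost d Q (m \<bind> K))
    \<le> ereal ((sqrt c1 + sqrt (c0 * c2))\<^sup>2) * relative_entropy Q (m \<bind> K)"
proof (cases "relative_entropy Q (m \<bind> K) = \<infinity>")
  case True
  have "(sqrt c1 + sqrt (c0 * c2))\<^sup>2 > 0"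
    using c by (intro zero_less_power add_pos_pos) auto
  then show ?thesis
    by (simp add: True)
next
  case False
  have m_sets[measurable_cong]: "sets m = sets X" and m_prob: "prob_space m"
    using m by (auto simp: space_prob_algebra)
  have m_space: "space m = space X"
    using m_sets by (rule sets_eq_imp_space_eq)
  have mK: "m \<bind> K \<in> space (prob_algebra S)"
    using prob_space_bind'[OF m K] sets_bind'[OF m K] by (simp add: space_prob_algebra)
  then have mK_prob: "prob_space (m \<bind> K)" and mK_sets: "sets (m \<bind> K) = sets S"
    by (auto simp: space_prob_algebra)
  have Kx: "K x \<in> space (prob_algebra S)" if "x \<in> space X" for x
    using measurable_space[OF K that] .
  have Kx_prob: "prob_space (K x)" and Kx_sets: "sets (K x) = sets S" if "x \<in> space X" for x
    using Kx[OF that] by (auto simp: space_prob_algebra)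
  obtain z where z: "z \<in> space S"
    using prob_algebra_not_empty[OF mK] by blast
  have Q': "prob_space Q" "sets Q = sets (m \<bind> K)"
    using Q mK_sets by (auto simp: space_prob_algebra)
  obtain F where F: "F \<in> borel_measurable (m \<bind> K)" "\<And>x. F x \<ge> 0" "(\<integral>\<^sup>+x. ennreal (F x) \<partial>(m \<bind> K)) = 1"
    and Q_eq: "Q = density (m \<bind> K) (\<lambda>x. ennreal (F x))"
    by (rule relative_entropy_finite_density[OF mK_prob Q' False]) (rule that)
  have F_meas: "F \<in> borel_measurable S"
    using F(1) mK_sets by (simp cong: measurable_cong_sets)
  obtain f :: "'a \<Rightarrow> real" and G :: "'a \<Rightarrow> 'b \<Rightarrow> real"
    where f[measurable]: "f \<in> borel_measurable X" and f_pos: "\<And>x. f x \<ge> 0" and f1: "(\<integral>\<^sup>+x. ennreal (f x) \<partial>m) = 1"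
    and G: "\<And>x. x \<in> space X \<Longrightarrow> G x \<in> borel_measurable S" and G_pos: "\<And>x y. G x y \<ge> 0"
    and G1: "\<And>x. x \<in> space X \<Longrightarrow> (\<integral>\<^sup>+y. ennreal (G x y) \<partial>K x) = 1"
    and L: "(\<lambda>x. density (K x) (\<lambda>y. ennreal (G x y))) \<in> X \<rightarrow>\<^sub>M prob_algebra S"
    and H[measurable]: "(\<lambda>x. \<integral>\<^sup>+y. ennreal (entropy_fun (G x y)) \<partial>K x) \<in> borel_measurable X"
    and disint: "density (m \<bind> K) (\<lambda>y. ennreal (F y))
      = density m (\<lambda>x. ennreal (f x)) \<bind> (\<lambda>x. density (K x) (\<lambda>y. ennreal (G x y)))"
    and chain: "(\<integral>\<^sup>+y. ennreal (entropy_fun (F y)) \<partial>(m \<bind> K)) = (\<integral>\<^sup>+x. ennreal (entropy_fun (f x)) \<partial>m)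
      + (\<integral>\<^sup>+x. (\<integral>\<^sup>+y. ennreal (entropy_fun (G x y)) \<partial>K x) \<partial>density m (\<lambda>x. ennreal (f x)))"
    by (rule entropy_disintegration[OF m K F_meas F(2,3)]) (rule that)
  define L' where "L' x = density (K x) (\<lambda>y. ennreal (G x y))" for x
  define \<nu> where "\<nu> = density m (\<lambda>x. ennreal (f x))"
  define Hx where "Hx x = (\<integral>\<^sup>+y. ennreal (entropy_fun (G x y)) \<partial>K x)" for x
  define E where "E = (\<integral>\<^sup>+y. ennreal (entropy_fun (F y)) \<partial>(m \<bind> K))"
  define Ef where "Ef = (\<integral>\<^sup>+x. ennreal (entropy_fun (f x)) \<partial>m)"
  define EG where "EG = (\<integral>\<^sup>+x. Hx x \<partial>\<nu>)"
  have E: "E = Ef + EG"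
    using chain by (simp add: E_def Ef_def EG_def Hx_def \<nu>_def)
  have L': "L' \<in> X \<rightarrow>\<^sub>M prob_algebra S"
    using L by (simp add: L'_def[abs_def])
  have Hx_meas[measurable]: "Hx \<in> borel_measurable X"
    using H by (simp add: Hx_def[abs_def])
  have \<nu>: "\<nu> \<in> space (prob_algebra X)"
    unfolding \<nu>_def by (rule density_in_prob_algebra[OF m f f1])
  have \<nu>_space: "space \<nu> = space X"
    by (simp add: \<nu>_def m_space)
  have \<nu>K: "\<nu> \<bind> K \<in> space (prob_algebra S)"
    using prob_space_bind'[OF \<nu> K] sets_bind'[OF \<nu> K] by (simp add: space_prob_algebra)
  have Q_bind: "Q = \<nu> \<bind> L'"
    using disint by (simp add: Q_eq \<nu>_def L'_def[abs_def])
  have RE_Q: "relative_entropy Q (m \<bind> K) = enn2ereal E"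
    unfolding Q_eq E_def by (rule relative_entropy_density[OF mK_prob F(1,2,3)])
  have RE_\<nu>: "relative_entropy \<nu> m = enn2ereal Ef"
    unfolding \<nu>_def Ef_def using f_pos f1 by (intro relative_entropy_density[OF m_prob]) auto
  have RE_L: "relative_entropy (L' x) (K x) = enn2ereal (Hx x)" if "x \<in> space X" for x
    unfolding L'_def Hx_def using G[OF that] G_pos G1[OF that] Kx_sets[OF that]
    by (intro relative_entropy_density[OF Kx_prob[OF that]]) (auto cong: measurable_cong_sets)
  have L'x: "L' x \<in> space (prob_algebra S)" if "x \<in> space X" for x
    using measurable_space[OF L' that] .
  have cost_L: "transport_cost d (L' x) (K x) \<le> ennreal c1 * Hx x" if "x \<in> space X" for x
    using T2_K[OF that L'x[OF that]] c by (simp add: RE_L[OF that] enn2ereal_le_cmult_iff)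
  \<comment> \<open>The transport inequality for \<open>K x\<close> yields finite cost for every
    \<open>R\<close> of finite entropy, as \<open>second_moment_finite\<close> demands.\<close>
  have mom_K: "(\<integral>\<^sup>+y. ennreal ((d y z)\<^sup>2) \<partial>K x) \<noteq> \<top>" if x: "x \<in> space X" for x
  proof (rule second_moment_finite[OF Kx[OF x] z])
    fix R assume R: "R \<in> space (prob_algebra S)" and fin: "relative_entropy R (K x) \<noteq> \<infinity>"
    have R': "prob_space R" "sets R = sets (K x)"
      using R Kx_sets[OF x] by (auto simp: space_prob_algebra)
    obtain h where h: "h \<in> borel_measurable (K x)" "\<And>y. h y \<ge> 0" "(\<integral>\<^sup>+y. ennreal (h y) \<partial>K x) = 1"
      and R_eq: "R = density (K x) (\<lambda>y. ennreal (h y))"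
      by (rule relative_entropy_finite_density[OF Kx_prob[OF x] R' fin]) (rule that)
    define e where "e = (\<integral>\<^sup>+y. ennreal (entropy_fun (h y)) \<partial>K x)"
    have "relative_entropy R (K x) = enn2ereal e"
      unfolding R_eq e_def by (rule relative_entropy_density[OF Kx_prob[OF x] h])
    then have "e \<noteq> \<top>" and "transport_cost d R (K x) \<le> ennreal c1 * e"
      using fin T2_K[OF x R] c by (auto simp: enn2ereal_le_cmult_iff)
    then show "transport_cost d R (K x) \<noteq> \<top>"
      by (auto simp: top_unique ennreal_mult_eq_top_iff)
  qed
  have EG_fin: "EG \<noteq> \<top>"
    using False E by (auto simp: RE_Q)
  have "AE x in \<nu>. Hx x \<noteq> \<top>"
    using nn_integral_PInf_AE[of Hx \<nu>] EG_fin by (simp add: EG_def \<nu>_def)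
  \<comment> \<open>A finite integral of the fibre entropies makes them finite for almost every
    \<open>x\<close>, hence the almost-everywhere form.\<close>
  then have mom_L: "AE x in \<nu>. (\<integral>\<^sup>+y. ennreal ((d y z)\<^sup>2) \<partial>L' x) \<noteq> \<top>"
    using AE_space
  proof eventually_elim
    case (elim x)
    then have x: "x \<in> space X" by (simp add: \<nu>_space)
    have "transport_cost d (L' x) (K x) \<noteq> \<top>"
      using cost_L[OF x] elim(1) by (auto simp: top_unique ennreal_mult_eq_top_iff)
    then show ?case
      using second_moment_finite_transfer[OF Kx[OF x] L'x[OF x] z] mom_K[OF x] by blast
  qed
  have cost1: "transport_cost d Q (\<nu> \<bind> K) \<le> ennreal c1 * EG"
  proof -
    have "transport_cost d (\<nu> \<bind> L') (\<nu> \<bind> K) \<le> (\<integral>\<^sup>+x. ennreal c1 * Hx x \<partial>\<nu>)"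
      by (rule transport_cost_bind_le[OF \<nu> L' K _ z _ mom_L])
        (auto intro!: AE_I2 cost_L mom_K simp: \<nu>_space)
    also have "\<dots> = ennreal c1 * EG"
      unfolding EG_def by (rule nn_integral_cmult) (simp add: \<nu>_def)
    finally show ?thesis
      by (simp add: Q_bind)
  qed
  \<comment> \<open>For any coupling \<open>\<pi>\<close> of \<open>\<nu>\<close> and
    \<open>m\<close>, both measures are mixtures over \<open>\<pi>\<close>, with kernels
    \<open>K (fst w)\<close> and \<open>K (snd w)\<close>; the Lipschitz bound is integrated against
    \<open>\<pi>\<close>.\<close>
  have cost2: "transport_cost d (\<nu> \<bind> K) (m \<bind> K) \<le> ennreal c2 * transport_cost \<rho> \<nu> m"
  proof -
    \<comment> \<open>Dividing by \<open>c2\<close> leaves the bare infimum over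
      \<open>\<pi>\<close> on the right, so that each coupling can be treated separately.\<close>
    have "ennreal (1 / c2) * transport_cost d (\<nu> \<bind> K) (m \<bind> K) \<le> transport_cost \<rho> \<nu> m"
      unfolding transport_cost_def[of \<rho>]
    proof (rule INF_greatest)
      fix \<pi> assume \<pi>: "\<pi> \<in> couplings \<nu> m"
      have sets: "sets \<nu> = sets X" "sets m = sets X"
        using \<nu> m by (auto simp: space_prob_algebra)
      have \<pi>_sets[measurable_cong]: "sets \<pi> = sets (X \<Otimes>\<^sub>M X)" and \<pi>_prob: "prob_space \<pi>"
        and \<pi>1: "distr \<pi> X fst = \<nu>" and \<pi>2: "distr \<pi> X snd = m"
        using \<pi> couplings_iff[OF sets] by auto
      have \<pi>': "\<pi> \<in> space (prob_algebra (X \<Otimes>\<^sub>M X))"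
        using \<pi>_sets \<pi>_prob by (simp add: space_prob_algebra)
      have \<pi>_space: "space \<pi> = space X \<times> space X"
        using sets_eq_imp_space_eq[OF \<pi>_sets] by (simp add: space_pair_measure)
      note \<rho>_measurable[measurable]
      have K1: "(\<lambda>w. K (fst w)) \<in> X \<Otimes>\<^sub>M X \<rightarrow>\<^sub>M prob_algebra S" and K2: "(\<lambda>w. K (snd w)) \<in> X \<Otimes>\<^sub>M X \<rightarrow>\<^sub>M prob_algebra S"
        using measurable_compose[OF measurable_fst K] measurable_compose[OF measurable_snd K] by auto
      have ne: "space \<pi> \<noteq> {}"
        using prob_space.not_empty[OF \<pi>_prob] .
      have bind1: "\<pi> \<bind> (\<lambda>w. K (fst w)) = \<nu> \<bind> K"
        unfolding \<pi>1[symmetric] using measurable_prob_algebraD[OF K] ne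
        by (subst bind_distr[where K=S]) (auto simp: comp_def)
      have bind2: "\<pi> \<bind> (\<lambda>w. K (snd w)) = m \<bind> K"
        unfolding \<pi>2[symmetric] using measurable_prob_algebraD[OF K] ne
        by (subst bind_distr[where K=S]) (auto simp: comp_def)
      have "transport_cost d (\<pi> \<bind> (\<lambda>w. K (fst w))) (\<pi> \<bind> (\<lambda>w. K (snd w)))
          \<le> (\<integral>\<^sup>+w. ennreal (c2 * (\<rho> (fst w) (snd w))\<^sup>2) \<partial>\<pi>)"
        by (rule transport_cost_bind_le[OF \<pi>' K1 K2 _ z])
          (auto intro!: AE_I2 lip_K mom_K simp: \<pi>_space)
      also have "\<dots> = ennreal c2 * (\<integral>\<^sup>+w. ennreal ((\<rho> (fst w) (snd w))\<^sup>2) \<partial>\<pi>)"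
        using c by (simp add: ennreal_mult nn_integral_cmult)
      finally have "ennreal (1 / c2) * transport_cost d (\<nu> \<bind> K) (m \<bind> K)
          \<le> ennreal (1 / c2) * (ennreal c2 * (\<integral>\<^sup>+w. ennreal ((\<rho> (fst w) (snd w))\<^sup>2) \<partial>\<pi>))"
        unfolding bind1 bind2 by (intro mult_left_mono) auto
      also have "\<dots> = (\<integral>\<^sup>+w. ennreal ((\<rho> (fst w) (snd w))\<^sup>2) \<partial>\<pi>)"
        using c by (simp flip: mult.assoc ennreal_mult)
      finally show "ennreal (1 / c2) * transport_cost d (\<nu> \<bind> K) (m \<bind> K)
          \<le> (\<integral>\<^sup>+(x, y). ennreal ((\<rho> x y)\<^sup>2) \<partial>\<pi>)"
        unfolding case_prod_beta .
    qed
    then have "ennreal c2 * (ennreal (1 / c2) * transport_cost d (\<nu> \<bind> K) (m \<bind> K))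
        \<le> ennreal c2 * transport_cost \<rho> \<nu> m"
      by (intro mult_left_mono) auto
    moreover have "ennreal c2 * (ennreal (1 / c2) * transport_cost d (\<nu> \<bind> K) (m \<bind> K))
        = transport_cost d (\<nu> \<bind> K) (m \<bind> K)"
      using c by (simp flip: mult.assoc ennreal_mult)
    ultimately show ?thesis by simp
  qed
  have cost3: "transport_cost \<rho> \<nu> m \<le> ennreal c0 * Ef"
    using T2_m[OF \<nu>] c by (simp add: RE_\<nu> enn2ereal_le_cmult_iff)
  define s where "s = sqrt c1"
  define t where "t = sqrt (c0 * c2)"
  have st: "s > 0" "t > 0" "s\<^sup>2 = c1" "t\<^sup>2 = c0 * c2"
    using c by (auto simp: s_def t_def)
  \<comment> \<open>The weight \<open>t / s\<close> produces the factors
    \<open>s\<^sup>2 + s * t\<close> and \<open>t\<^sup>2 + s * t\<close>, whose sum is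
    \<open>(s + t)\<^sup>2\<close>; each is therefore at most the constant claimed.\<close>
  have "transport_cost d Q (m \<bind> K) \<le> ennreal (1 + t / s) * transport_cost d Q (\<nu> \<bind> K)
      + ennreal (1 + 1 / (t / s)) * transport_cost d (\<nu> \<bind> K) (m \<bind> K)"
    using st by (intro transport_cost_triangle[OF Q \<nu>K mK]) simp
  also have "\<dots> \<le> ennreal (1 + t / s) * (ennreal c1 * EG)
      + ennreal (1 + 1 / (t / s)) * (ennreal c2 * (ennreal c0 * Ef))"
    by (intro add_mono mult_left_mono cost1 order_trans[OF cost2] cost3) auto
  also have "\<dots> = ennreal (s\<^sup>2 + s * t) * EG + ennreal (t\<^sup>2 + s * t) * Ef"
  proof -
    have "(1 + t / s) * c1 = s\<^sup>2 + s * t" "(1 + 1 / (t / s)) * (c2 * c0) = t\<^sup>2 + s * t"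
      unfolding mult.commute[of c2 c0] st(3,4)[symmetric] using st(1,2)
      by (simp_all add: field_simps power2_eq_square)
    moreover have "ennreal (1 + t / s) * (ennreal c1 * EG) = ennreal ((1 + t / s) * c1) * EG"
      using st c by (simp add: ennreal_mult mult.assoc)
    moreover have "ennreal (1 + 1 / (t / s)) * (ennreal c2 * (ennreal c0 * Ef))
        = ennreal ((1 + 1 / (t / s)) * (c2 * c0)) * Ef"
      using st c by (simp add: ennreal_mult mult.assoc)
    ultimately show ?thesis by simp
  qed
  also have "\<dots> \<le> ennreal ((s + t)\<^sup>2) * EG + ennreal ((s + t)\<^sup>2) * Ef"
    using st(1,2) by (intro add_mono mult_right_mono ennreal_leI) (auto simp: power2_sum)
  also have "\<dots> = ennreal ((s + t)\<^sup>2) * E"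
    by (simp add: E distrib_left add.commute)
  finally show ?thesis
    unfolding RE_Q by (simp add: enn2ereal_le_cmult_iff s_def t_def)
qed

end

theorem theorem2p1:
  fixes P :: "real \<Rightarrow> 'a::polish_space \<Rightarrow> 'a measure"
    and T c1 c2 :: real
    and \<mu> :: "'a measure"
  assumes "T > 0" and "c1 > 0" and "c2 > 0"
    and "markov_semigroup P"
    and "continuous_markov P T"
    and "\<And>x Q. Q \<in> space (prob_algebra (path_borel T)) \<Longrightarrow>
      enn2ereal ((W2_path T Q (path_law_at P T x))\<^sup>2)
        \<le> ereal c1 * relative_entropy Q (path_law_at P T x)"
    and "\<And>x y. (W2_path T (path_law_at P T x) (path_law_at P T y))\<^sup>2
        \<le> ennreal (c2 * (dist x y)\<^sup>2)"
    and "\<mu> \<in> space (prob_algebra borel)"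
  shows "(\<forall>c0>0.
      (\<forall>\<nu>\<in>space (prob_algebra borel).
        enn2ereal ((W2 \<nu> \<mu>)\<^sup>2) \<le> ereal c0 * relative_entropy \<nu> \<mu>) \<longrightarrow>
      (\<forall>Q\<in>space (prob_algebra (path_borel T)).
        enn2ereal ((W2_path T Q (path_law P T \<mu>))\<^sup>2)
          \<le> ereal ((sqrt c1 + sqrt (c0 * c2))\<^sup>2) * relative_entropy Q (path_law P T \<mu>)))
    \<and> (\<forall>C>0.
      (\<forall>Q\<in>space (prob_algebra (path_borel T)).
        enn2ereal ((W2_path T Q (path_law P T \<mu>))\<^sup>2)
          \<le> ereal C * relative_entropy Q (path_law P T \<mu>)) \<longrightarrow>
      (\<forall>\<nu>\<in>space (prob_algebra borel).
        enn2ereal ((W2 \<nu> \<mu>)\<^sup>2) \<le> ereal C * relative_entropy \<nu> \<mu>))"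
proof -
  interpret separable_metric_measurable "path_borel T :: (real \<Rightarrow> 'a) measure" "path_dist T"
    by (rule path_space_separable_metric_measurable[OF assms(1)])
  note law = assms(1,4,5)
  have dist_measurable: "(\<lambda>z. dist (fst z) (snd z) :: real) \<in> borel_measurable (borel \<Otimes>\<^sub>M (borel :: 'a measure))"
    by measurable
  show ?thesis
    unfolding wasserstein2_power2
  proof (intro conjI allI impI ballI)
    fix c0 :: real and Q :: "(real \<Rightarrow> 'a) measure"
    assume "c0 > 0" and \<mu>: "\<forall>\<nu>\<in>space (prob_algebra borel).
        enn2ereal (transport_cost dist \<nu> \<mu>) \<le> ereal c0 * relative_entropy \<nu> \<mu>"
      and Q: "Q \<in> space (prob_algebra (path_borel T))"
    show "enn2ereal (transport_cost (path_dist T) Q (path_law P T \<mu>))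
        \<le> ereal ((sqrt c1 + sqrt (c0 * c2))\<^sup>2) * relative_entropy Q (path_law P T \<mu>)"
      \<comment> \<open>As a mixture of the laws \<open>path_law_at P T x\<close> the path law falls
        under the inequality for mixtures, with \<open>dist\<close> as the distance between initial
        points.\<close>
      unfolding path_law_eq_bind[OF law assms(8)]
    proof (rule transport_entropy_bind[OF \<open>c0 > 0\<close> assms(2,3,8) path_law_at_measurable[OF law] dist_measurable
          _ _ _ Q])
      show "enn2ereal (transport_cost (path_dist T) R (path_law_at P T x))
          \<le> ereal c1 * relative_entropy R (path_law_at P T x)"
        if "R \<in> space (prob_algebra (path_borel T))" for x R
        using assms(6)[OF that] by (simp add: wasserstein2_power2)
      show "transport_cost (path_dist T) (path_law_at P T x) (path_law_at P T y) \<le> ennreal (c2 * (dist x y)\<^sup>2)" for x y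
        using assms(7) by (simp add: wasserstein2_power2)
    qed (use \<mu> in blast)
  next
    fix C :: real and \<nu> :: "'a measure"
    assume "C > 0" and Q: "\<forall>Q\<in>space (prob_algebra (path_borel T)).
        enn2ereal (transport_cost (path_dist T) Q (path_law P T \<mu>)) \<le> ereal C * relative_entropy Q (path_law P T \<mu>)"
      and \<nu>: "\<nu> \<in> space (prob_algebra borel)"
    have "enn2ereal (transport_cost dist \<nu> (distr (path_law P T \<mu>) borel (\<lambda>\<xi>. \<xi> 0)))
        \<le> ereal C * relative_entropy \<nu> (distr (path_law P T \<mu>) borel (\<lambda>\<xi>. \<xi> 0))"
    proof (rule transport_entropy_distr[OF path_law_prob_algebra[OF law assms(8)] eval_measurable
          dist_measurable _ _ \<open>C > 0\<close> _ \<nu>])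
      show "dist (\<xi> 0) (\<eta> 0) \<le> path_dist T \<xi> \<eta>"
        if "\<xi> \<in> space (path_borel T)" "\<eta> \<in> space (path_borel T)" for \<xi> \<eta> :: "real \<Rightarrow> 'a"
        using that assms(1) by (intro dist_le_path_dist) auto
    qed (use Q assms(1) in auto)
    then show "enn2ereal (transport_cost dist \<nu> \<mu>) \<le> ereal C * relative_entropy \<nu> \<mu>"
      by (simp add: distr_path_law_initial[OF law assms(8)])
  qed
qed

end
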